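(* Let $n\ge 1$ and $M\ge 1$. There exists a constant $C=C(n,M)>0$ such that the following holds. Let $f(x_1,\ldots,x_n)=\prod_{i=1}^n f_i(x_i)$, where for each $i$, $f_i\,d\gamma$ is a probability measure on $\mathbb{R}$ with $\int_{\mathbb{R}}|x|^2 f_i\,d\gamma\le M$, and suppose that $f\,d\gamma$ is a centered probability measure on $\mathbb{R}^n$ with $\sqrt f\in W^{1,2}(\mathbb{R}^n,d\gamma)$. Then $$\int_{\mathbb{R}^n} |f-1|\,d\gamma\le C\,\delta(f)^{\frac14}.$$
   Context: On $\mathbb{R}^n$, $d\gamma=(2\pi)^{-n/2}e^{-|x|^2/2}dx$ is the standard Gaussian measure (the same letter $\gamma$ is used in every dimension). For a probability measure $f\,d\gamma$ with $\sqrt f\in W^{1,2}(\mathbb{R}^n,d\gamma)$, the Fisher information is $\mathrm{I}(f)=\int \frac{|\nabla f|^2}{f}\,d\gamma$, the relative entropy is $\mathrm{H}(f)=\int f\log f\,d\gamma$, and the log-Sobolev deficit is $\delta(f)=\frac12 \mathrm{I}(f)-\mathrm{H}(f)\ge 0$. A probability measure $\mu$ is centered if $\int x\,d\mu=0$. *)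

theory Defs
  imports "HOL-Probability.Probability"
begin

definition gaussian :: "'a::euclidean_space measure" where
  "gaussian = density lborel
     (\<lambda>x. ennreal ((2 * pi) powr (- real DIM('a) / 2) * exp (- (norm x)\<^sup>2 / 2)))"

text \<open>Densities are regarded up to null sets, so nonnegativity is only required almost
  everywhere. It has to be stated, since \<^const>\<open>ennreal\<close> truncates negative values.\<close>

definition gaussian_prob_density :: "('a::euclidean_space \<Rightarrow> real) \<Rightarrow> bool" where
  "gaussian_prob_density f \<longleftrightarrow>
     f \<in> borel_measurable borel \<and>
     (AE x in gaussian. 0 \<le> f x) \<and>
     prob_space (density gaussian (\<lambda>x. ennreal (f x)))"

definition centered :: "'a::euclidean_space measure \<Rightarrow> bool" where
  "centered \<mu> \<longleftrightarrow> integrable \<mu> (\<lambda>x. x) \<and> (LINT x|\<mu>. x) = 0"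

fun C_k :: "nat \<Rightarrow> ('a::euclidean_space \<Rightarrow> real) \<Rightarrow> bool" where
  "C_k 0 \<phi> \<longleftrightarrow> continuous_on UNIV \<phi>"
| "C_k (Suc k) \<phi> \<longleftrightarrow>
     (\<forall>x. \<phi> differentiable (at x)) \<and>
     (\<forall>b\<in>Basis. C_k k (\<lambda>x. frechet_derivative \<phi> (at x) b))"

definition test_function :: "('a::euclidean_space \<Rightarrow> real) \<Rightarrow> bool" where
  "test_function \<phi> \<longleftrightarrow> (\<forall>k. C_k k \<phi>) \<and> compact (closure {x. \<phi> x \<noteq> 0})"

definition locally_integrable ::
    "('a::euclidean_space \<Rightarrow> 'b::{banach, second_countable_topology}) \<Rightarrow> bool" where
  "locally_integrable g \<longleftrightarrow>
     g \<in> borel_measurable borel \<and> (\<forall>K. compact K \<longrightarrow> set_integrable lborel K g)"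

text \<open>Weak derivatives are taken in the sense of distributions, hence with respect to
  Lebesgue measure; the Gaussian weight only enters the integrability conditions.\<close>

definition has_weak_gradient ::
    "('a::euclidean_space \<Rightarrow> real) \<Rightarrow> ('a \<Rightarrow> 'a) \<Rightarrow> bool" where
  "has_weak_gradient g G \<longleftrightarrow>
     locally_integrable g \<and> locally_integrable G \<and>
     (\<forall>\<phi>. test_function \<phi> \<longrightarrow> (\<forall>b\<in>Basis.
        (LINT x|lborel. g x * frechet_derivative \<phi> (at x) b) =
        - (LINT x|lborel. (G x \<bullet> b) * \<phi> x)))"

definition gaussian_W12 :: "('a::euclidean_space \<Rightarrow> real) set" where
  "gaussian_W12 = {g. \<exists>G. has_weak_gradient g G \<and>
     integrable gaussian (\<lambda>x. (g x)\<^sup>2) \<and>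
     integrable gaussian (\<lambda>x. (norm (G x))\<^sup>2)}"

text \<open>The weak gradient is unique almost everywhere. It exists for \<open>f\<close> when \<open>\<surd>f\<close> is in
  the Gaussian Sobolev space, namely as \<open>2 \<surd>f \<nabla>\<surd>f\<close>.\<close>

definition weak_gradient :: "('a::euclidean_space \<Rightarrow> real) \<Rightarrow> 'a \<Rightarrow> 'a" where
  "weak_gradient g = (SOME G. has_weak_gradient g G)"

text \<open>Where \<open>f\<close> vanishes, its weak gradient vanishes almost everywhere and the quotient is
  read as \<open>0\<close>; this is what \<open>x / 0 = 0\<close> gives. Likewise \<open>0 ln 0 = 0\<close> in the entropy. For
  \<open>\<surd>f\<close> in the Gaussian Sobolev space both integrands are integrable (the second one by the
  logarithmic Sobolev inequality).\<close>

definition fisher_information :: "('a::euclidean_space \<Rightarrow> real) \<Rightarrow> real" where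
  "fisher_information f = (LINT x|gaussian. (norm (weak_gradient f x))\<^sup>2 / f x)"

definition relative_entropy :: "('a::euclidean_space \<Rightarrow> real) \<Rightarrow> real" where
  "relative_entropy f = (LINT x|gaussian. f x * ln (f x))"

definition LSI_deficit :: "('a::euclidean_space \<Rightarrow> real) \<Rightarrow> real" where
  "LSI_deficit f = fisher_information f / 2 - relative_entropy f"

end

theory Submission
  imports Defs "HOL-Real_Asymp.Real_Asymp"
begin

text \<open>
  The estimate splits over the coordinates. For a product density the Fisher information and the
  entropy are sums over the factors, hence so is the deficit, and each one-dimensional deficit is
  nonnegative; the \<open>L\<^sup>1\<close> distance of the product from \<open>1\<close> is at most the sum of the distances
  of the factors from \<open>1\<close>. So the claim follows from a one-dimensional estimate
  (\<open>sobolev_density.L1_distance\<close>).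

  On the line let \<open>\<phi>\<close> be the Gaussian density, \<open>\<rho> = f \<phi>\<close>, \<open>F\<close> and \<open>\<Phi>\<close> the distribution
  functions of \<open>\<rho>\<close> and \<open>\<phi>\<close>, and \<open>T = \<Phi>\<^sup>-\<^sup>1 \<circ> F\<close> the increasing map that transports \<open>\<rho>\<close> to
  \<open>\<phi>\<close>, so that \<open>T' = \<rho> / \<phi>(T)\<close>. Put \<open>q = f' / \<surd>f + (T - x) \<surd>f\<close>. Expanding \<open>q\<^sup>2\<close>, integrating
  the mixed term by parts and using \<open>ln T' \<le> T' - 1\<close> turns \<open>\<integral> q\<^sup>2 \<phi>\<close> into at most twice the
  deficit \<open>\<delta>\<close> (\<open>energy_bound\<close>); this contains the logarithmic Sobolev inequality. The function
  \<open>q\<close> also controls how far \<open>\<rho>\<close> is from the Gaussian profile: \<open>(\<rho> - \<phi>(T))' = q \<surd>f \<phi>\<close>, and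
  Cauchy-Schwarz from either end of the line gives
  \<open>\<bar>\<rho> - \<phi>(T)\<bar> \<le> \<surd>(2 \<delta> min(F, 1 - F))\<close> (\<open>profile_distance\<close>).

  Let \<open>\<delta> \<le> s\<^sup>4\<close> with \<open>s\<close> small, and call the set \<open>s\<^sup>2 \<le> F \<le> 1 - s\<^sup>2\<close> the bulk. There
  \<open>\<phi>(T) \<ge> min(F, 1 - F) / 3\<close> dominates the error, so \<open>\<rho>\<close> is comparable to \<open>\<phi>(T)\<close> and
  \<open>T' - 1\<close> is small. Integrating \<open>T' - 1\<close> shows that \<open>T\<close> is within \<open>O(s)\<close> of a translation
  (\<open>deviation_from_shift\<close>). The translation is by the median; it is \<open>O(s)\<close> as well, because \<open>\<rho>\<close> is
  centered and, by the bound on the second moment, the part of the mean outside the bulk is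
  \<open>O(s)\<close> (\<open>median_small\<close>). So \<open>\<rho>\<close>, \<open>\<phi>(T)\<close> and \<open>\<phi>\<close> differ by \<open>O(s)\<close> in \<open>L\<^sup>1\<close> on the bulk,
  and outside it \<open>\<rho>\<close> has mass \<open>2 s\<^sup>2\<close> only. The exponent \<open>1/4\<close> is the choice \<open>s = \<delta>\<^sup>1\<^sup>/\<^sup>4\<close>.

  Only \<open>\<surd>f\<close> is assumed to be weakly differentiable, and only in \<open>n\<close> variables. Testing its weak
  gradient with products of test functions gives every \<open>\<surd>f\<^sub>i\<close> a weak derivative
  (\<open>ex_weak_derivative\<close>), the lemma of du Bois-Reymond makes \<open>\<surd>f\<^sub>i\<close> almost everywhere equal to an
  indefinite integral, and uniqueness of weak gradients identifies the gradients of \<open>\<surd>f\<close> and of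
  \<open>f\<close> with the expected products (\<open>G_coord_AE\<close>, \<open>weak_gradient_product\<close>).
\<close>

section \<open>Cauchy-Schwarz and indefinite integrals\<close>

lemma integrable_mult_square_integrable:
  fixes f g :: "'a \<Rightarrow> real"
  assumes [measurable]: "f \<in> borel_measurable M" "g \<in> borel_measurable M"
    and f: "integrable M (\<lambda>x. (f x)\<^sup>2)" and g: "integrable M (\<lambda>x. (g x)\<^sup>2)"
  shows "integrable M (\<lambda>x. f x * g x)"
proof (rule Bochner_Integration.integrable_bound)
  show "integrable M (\<lambda>x. (f x)\<^sup>2 + (g x)\<^sup>2)" using f g by auto
  have "\<bar>a * b\<bar> \<le> a\<^sup>2 + b\<^sup>2" for a b :: real
  proof -
    have "2 * (\<bar>a\<bar> * \<bar>b\<bar>) \<le> a\<^sup>2 + b\<^sup>2" using sum_squares_bound[of "\<bar>a\<bar>" "\<bar>b\<bar>"] by simp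
    moreover have "0 \<le> \<bar>a\<bar> * \<bar>b\<bar>" by simp
    ultimately have "\<bar>a\<bar> * \<bar>b\<bar> \<le> a\<^sup>2 + b\<^sup>2" by linarith
    then show ?thesis by (simp add: abs_mult)
  qed
  then show "AE x in M. norm (f x * g x) \<le> norm ((f x)\<^sup>2 + (g x)\<^sup>2)" by simp
qed auto

lemma Cauchy_Schwarz_integral:
  fixes f g :: "'a \<Rightarrow> real"
  assumes [measurable]: "f \<in> borel_measurable M" "g \<in> borel_measurable M"
    and f: "integrable M (\<lambda>x. (f x)\<^sup>2)" and g: "integrable M (\<lambda>x. (g x)\<^sup>2)"
  shows "\<bar>LINT x|M. f x * g x\<bar> \<le> sqrt (LINT x|M. (f x)\<^sup>2) * sqrt (LINT x|M. (g x)\<^sup>2)"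
proof -
  have fg: "integrable M (\<lambda>x. f x * g x)"
    by (rule integrable_mult_square_integrable) (use f g in auto)
  have n: "(\<integral>\<^sup>+x. ennreal \<bar>f x\<bar> * ennreal \<bar>g x\<bar> \<partial>M) = ennreal (LINT x|M. \<bar>f x * g x\<bar>)"
    using nn_integral_eq_integral[OF integrable_abs[OF fg]] by (simp add: abs_mult ennreal_mult)
  have "(\<integral>\<^sup>+x. ennreal \<bar>f x\<bar> * ennreal \<bar>g x\<bar> \<partial>M)\<^sup>2
      \<le> (\<integral>\<^sup>+x. ennreal \<bar>f x\<bar> ^ 2 \<partial>M) * (\<integral>\<^sup>+x. ennreal \<bar>g x\<bar> ^ 2 \<partial>M)"
    by (rule Cauchy_Schwarz_nn_integral) auto
  also have "(\<integral>\<^sup>+x. ennreal \<bar>f x\<bar> ^ 2 \<partial>M) = ennreal (LINT x|M. (f x)\<^sup>2)"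
    using nn_integral_eq_integral[OF f] by (simp add: ennreal_power)
  also have "(\<integral>\<^sup>+x. ennreal \<bar>g x\<bar> ^ 2 \<partial>M) = ennreal (LINT x|M. (g x)\<^sup>2)"
    using nn_integral_eq_integral[OF g] by (simp add: ennreal_power)
  finally have "(LINT x|M. \<bar>f x * g x\<bar>)\<^sup>2 \<le> (LINT x|M. (f x)\<^sup>2) * (LINT x|M. (g x)\<^sup>2)"
    unfolding n by (simp add: ennreal_power ennreal_mult[symmetric])
  then have "(LINT x|M. \<bar>f x * g x\<bar>) \<le> sqrt ((LINT x|M. (f x)\<^sup>2) * (LINT x|M. (g x)\<^sup>2))"
    by (intro real_le_rsqrt)
  moreover have "\<bar>LINT x|M. f x * g x\<bar> \<le> (LINT x|M. \<bar>f x * g x\<bar>)" by (rule integral_abs_bound)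
  ultimately show ?thesis unfolding real_sqrt_mult by linarith
qed

lemma abs_le_1_plus_square: "\<bar>x\<bar> \<le> 1 + x\<^sup>2" for x :: real
proof -
  have "0 \<le> (\<bar>x\<bar> - 1)\<^sup>2" by simp
  then have "2 * \<bar>x\<bar> \<le> 1 + x\<^sup>2" by (simp add: power2_diff)
  then show ?thesis using abs_ge_zero[of x] by linarith
qed

text \<open>Absolute continuity of \<open>V\<close> on \<open>[a, b]\<close> with derivative \<open>g\<close>, in integral form: \<open>g\<close> may be
  changed on null sets, and nothing is said about pointwise derivatives of \<open>V\<close>.\<close>

definition primitive_on :: "real \<Rightarrow> real \<Rightarrow> (real \<Rightarrow> real) \<Rightarrow> (real \<Rightarrow> real) \<Rightarrow> bool" where
  "primitive_on a b V g \<longleftrightarrow> set_integrable lborel {a..b} g \<and>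
     (\<forall>x\<in>{a..b}. V x - V a = (LINT s:{a..x}|lborel. g s))"

lemma primitive_onI:
  assumes "set_integrable lborel {a..b} g"
    and "\<And>x. a \<le> x \<Longrightarrow> x \<le> b \<Longrightarrow> V x - V a = (LINT s:{a..x}|lborel. g s)"
  shows "primitive_on a b V g"
  using assms by (simp add: primitive_on_def)

lemma primitive_on_integrable: "primitive_on a b V g \<Longrightarrow> set_integrable lborel {a..b} g"
  unfolding primitive_on_def by (rule conjunct1)

lemma set_integral_Icc_split:
  fixes g :: "real \<Rightarrow> real"
  assumes g: "set_integrable lborel {a..b} g" and "a \<le> x" "x \<le> y" "y \<le> b"
  shows "(LINT s:{a..y}|lborel. g s) = (LINT s:{a..x}|lborel. g s) + (LINT s:{x..y}|lborel. g s)"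
proof -
  have i: "set_integrable lborel {c..d} g" if "a \<le> c" "d \<le> b" for c d
    by (rule set_integrable_subset[OF g]) (use that in auto)
  have *: "(LINT s:{c..d}|lborel. g s) = integral {c..d} g" if "a \<le> c" "d \<le> b" for c d
    by (rule set_borel_integral_eq_integral(2)) (use i that in auto)
  have "g integrable_on {a..y}"
    by (rule set_borel_integral_eq_integral(1)) (use i assms in auto)
  then show ?thesis using assms by (simp add: * Henstock_Kurzweil_Integration.integral_combine)
qed

lemma primitive_on_diff:
  assumes "primitive_on a b V g" "a \<le> x" "x \<le> y" "y \<le> b"
  shows "V y - V x = (LINT s:{x..y}|lborel. g s)"
proof -
  have "\<forall>x\<in>{a..b}. V x - V a = (LINT s:{a..x}|lborel. g s)"
    using assms(1) unfolding primitive_on_def by (rule conjunct2)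
  from bspec[OF this, of x] bspec[OF this, of y]
  have "V x - V a = (LINT s:{a..x}|lborel. g s)" "V y - V a = (LINT s:{a..y}|lborel. g s)"
    using assms(2-4) by simp_all
  with set_integral_Icc_split[OF primitive_on_integrable[OF assms(1)] assms(2-4)]
  show ?thesis by linarith
qed

lemma primitive_on_subset:
  assumes "primitive_on a b V g" "a \<le> c" "c \<le> d" "d \<le> b"
  shows "primitive_on c d V g"
proof (rule primitive_onI)
  show "set_integrable lborel {c..d} g"
    by (rule set_integrable_subset[OF primitive_on_integrable[OF assms(1)]]) (use assms in auto)
  show "V x - V c = (LINT s:{c..x}|lborel. g s)" if "c \<le> x" "x \<le> d" for x
    by (rule primitive_on_diff[OF assms(1)]) (use assms that in auto)
qed

lemma primitive_on_continuous:
  assumes "primitive_on a b V g"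
  shows "continuous_on {a..b} V"
proof -
  have g: "set_integrable lborel {a..b} g" by (rule primitive_on_integrable[OF assms])
  have c1: "continuous_on {a..b} (\<lambda>x. V a + integral {a..x} g)"
    by (intro continuous_intros indefinite_integral_continuous_1 set_borel_integral_eq_integral(1)[OF g])
  have c2: "V a + integral {a..x} g = V x" if "x \<in> {a..b}" for x
  proof -
    have "set_integrable lborel {a..x} g"
      by (rule set_integrable_subset[OF g]) (use that in auto)
    from this have "(LINT s:{a..x}|lborel. g s) = integral {a..x} g"
      by (rule set_borel_integral_eq_integral(2))
    moreover have "V x - V a = (LINT s:{a..x}|lborel. g s)"
      by (rule primitive_on_diff[OF assms]) (use that in auto)
    ultimately show ?thesis by linarith
  qed
  show ?thesis by (rule continuous_on_eq[OF c1]) (rule c2)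
qed

lemma continuous_on_UNIV_if_primitive_on:
  assumes "\<And>a b. a \<le> b \<Longrightarrow> primitive_on a b V g"
  shows "continuous_on UNIV V"
proof -
  have "isCont V x" for x
  proof -
    have "continuous_on {x - 1..x + 1} V" by (rule primitive_on_continuous[OF assms]) simp
    then show ?thesis by (rule continuous_on_interior) simp
  qed
  then show ?thesis by (intro continuous_at_imp_continuous_on) auto
qed

lemma primitive_on_has_derivative:
  assumes V: "\<And>a b. a \<le> b \<Longrightarrow> primitive_on a b V g" and g: "continuous_on UNIV g"
  shows "(V has_real_derivative g x) (at x)"
proof -
  have *: "V y = V (x - 1) + integral {x - 1..y} g" if "y \<in> {x - 1..x + 1}" for y
  proof -
    have "primitive_on (x - 1) y V g" using that by (intro V) simp
    then have "V y - V (x - 1) = (LINT s:{x - 1..y}|lborel. g s)"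
      by (rule primitive_on_diff) (use that in auto)
    also have "\<dots> = integral {x - 1..y} g"
      by (rule set_borel_integral_eq_integral(2)[OF borel_integrable_atLeastAtMost'])
        (rule continuous_on_subset[OF g], simp)
    finally show ?thesis by simp
  qed
  have "((\<lambda>y. integral {x - 1..y} g) has_real_derivative g x) (at x within {x - 1..x + 1})"
    by (rule integral_has_real_derivative) (auto intro: continuous_on_subset[OF g])
  then have "((\<lambda>y. integral {x - 1..y} g) has_real_derivative g x) (at x)"
    using at_within_Icc_at[of "x - 1" x "x + 1"] by simp
  then have "((\<lambda>y. V (x - 1) + integral {x - 1..y} g) has_real_derivative g x) (at x)"
    by (auto intro!: derivative_eq_intros)
  moreover have "(V has_real_derivative g x) (at x) \<longleftrightarrow>
     ((\<lambda>y. V (x - 1) + integral {x - 1..y} g) has_real_derivative g x) (at x)"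
  proof (rule DERIV_cong_ev[OF refl _ refl])
    have "eventually (\<lambda>y. y \<in> {x - 1<..<x + 1}) (nhds x)"
      by (rule eventually_nhds_in_open) auto
    then show "\<forall>\<^sub>F y in nhds x. V y = V (x - 1) + integral {x - 1..y} g"
      by (rule eventually_mono) (rule *, auto)
  qed
  ultimately show ?thesis by simp
qed

lemma primitive_on_C1:
  assumes "\<And>x. a \<le> x \<Longrightarrow> x \<le> b \<Longrightarrow> (V has_real_derivative g x) (at x)"
    and "continuous_on {a..b} g"
  shows "primitive_on a b V g"
proof (rule primitive_onI)
  show "set_integrable lborel {a..b} g" by (rule borel_integrable_atLeastAtMost'[OF assms(2)])
  show "V x - V a = (LINT s:{a..x}|lborel. g s)" if "a \<le> x" "x \<le> b" for x
  proof -
    have "(V has_vector_derivative g y) (at y within {a..x})" if "a \<le> y" "y \<le> x" for y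
      using has_field_derivative_at_within[OF assms(1)[of y]] that \<open>x \<le> b\<close>
      by (auto simp: has_real_derivative_iff_has_vector_derivative)
    moreover have "continuous_on {a..x} g"
      using continuous_on_subset[OF assms(2), of "{a..x}"] that by auto
    ultimately show ?thesis
      unfolding set_lebesgue_integral_def using that(1)
      by (intro integral_FTC_atLeastAtMost[symmetric]) auto
  qed
qed

lemma set_integrable_mult_continuous:
  fixes g V :: "real \<Rightarrow> real"
  assumes g: "set_integrable lborel {a..b} g" and V: "continuous_on {a..b} V"
  shows "set_integrable lborel {a..b} (\<lambda>x. g x * V x)"
proof -
  obtain K where K: "\<And>x. x \<in> {a..b} \<Longrightarrow> \<bar>V x\<bar> \<le> K"
    using compact_imp_bounded[OF compact_continuous_image[OF V compact_Icc]]
    unfolding bounded_iff by (metis imageI real_norm_def)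
  have V': "(\<lambda>x. indicator {a..b} x * V x) \<in> borel_measurable borel"
    using borel_measurable_continuous_on_indicator[OF _ V] by simp
  have g': "(\<lambda>x. indicator {a..b} x * g x) \<in> borel_measurable lborel"
    using g unfolding set_integrable_def by auto
  have "integrable lborel (\<lambda>x. (indicator {a..b} x * g x) * (indicator {a..b} x * V x))"
  proof (rule Bochner_Integration.integrable_bound)
    show "integrable lborel (\<lambda>x. K * (indicator {a..b} x * g x))"
      using g unfolding set_integrable_def by simp
    show "AE x in lborel. norm (indicator {a..b} x * g x * (indicator {a..b} x * V x))
        \<le> norm (K * (indicator {a..b} x * g x))"
    proof (rule AE_I2)
      fix x
      have "\<bar>V x\<bar> * \<bar>g x\<bar> \<le> \<bar>K\<bar> * \<bar>g x\<bar>" if "x \<in> {a..b}"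
        using K[OF that] by (intro mult_right_mono) auto
      then show "norm (indicator {a..b} x * g x * (indicator {a..b} x * V x))
        \<le> norm (K * (indicator {a..b} x * g x))"
        by (cases "x \<in> {a..b}") (simp_all add: abs_mult mult.commute)
    qed
  qed (use V' g' in measurable)
  moreover have "(\<lambda>x. (indicator {a..b} x * g x) * (indicator {a..b} x * V x))
      = (\<lambda>x. indicator {a..b} x *\<^sub>R (g x * V x))" by (auto simp: indicator_def)
  ultimately show ?thesis unfolding set_integrable_def by simp
qed

text \<open>Both integrals on the right are double integrals of \<open>g(s) h(t)\<close>, over \<open>t \<le> s\<close> and over \<open>s \<le> t\<close>
  (after \<open>V\<close> and \<open>W\<close> are replaced by their increments from \<open>a\<close>). Together these two triangles
  fill the square and overlap in the diagonal, a null set.\<close>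

lemma primitive_on_mult_at_end:
  assumes "a \<le> b" and V: "primitive_on a b V g" and W: "primitive_on a b W h"
  shows "V b * W b - V a * W a = (LINT s:{a..b}|lborel. g s * W s + h s * V s)"
proof -
  define G where "G = (\<lambda>s. indicator {a..b} s * g s)"
  define H where "H = (\<lambda>s. indicator {a..b} s * h s)"
  have G: "integrable lborel G" using primitive_on_integrable[OF V] unfolding set_integrable_def G_def by simp
  have H: "integrable lborel H" using primitive_on_integrable[OF W] unfolding set_integrable_def H_def by simp
  have [measurable]: "G \<in> borel_measurable lborel" "H \<in> borel_measurable lborel" using G H by auto
  have GH: "integrable (lborel \<Otimes>\<^sub>M lborel) (\<lambda>z. G (fst z) * H (snd z))"
  proof (rule lborel_pair.Fubini_integrable)
    show "integrable lborel (\<lambda>x. LINT y|lborel. norm (G (fst (x, y)) * H (snd (x, y))))"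
      using G H by (simp add: abs_mult)
    show "AE x in lborel. integrable lborel (\<lambda>y. G (fst (x, y)) * H (snd (x, y)))"
      using H by simp
  qed measurable
  have GH1: "integrable (lborel \<Otimes>\<^sub>M lborel) (\<lambda>z. G (fst z) * H (snd z) * (if snd z \<le> fst z then 1 else 0))"
  proof (rule Bochner_Integration.integrable_bound[OF GH])
    show "(\<lambda>z. G (fst z) * H (snd z) * (if snd z \<le> fst z then 1 else 0)) \<in> borel_measurable (lborel \<Otimes>\<^sub>M lborel)"
      by measurable
  qed auto
  have GH2: "integrable (lborel \<Otimes>\<^sub>M lborel) (\<lambda>z. G (fst z) * H (snd z) * (if fst z \<le> snd z then 1 else 0))"
  proof (rule Bochner_Integration.integrable_bound[OF GH])
    show "(\<lambda>z. G (fst z) * H (snd z) * (if fst z \<le> snd z then 1 else 0)) \<in> borel_measurable (lborel \<Otimes>\<^sub>M lborel)"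
      by measurable
  qed auto
  have Wx: "(LINT t|lborel. H t * (if t \<le> s then 1 else 0)) = W s - W a" if "s \<in> {a..b}" for s
  proof -
    have "(LINT t|lborel. H t * (if t \<le> s then 1 else 0)) = (LINT t:{a..s}|lborel. h t)"
      unfolding set_lebesgue_integral_def H_def using that
      by (intro Bochner_Integration.integral_cong) (auto simp: indicator_def)
    also have "\<dots> = W s - W a" using primitive_on_diff[OF W, of a s] that by simp
    finally show ?thesis .
  qed
  have Vx: "(LINT t|lborel. G t * (if t \<le> s then 1 else 0)) = V s - V a" if "s \<in> {a..b}" for s
  proof -
    have "(LINT t|lborel. G t * (if t \<le> s then 1 else 0)) = (LINT t:{a..s}|lborel. g t)"
      unfolding set_lebesgue_integral_def G_def using that
      by (intro Bochner_Integration.integral_cong) (auto simp: indicator_def)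
    also have "\<dots> = V s - V a" using primitive_on_diff[OF V, of a s] that by simp
    finally show ?thesis .
  qed
  have Vb: "(LINT t|lborel. G t) = V b - V a"
    using primitive_on_diff[OF V, of a b] \<open>a \<le> b\<close> unfolding G_def set_lebesgue_integral_def by simp
  have Wb: "(LINT t|lborel. H t) = W b - W a"
    using primitive_on_diff[OF W, of a b] \<open>a \<le> b\<close> unfolding H_def set_lebesgue_integral_def by simp
  have i1: "(LINT z|(lborel \<Otimes>\<^sub>M lborel). G (fst z) * H (snd z) * (if snd z \<le> fst z then 1 else 0))
      = (LINT s|lborel. G s * (W s - W a))"
  proof -
    have "(LINT z|(lborel \<Otimes>\<^sub>M lborel). G (fst z) * H (snd z) * (if snd z \<le> fst z then 1 else 0))
       = (LINT s|lborel. LINT t|lborel. G s * (H t * (if t \<le> s then 1 else 0)))"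
      using lborel_pair.integral_fst'[OF GH1] by (simp add: mult.assoc)
    also have "\<dots> = (LINT s|lborel. G s * (LINT t|lborel. H t * (if t \<le> s then 1 else 0)))" by simp
    also have "\<dots> = (LINT s|lborel. G s * (W s - W a))"
    proof (rule Bochner_Integration.integral_cong[OF refl])
      fix s show "G s * (LINT t|lborel. H t * (if t \<le> s then 1 else 0)) = G s * (W s - W a)"
        by (cases "s \<in> {a..b}") (simp_all only: Wx, simp add: G_def)
    qed
    finally show ?thesis .
  qed
  have i2: "(LINT z|(lborel \<Otimes>\<^sub>M lborel). G (fst z) * H (snd z) * (if fst z \<le> snd z then 1 else 0))
      = (LINT s|lborel. H s * (V s - V a))"
  proof -
    have "(LINT z|(lborel \<Otimes>\<^sub>M lborel). G (fst z) * H (snd z) * (if fst z \<le> snd z then 1 else 0))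
       = (LINT t|lborel. LINT s|lborel. G s * H t * (if s \<le> t then 1 else 0))"
      using lborel_pair.integral_snd[of "\<lambda>s t. G s * H t * (if s \<le> t then 1 else 0)"] GH2
      unfolding case_prod_beta by simp
    also have "\<dots> = (LINT t|lborel. H t * (LINT s|lborel. G s * (if s \<le> t then 1 else 0)))"
      by (subst Bochner_Integration.integral_mult_right_zero[symmetric]) (simp add: ac_simps)
    also have "\<dots> = (LINT s|lborel. H s * (V s - V a))"
    proof (rule Bochner_Integration.integral_cong[OF refl])
      fix s show "H s * (LINT t|lborel. G t * (if t \<le> s then 1 else 0)) = H s * (V s - V a)"
        by (cases "s \<in> {a..b}") (simp_all only: Vx, simp add: H_def)
    qed
    finally show ?thesis .
  qed
  have i3: "(LINT z|(lborel \<Otimes>\<^sub>M lborel). G (fst z) * H (snd z)) = (V b - V a) * (W b - W a)"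
    using lborel_pair.integral_fst'[OF GH] by (simp add: Vb Wb)
  have i4: "(LINT z|(lborel \<Otimes>\<^sub>M lborel). G (fst z) * H (snd z) * (if snd z \<le> fst z then 1 else 0))
      + (LINT z|(lborel \<Otimes>\<^sub>M lborel). G (fst z) * H (snd z) * (if fst z \<le> snd z then 1 else 0))
      = (LINT z|(lborel \<Otimes>\<^sub>M lborel). G (fst z) * H (snd z))"
  proof -
    have "(LINT z|(lborel \<Otimes>\<^sub>M lborel). G (fst z) * H (snd z) * (if snd z \<le> fst z then 1 else 0))
      + (LINT z|(lborel \<Otimes>\<^sub>M lborel). G (fst z) * H (snd z) * (if fst z \<le> snd z then 1 else 0))
      = (LINT z|(lborel \<Otimes>\<^sub>M lborel). G (fst z) * H (snd z) * (if snd z \<le> fst z then 1 else 0)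
           + G (fst z) * H (snd z) * (if fst z \<le> snd z then 1 else 0))"
      by (rule Bochner_Integration.integral_add[OF GH1 GH2, symmetric])
    also have "\<dots> = (LINT s|lborel. LINT t|lborel. G s * H t * (if t \<le> s then 1 else 0)
           + G s * H t * (if s \<le> t then 1 else 0))"
      using lborel_pair.integral_fst'[OF Bochner_Integration.integrable_add[OF GH1 GH2]] by simp
    also have "\<dots> = (LINT s|lborel. LINT t|lborel. G s * H t)"
    proof (rule Bochner_Integration.integral_cong[OF refl])
      fix s :: real
      have "AE t in lborel. G s * H t * (if t \<le> s then 1 else 0) + G s * H t * (if s \<le> t then 1 else 0)
          = G s * H t"
        by (rule eventually_mono[OF AE_lborel_singleton[of s]]) auto
      then show "(LINT t|lborel. G s * H t * (if t \<le> s then 1 else 0) + G s * H t * (if s \<le> t then 1 else 0))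
        = (LINT t|lborel. G s * H t)"
        by (intro integral_cong_AE) (measurable)
    qed
    also have "\<dots> = (LINT z|(lborel \<Otimes>\<^sub>M lborel). G (fst z) * H (snd z))"
      using lborel_pair.integral_fst'[OF GH] by simp
    finally show ?thesis .
  qed
  have sG: "set_integrable lborel {a..b} (\<lambda>s. g s * W s)"
    by (intro set_integrable_mult_continuous primitive_on_integrable[OF V] primitive_on_continuous[OF W])
  have sH: "set_integrable lborel {a..b} (\<lambda>s. h s * V s)"
    by (intro set_integrable_mult_continuous primitive_on_integrable[OF W] primitive_on_continuous[OF V])
  have iG: "integrable lborel (\<lambda>s. G s * W s)" and iH: "integrable lborel (\<lambda>s. H s * V s)"
    using sG sH by (simp_all add: set_integrable_def G_def H_def mult.assoc)
  have "(LINT s|lborel. G s * (W s - W a)) = (LINT s|lborel. G s * W s) - (V b - V a) * W a"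
    using iG G by (simp add: right_diff_distrib Vb)
  moreover have "(LINT s|lborel. H s * (V s - V a)) = (LINT s|lborel. H s * V s) - (W b - W a) * V a"
    using iH H by (simp add: right_diff_distrib Wb)
  ultimately have "V b * W b - V a * W a = (LINT s|lborel. G s * W s) + (LINT s|lborel. H s * V s)"
    using i1 i2 i3 i4 by (simp add: algebra_simps)
  also have "\<dots> = (LINT s|lborel. G s * W s + H s * V s)" using iG iH by simp
  also have "\<dots> = (LINT s:{a..b}|lborel. g s * W s + h s * V s)"
    unfolding set_lebesgue_integral_def G_def H_def by (simp add: algebra_simps)
  finally show ?thesis .
qed

lemma primitive_on_mult:
  assumes V: "primitive_on a b V g" and W: "primitive_on a b W h"
  shows "primitive_on a b (\<lambda>x. V x * W x) (\<lambda>x. g x * W x + h x * V x)"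
proof (rule primitive_onI)
  show "set_integrable lborel {a..b} (\<lambda>x. g x * W x + h x * V x)"
    by (rule set_integral_add(1)[OF
          set_integrable_mult_continuous[OF primitive_on_integrable[OF V] primitive_on_continuous[OF W]]
          set_integrable_mult_continuous[OF primitive_on_integrable[OF W] primitive_on_continuous[OF V]]])
  show "V x * W x - V a * W a = (LINT s:{a..x}|lborel. g s * W s + h s * V s)" if "a \<le> x" "x \<le> b" for x
    by (rule primitive_on_mult_at_end[OF that(1) primitive_on_subset[OF V] primitive_on_subset[OF W]])
      (use that in auto)
qed

lemma primitive_on_diff_fun:
  assumes V: "primitive_on a b V g" and W: "primitive_on a b W h"
  shows "primitive_on a b (\<lambda>x. V x - W x) (\<lambda>x. g x - h x)"
proof (rule primitive_onI)
  show "set_integrable lborel {a..b} (\<lambda>x. g x - h x)"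
    by (rule set_integral_diff(1)[OF primitive_on_integrable[OF V] primitive_on_integrable[OF W]])
  show "V x - W x - (V a - W a) = (LINT s:{a..x}|lborel. g s - h s)" if "a \<le> x" "x \<le> b" for x
  proof -
    have "set_integrable lborel {a..x} g" "set_integrable lborel {a..x} h"
      using primitive_on_integrable[OF primitive_on_subset[OF V, of a x]]
        primitive_on_integrable[OF primitive_on_subset[OF W, of a x]] that by auto
    moreover have "V x - V a = (LINT s:{a..x}|lborel. g s)" "W x - W a = (LINT s:{a..x}|lborel. h s)"
      using primitive_on_diff[OF V, of a x] primitive_on_diff[OF W, of a x] that by auto
    ultimately show ?thesis by (simp add: set_integral_diff)
  qed
qed

lemma primitive_on_cong:
  assumes "primitive_on a b V g" "\<And>x. a \<le> x \<Longrightarrow> x \<le> b \<Longrightarrow> V x = V' x"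
    "\<And>x. a \<le> x \<Longrightarrow> x \<le> b \<Longrightarrow> g x = g' x"
  shows "primitive_on a b V' g'"
proof (rule primitive_onI)
  show "set_integrable lborel {a..b} g'"
    using primitive_on_integrable[OF assms(1)] set_integrable_cong[of lborel lborel "{a..b}" "{a..b}" g g']
      assms(3) by auto
  show "V' x - V' a = (LINT s:{a..x}|lborel. g' s)" if "a \<le> x" "x \<le> b" for x
  proof -
    have "(LINT s:{a..x}|lborel. g' s) = (LINT s:{a..x}|lborel. g s)"
      by (rule set_lebesgue_integral_cong) (use that assms(3) in auto)
    moreover have "V x - V a = (LINT s:{a..x}|lborel. g s)"
      using primitive_on_diff[OF assms(1), of a x] that by auto
    moreover have "V x = V' x" "V a = V' a" using assms(2)[of x] assms(2)[of a] that by auto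
    ultimately show ?thesis by simp
  qed
qed

section \<open>Distribution functions and the Gaussian profile\<close>

definition cumulative :: "(real \<Rightarrow> real) \<Rightarrow> real \<Rightarrow> real" where
  "cumulative r x = (LINT s:{..x}|lborel. r s)"

locale continuous_density =
  fixes r :: "real \<Rightarrow> real"
  assumes continuous: "continuous_on UNIV r"
    and nonneg: "0 \<le> r x"
    and integrable: "integrable lborel r"
    and mass: "(LINT x|lborel. r x) = 1"
begin

lemma set_integrable: "A \<in> sets borel \<Longrightarrow> set_integrable lborel A r"
  unfolding set_integrable_def by (rule integrable_mult_indicator[OF _ integrable]) simp

lemma cumulative_diff:
  assumes "a \<le> b"
  shows "cumulative r b - cumulative r a = (LINT s:{a..b}|lborel. r s)"
proof -
  have *: "{..b} = {..<a} \<union> {a..b}" using assms by auto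
  have "cumulative r b = (LINT s:{..<a}|lborel. r s) + (LINT s:{a..b}|lborel. r s)"
    unfolding cumulative_def * by (rule set_integral_Un) (auto intro: set_integrable)
  moreover have "cumulative r a = (LINT s:{..<a}|lborel. r s)"
    unfolding cumulative_def set_lebesgue_integral_def
  proof (rule integral_cong_AE)
    show "AE x in lborel. indicator {..a} x *\<^sub>R r x = indicator {..<a} x *\<^sub>R r x"
      by (rule eventually_mono[OF AE_lborel_singleton[of a]]) (auto simp: indicator_def)
  qed (use borel_measurable_integrable[OF integrable] in measurable)
  ultimately show ?thesis by simp
qed

lemma cumulative_complement:
  "1 - cumulative r x = (LINT s:{x..}|lborel. r s)"
proof -
  have *: "{..x} \<union> {x<..} = UNIV" by auto
  have "(LINT s:{..x} \<union> {x<..}|lborel. r s) = cumulative r x + (LINT s:{x<..}|lborel. r s)"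
    unfolding cumulative_def by (rule set_integral_Un) (auto intro: set_integrable)
  then have "1 = cumulative r x + (LINT s:{x<..}|lborel. r s)"
    unfolding * using mass by (simp add: set_lebesgue_integral_def)
  moreover have "(LINT s:{x<..}|lborel. r s) = (LINT s:{x..}|lborel. r s)"
    unfolding set_lebesgue_integral_def
  proof (rule integral_cong_AE)
    show "AE y in lborel. indicator {x<..} y *\<^sub>R r y = indicator {x..} y *\<^sub>R r y"
      by (rule eventually_mono[OF AE_lborel_singleton[of x]]) (auto simp: indicator_def)
  qed (use borel_measurable_integrable[OF integrable] in measurable)
  ultimately show ?thesis by simp
qed

lemma cumulative_nonneg: "0 \<le> cumulative r x"
  unfolding cumulative_def set_lebesgue_integral_def by (rule Bochner_Integration.integral_nonneg) (simp add: nonneg)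

lemma cumulative_le_1: "cumulative r x \<le> 1"
proof -
  have "0 \<le> (LINT s:{x..}|lborel. r s)"
    unfolding set_lebesgue_integral_def by (rule Bochner_Integration.integral_nonneg) (simp add: nonneg)
  then show ?thesis using cumulative_complement[of x] by simp
qed

lemma cumulative_mono: "a \<le> b \<Longrightarrow> cumulative r a \<le> cumulative r b"
proof -
  assume "a \<le> b"
  moreover have "0 \<le> (LINT s:{a..b}|lborel. r s)"
    unfolding set_lebesgue_integral_def by (rule Bochner_Integration.integral_nonneg) (simp add: nonneg)
  ultimately show ?thesis using cumulative_diff[of a b] by simp
qed

lemma cumulative_le_iff_less: "cumulative r a < cumulative r b \<Longrightarrow> a < b"
  using cumulative_mono[of b a] by linarith

lemma cumulative_primitive: "primitive_on a b (cumulative r) r"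
  by (rule primitive_onI) (simp_all add: set_integrable cumulative_diff)

lemma cumulative_deriv: "(cumulative r has_real_derivative r x) (at x)"
  by (rule primitive_on_has_derivative[OF cumulative_primitive continuous])

lemma cumulative_continuous: "isCont (cumulative r) x"
  using cumulative_deriv by (rule DERIV_isCont)

lemma cumulative_at_top: "(cumulative r \<longlongrightarrow> 1) at_top"
  using tendsto_integral_at_top[OF _ integrable] mass
  unfolding cumulative_def set_lebesgue_integral_def by simp

lemma cumulative_at_bot: "(cumulative r \<longlongrightarrow> 0) at_bot"
proof -
  have "((\<lambda>y. LINT x|lborel. indicator {..-y} x *\<^sub>R r x) \<longlongrightarrow> (LINT x|(lborel :: real measure). 0 :: real)) at_top"
  proof (rule integral_dominated_convergence_at_top[where w = r
        and s = "\<lambda>i x. indicator {..-i} x *\<^sub>R r x" and f = "\<lambda>_. 0"])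
    show "\<forall>\<^sub>F i in at_top. AE x in lborel. norm (indicator {..- i} x *\<^sub>R r x) \<le> r x"
      using nonneg by (auto simp: indicator_def)
    show "AE x in lborel. ((\<lambda>i. indicator {..- i} x *\<^sub>R r x) \<longlongrightarrow> 0) at_top"
    proof (rule AE_I2)
      fix x
      have "eventually (\<lambda>i. indicator {..- i} x *\<^sub>R r x = 0) at_top"
        by (rule eventually_mono[OF eventually_gt_at_top[of "-x"]]) (auto simp: indicator_def)
      then show "((\<lambda>i. indicator {..- i} x *\<^sub>R r x) \<longlongrightarrow> 0) at_top"
        by (rule tendsto_eventually)
    qed
  qed (use integrable in auto)
  then have "((\<lambda>y. cumulative r (-y)) \<longlongrightarrow> 0) at_top"
    unfolding cumulative_def set_lebesgue_integral_def by simp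
  then show ?thesis by (simp add: filterlim_at_bot_mirror)
qed

lemma cumulative_surj:
  assumes "0 < u" "u < 1"
  obtains x where "cumulative r x = u"
proof -
  obtain a where a: "cumulative r a < u"
    using order_tendstoD(2)[OF cumulative_at_bot assms(1)] eventually_happens'[of "at_bot :: real filter"]
    by (metis (mono_tags, lifting) trivial_limit_at_bot_linorder)
  obtain b where b: "u < cumulative r b"
    using order_tendstoD(1)[OF cumulative_at_top assms(2)] eventually_happens'[of "at_top :: real filter"]
    by (metis (mono_tags, lifting) trivial_limit_at_top_linorder)
  have "a \<le> b" using a b cumulative_le_iff_less[of a b] by simp
  then obtain x where "cumulative r x = u"
    using IVT'[of "cumulative r" a u b] a b cumulative_continuous
    by (auto intro: continuous_at_imp_continuous_on)
  then show ?thesis by (rule that)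
qed

lemma zero_where_cumulative_extremal:
  assumes "cumulative r x = 0 \<or> cumulative r x = 1"
  shows "r x = 0"
  using assms
proof
  assume "cumulative r x = 0"
  then show ?thesis using DERIV_local_min[OF cumulative_deriv, of 1 x] cumulative_nonneg by simp
next
  assume "cumulative r x = 1"
  then show ?thesis using DERIV_local_max[OF cumulative_deriv, of 1 x] cumulative_le_1 by simp
qed

end

abbreviation "\<phi> \<equiv> std_normal_density"

interpretation normal: continuous_density \<phi>
proof
  show "continuous_on UNIV \<phi>" unfolding std_normal_density_def by (intro continuous_intros) auto
  show "0 \<le> \<phi> x" for x by simp
  show "integrable lborel \<phi>" using integrable_normal_density[of 1 0] by simp
  show "(LINT x|lborel. \<phi> x) = 1" using integral_normal_density[of 1 0] by simp
qed

abbreviation "\<Phi> \<equiv> cumulative \<phi>"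

lemma \<phi>_pos: "0 < \<phi> x" by (simp add: normal_density_pos)

lemma \<phi>_minus: "\<phi> (- x) = \<phi> x" by (simp add: std_normal_density_def)

lemma \<phi>_deriv: "(\<phi> has_real_derivative - x * \<phi> x) (at x)"
proof -
  have "((\<lambda>x. c * exp (- x\<^sup>2 / 2)) has_real_derivative - x * (c * exp (- x\<^sup>2 / 2))) (at x)" for c :: real
    by (auto intro!: derivative_eq_intros)
  then show ?thesis unfolding std_normal_density_def by blast
qed

lemma \<phi>_continuous: "continuous_on S \<phi>"
  by (rule continuous_on_subset[OF normal.continuous]) auto

lemma ln_\<phi>: "ln (\<phi> x) = - x\<^sup>2 / 2 - ln (2 * pi) / 2"
  unfolding std_normal_density_def by (simp add: ln_mult ln_div ln_sqrt)

lemma \<Phi>_strict_mono: "a < b \<Longrightarrow> \<Phi> a < \<Phi> b"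
  by (rule DERIV_pos_imp_increasing) (use normal.cumulative_deriv \<phi>_pos in blast)+

lemma \<Phi>_bounds: "0 < \<Phi> x" "\<Phi> x < 1"
  using \<Phi>_strict_mono[of "x - 1" x] \<Phi>_strict_mono[of x "x + 1"]
    normal.cumulative_nonneg[of "x - 1"] normal.cumulative_le_1[of "x + 1"] by auto

lemma \<Phi>_minus: "\<Phi> (- x) = 1 - \<Phi> x"
proof -
  have "1 - \<Phi> x = (LINT s|lborel. indicator {x..} s * \<phi> s)"
    unfolding normal.cumulative_complement set_lebesgue_integral_def by simp
  also have "\<dots> = (LINT s|lborel. indicator {x..} (- s) * \<phi> (- s))"
    using lborel_integral_real_affine[of "-1" "\<lambda>s. indicator {x..} s * \<phi> s" 0] by simp
  also have "\<dots> = \<Phi> (- x)"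
    unfolding cumulative_def set_lebesgue_integral_def
    by (intro Bochner_Integration.integral_cong) (auto simp: indicator_def \<phi>_minus)
  finally show ?thesis by simp
qed

text \<open>For \<open>s \<ge> t \<ge> 0\<close> the density satisfies \<open>\<phi>(s) \<le> \<phi>(t) exp(-(s - t)\<^sup>2 / 2)\<close>, and the last factor
  has integral \<open>\<surd>(2 \<pi>) \<le> 3\<close>.\<close>

lemma \<Phi>_tail:
  assumes "0 \<le> t"
  shows "1 - \<Phi> t \<le> 3 * \<phi> t"
proof -
  have "1 - \<Phi> t = (LINT s|lborel. indicator {t..} s * \<phi> s)"
    unfolding normal.cumulative_complement set_lebesgue_integral_def by simp
  also have "\<dots> \<le> (LINT s|lborel. 3 * \<phi> t * normal_density t 1 s)"
  proof (rule integral_mono)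
    show "integrable lborel (\<lambda>s. indicator {t..} s * \<phi> s)"
      using normal.set_integrable[of "{t..}"] by (simp add: set_integrable_def)
    show "integrable lborel (\<lambda>s. 3 * \<phi> t * normal_density t 1 s)" by simp
    fix s :: real
    show "indicator {t..} s * \<phi> s \<le> 3 * \<phi> t * normal_density t 1 s"
    proof (cases "t \<le> s")
      case True
      have "s\<^sup>2 = t\<^sup>2 + (s - t)\<^sup>2 + 2 * (t * (s - t))" by (simp add: power2_eq_square algebra_simps)
      moreover have "0 \<le> t * (s - t)" using True assms by simp
      ultimately have "- s\<^sup>2 / 2 \<le> - t\<^sup>2 / 2 + - (s - t)\<^sup>2 / 2" by simp
      then have e: "exp (- s\<^sup>2 / 2) \<le> exp (- t\<^sup>2 / 2) * exp (- (s - t)\<^sup>2 / 2)"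
        by (simp add: exp_add[symmetric])
      have "sqrt (2 * pi) \<le> sqrt (3 * 3)" using pi_less_4 by (intro real_sqrt_le_mono) simp
      then have "sqrt (2 * pi) \<le> 3" by (simp add: real_sqrt_mult_self)
      then have "1 \<le> 3 * (1 / sqrt (2 * pi))" by (simp add: field_simps)
      then have "exp (- t\<^sup>2 / 2) * exp (- (s - t)\<^sup>2 / 2)
          \<le> 3 * (1 / sqrt (2 * pi)) * (exp (- t\<^sup>2 / 2) * exp (- (s - t)\<^sup>2 / 2))"
        using mult_right_mono[of 1 "3 * (1 / sqrt (2 * pi))"
            "exp (- t\<^sup>2 / 2) * exp (- (s - t)\<^sup>2 / 2)"] by simp
      with e have "exp (- s\<^sup>2 / 2) \<le> 3 * (1 / sqrt (2 * pi)) * (exp (- t\<^sup>2 / 2) * exp (- (s - t)\<^sup>2 / 2))"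
        by simp
      then have "(1 / sqrt (2 * pi)) * exp (- s\<^sup>2 / 2)
          \<le> (1 / sqrt (2 * pi)) * (3 * (1 / sqrt (2 * pi)) * (exp (- t\<^sup>2 / 2) * exp (- (s - t)\<^sup>2 / 2)))"
        by (intro mult_left_mono) auto
      then show ?thesis using True by (simp add: std_normal_density_def normal_density_def mult_ac)
    next
      case False
      then show ?thesis by (simp add: normal_density_nonneg)
    qed
  qed
  also have "\<dots> = 3 * \<phi> t" using integral_normal_density[of 1 t] by simp
  finally show ?thesis .
qed

text \<open>A lower bound, linear in the mass of the smaller side, for the isoperimetric profile
  \<open>u \<mapsto> \<phi>(\<Phi>\<^sup>-\<^sup>1(u))\<close> of the Gaussian measure.\<close>

lemma \<Phi>_profile: "min (\<Phi> t) (1 - \<Phi> t) \<le> 3 * \<phi> t"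
proof (cases "0 \<le> t")
  case True
  then show ?thesis using \<Phi>_tail[of t] by simp
next
  case False
  then show ?thesis using \<Phi>_tail[of "- t"] by (simp add: \<Phi>_minus \<phi>_minus)
qed

definition quantile :: "real \<Rightarrow> real" where
  "quantile u = (THE t. \<Phi> t = u)"

lemma \<Phi>_inj: "\<Phi> s = \<Phi> t \<longleftrightarrow> s = t"
  using \<Phi>_strict_mono[of s t] \<Phi>_strict_mono[of t s] by (metis less_irrefl linorder_less_linear)

lemma quantile_\<Phi>: "quantile (\<Phi> t) = t"
  unfolding quantile_def by (simp add: \<Phi>_inj)

lemma \<Phi>_quantile: "0 < u \<Longrightarrow> u < 1 \<Longrightarrow> \<Phi> (quantile u) = u"
  using normal.cumulative_surj quantile_\<Phi> by metis

lemma quantile_deriv: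
  assumes "0 < u" "u < 1"
  shows "(quantile has_real_derivative inverse (\<phi> (quantile u))) (at u)"
proof (rule DERIV_inverse_function[where f = \<Phi> and a = 0 and b = 1])
  show "(\<Phi> has_real_derivative \<phi> (quantile u)) (at (quantile u))" by (rule normal.cumulative_deriv)
  show "\<phi> (quantile u) \<noteq> 0" using \<phi>_pos[of "quantile u"] by simp
  have "isCont quantile (\<Phi> (quantile u))"
    by (rule isCont_inverse_function[where d = 1]) (auto simp: quantile_\<Phi> normal.cumulative_continuous)
  then show "isCont quantile u" using assms by (simp add: \<Phi>_quantile)
qed (use assms \<Phi>_quantile in auto)

lemma \<phi>_tendsto_0: "((\<lambda>n. \<phi> (real n)) \<longlongrightarrow> 0) sequentially"
proof -
  have "((\<lambda>n. (1 / sqrt (2 * pi)) * exp (- (real n)\<^sup>2 / 2)) \<longlongrightarrow> (1 / sqrt (2 * pi)) * 0) sequentially"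
    by (intro tendsto_mult tendsto_const) real_asymp
  then show ?thesis unfolding std_normal_density_def by simp
qed

lemma scaled_normal_tail_tendsto_0: "((\<lambda>n. real n * sqrt (1 - \<Phi> (real n))) \<longlongrightarrow> 0) sequentially"
proof (rule Lim_null_comparison)
  have "norm (real n * sqrt (1 - \<Phi> (real n))) \<le> sqrt (3 * (1 / sqrt (2 * pi))) * (real n * sqrt (exp (- (real n)\<^sup>2 / 2)))" for n
  proof -
    have "sqrt (1 - \<Phi> (real n)) \<le> sqrt (3 * \<phi> (real n))" by (intro real_sqrt_le_mono \<Phi>_tail) simp
    also have "\<dots> = sqrt (3 * (1 / sqrt (2 * pi))) * sqrt (exp (- (real n)\<^sup>2 / 2))"
      unfolding std_normal_density_def by (simp only: real_sqrt_mult mult.assoc)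
    finally have "real n * sqrt (1 - \<Phi> (real n))
        \<le> real n * (sqrt (3 * (1 / sqrt (2 * pi))) * sqrt (exp (- (real n)\<^sup>2 / 2)))"
      by (intro mult_left_mono) auto
    moreover have "0 \<le> sqrt (1 - \<Phi> (real n))" using \<Phi>_bounds(2)[of "real n"] by simp
    ultimately show ?thesis by (simp add: mult_ac)
  qed
  then show "\<forall>\<^sub>F n in sequentially. norm (real n * sqrt (1 - \<Phi> (real n)))
     \<le> sqrt (3 * (1 / sqrt (2 * pi))) * (real n * sqrt (exp (- (real n)\<^sup>2 / 2)))" by simp
  have "((\<lambda>n. real n * sqrt (exp (- (real n)\<^sup>2 / 2))) \<longlongrightarrow> 0) sequentially" by real_asymp
  from tendsto_mult[OF tendsto_const this]
  show "((\<lambda>n. sqrt (3 * (1 / sqrt (2 * pi))) * (real n * sqrt (exp (- (real n)\<^sup>2 / 2)))) \<longlongrightarrow> 0) sequentially"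
    by fastforce
qed

section \<open>The transport map to the Gaussian and the energy identity\<close>

text \<open>The density \<open>f\<close> is given through its continuous representative. The function \<open>h\<close> is its
  derivative; requiring \<open>h = 0\<close> where \<open>f = 0\<close> selects a version of \<open>h\<close> for which
  \<open>h\<^sup>2 / f\<close> is the density of the Fisher information.\<close>

locale sobolev_density =
  fixes f h :: "real \<Rightarrow> real" and M :: real
  assumes f_nonneg: "0 \<le> f x"
    and f_primitive: "a \<le> b \<Longrightarrow> primitive_on a b f h"
    and h_zero: "f x = 0 \<Longrightarrow> h x = 0"
    and h_measurable [measurable]: "h \<in> borel_measurable borel"
    and fisher_integrable: "integrable lborel (\<lambda>x. (h x)\<^sup>2 / f x * \<phi> x)"
    and mass_integrable: "integrable lborel (\<lambda>x. f x * \<phi> x)"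
    and mass_1: "(LINT x|lborel. f x * \<phi> x) = 1"
    and moment_integrable: "integrable lborel (\<lambda>x. x\<^sup>2 * (f x * \<phi> x))"
    and moment_le: "(LINT x|lborel. x\<^sup>2 * (f x * \<phi> x)) \<le> M"
    and mean_0: "(LINT x|lborel. x * (f x * \<phi> x)) = 0"
begin

definition \<rho> :: "real \<Rightarrow> real" where "\<rho> x = f x * \<phi> x"

text \<open>This is \<open>2 (\<surd>f)'\<close>, read as \<open>0\<close> where \<open>f\<close> vanishes.\<close>

definition u :: "real \<Rightarrow> real" where "u x = h x / sqrt (f x)"

abbreviation "F \<equiv> cumulative \<rho>"

text \<open>The monotone transport map from \<open>\<rho>\<close> to \<open>\<phi>\<close>. It is meaningful only where \<open>0 < F x < 1\<close>;
  outside, \<open>quantile\<close> has an arbitrary value.\<close>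

definition T :: "real \<Rightarrow> real" where "T x = quantile (F x)"

text \<open>The quantity whose \<open>L\<^sup>2(\<phi>)\<close> norm the deficit controls. It vanishes for \<open>f = 1\<close>, where
  \<open>T x = x\<close>; in general \<open>q \<surd>f = \<rho>' / \<phi> + T f\<close> compares the score of \<open>\<rho>\<close> with that of a
  Gaussian in the variable \<open>T\<close>.\<close>

definition q :: "real \<Rightarrow> real" where "q x = u x + (T x - x) * sqrt (f x)"

definition deficit :: real where
  "deficit = (LINT x|lborel. (h x)\<^sup>2 / f x * \<phi> x) / 2 - (LINT x|lborel. f x * ln (f x) * \<phi> x)"

text \<open>The Fisher information of \<open>\<rho>\<close> relative to Lebesgue measure, that is \<open>\<integral> \<rho>'\<^sup>2 / \<rho>\<close>. Its
  finiteness bounds \<open>\<rho>\<close> and makes boundary terms vanish.\<close>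

definition L :: real where
  "L = (LINT x|lborel. (u x - x * sqrt (f x))\<^sup>2 * \<phi> x)"

lemma f_continuous: "continuous_on S f"
  by (rule continuous_on_subset[OF continuous_on_UNIV_if_primitive_on[OF f_primitive]]) simp_all

lemma f_measurable [measurable]: "f \<in> borel_measurable borel"
  by (rule borel_measurable_continuous_onI) (rule f_continuous)

lemma u_measurable [measurable]: "u \<in> borel_measurable borel"
  unfolding u_def by measurable

lemma u_sq: "(u x)\<^sup>2 = (h x)\<^sup>2 / f x"
  by (simp add: u_def power_divide f_nonneg)

lemma u_sqrt: "u x * sqrt (f x) = h x"
  using h_zero[of x] by (cases "f x = 0") (simp_all add: u_def)

lemma sqrt_f_sq: "sqrt (f x) * sqrt (f x) = f x"
  by (simp add: f_nonneg)

sublocale rho: continuous_density \<rho>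
proof
  show "continuous_on UNIV \<rho>" unfolding \<rho>_def by (intro continuous_intros f_continuous \<phi>_continuous)
  show "0 \<le> \<rho> x" for x by (simp add: \<rho>_def f_nonneg)
  show "integrable lborel \<rho>" "(LINT x|lborel. \<rho> x) = 1"
    using mass_integrable mass_1 by (simp_all add: \<rho>_def[abs_def])
qed

lemma rho_measurable [measurable]: "\<rho> \<in> borel_measurable borel"
  by (rule borel_measurable_continuous_onI) (rule rho.continuous)

lemma rho_primitive: "a \<le> b \<Longrightarrow> primitive_on a b \<rho> (\<lambda>x. h x * \<phi> x + (- x * \<phi> x) * f x)"
  unfolding \<rho>_def[abs_def]
  by (intro primitive_on_mult f_primitive primitive_on_C1 \<phi>_deriv continuous_intros \<phi>_continuous)

text \<open>The derivative of \<open>\<rho>\<close> as a product of two square integrable functions, in the shape needed for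
  Cauchy-Schwarz.\<close>

lemma rho_derivative_factors: "h x * \<phi> x + (- x * \<phi> x) * f x = (u x - x * sqrt (f x)) * sqrt (\<phi> x) * (sqrt (f x) * sqrt (\<phi> x))"
proof -
  have "(u x - x * sqrt (f x)) * sqrt (\<phi> x) * (sqrt (f x) * sqrt (\<phi> x))
    = (u x * sqrt (f x) - x * (sqrt (f x) * sqrt (f x))) * (sqrt (\<phi> x) * sqrt (\<phi> x))" by (simp add: algebra_simps)
  also have "\<dots> = (h x - x * f x) * \<phi> x" by (simp only: u_sqrt sqrt_f_sq) simp
  finally show ?thesis by (simp add: algebra_simps)
qed

lemma L_integrable: "integrable lborel (\<lambda>x. (u x - x * sqrt (f x))\<^sup>2 * \<phi> x)"
proof (rule Bochner_Integration.integrable_bound)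
  show "integrable lborel (\<lambda>x. 2 * ((h x)\<^sup>2 / f x * \<phi> x) + 2 * (x\<^sup>2 * (f x * \<phi> x)))"
    by (intro Bochner_Integration.integrable_add integrable_mult_right fisher_integrable moment_integrable)
  show "AE x in lborel. norm ((u x - x * sqrt (f x))\<^sup>2 * \<phi> x)
      \<le> norm (2 * ((h x)\<^sup>2 / f x * \<phi> x) + 2 * (x\<^sup>2 * (f x * \<phi> x)))"
  proof (rule AE_I2)
    fix x
    have "(u x - x * sqrt (f x))\<^sup>2 \<le> 2 * (u x)\<^sup>2 + 2 * (x * sqrt (f x))\<^sup>2"
      using sum_squares_bound[of "u x" "- (x * sqrt (f x))"] by (simp add: power2_diff)
    also have "\<dots> = 2 * ((h x)\<^sup>2 / f x) + 2 * (x\<^sup>2 * f x)"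
      by (simp add: u_sq power_mult_distrib f_nonneg)
    finally have "(u x - x * sqrt (f x))\<^sup>2 * \<phi> x \<le> (2 * ((h x)\<^sup>2 / f x) + 2 * (x\<^sup>2 * f x)) * \<phi> x"
      by (intro mult_right_mono) auto
    then show "norm ((u x - x * sqrt (f x))\<^sup>2 * \<phi> x)
      \<le> norm (2 * ((h x)\<^sup>2 / f x * \<phi> x) + 2 * (x\<^sup>2 * (f x * \<phi> x)))"
      by (simp add: f_nonneg algebra_simps)
  qed
qed simp

lemma L_nonneg: "0 \<le> L"
  unfolding L_def by (rule Bochner_Integration.integral_nonneg) simp

lemma Cauchy_Schwarz_density:
  fixes g :: "real \<Rightarrow> real"
  assumes "a \<le> b" and [measurable]: "(\<lambda>x. indicator {a..b} x * g x) \<in> borel_measurable borel"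
    and g: "set_integrable lborel {a..b} (\<lambda>x. (g x)\<^sup>2 * \<phi> x)"
  shows "\<bar>LINT x:{a..b}|lborel. g x * sqrt (\<phi> x) * (sqrt (f x) * sqrt (\<phi> x))\<bar>
    \<le> sqrt (LINT x:{a..b}|lborel. (g x)\<^sup>2 * \<phi> x) * sqrt (F b - F a)"
proof -
  define G where "G = (\<lambda>x. (indicator {a..b} x * g x) * sqrt (\<phi> x))"
  define R where "R = (\<lambda>x. indicator {a..b} x * (sqrt (f x) * sqrt (\<phi> x)))"
  have [measurable]: "G \<in> borel_measurable lborel" "R \<in> borel_measurable lborel"
    unfolding G_def R_def by measurable
  have G2: "(G x)\<^sup>2 = indicator {a..b} x *\<^sub>R ((g x)\<^sup>2 * \<phi> x)" for x
    by (simp add: G_def power_mult_distrib indicator_def)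
  have R2: "(R x)\<^sup>2 = indicator {a..b} x *\<^sub>R \<rho> x" for x
    by (simp add: R_def power_mult_distrib indicator_def \<rho>_def f_nonneg)
  have "\<bar>LINT x|lborel. G x * R x\<bar> \<le> sqrt (LINT x|lborel. (G x)\<^sup>2) * sqrt (LINT x|lborel. (R x)\<^sup>2)"
  proof (rule Cauchy_Schwarz_integral)
    show "integrable lborel (\<lambda>x. (G x)\<^sup>2)" using g by (simp add: G2 set_integrable_def)
    show "integrable lborel (\<lambda>x. (R x)\<^sup>2)"
      using rho.set_integrable[of "{a..b}"] by (simp add: R2 set_integrable_def)
  qed measurable
  moreover have "(LINT x|lborel. (R x)\<^sup>2) = F b - F a"
    unfolding R2 rho.cumulative_diff[OF \<open>a \<le> b\<close>] set_lebesgue_integral_def ..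
  moreover have "(LINT x|lborel. (G x)\<^sup>2) = (LINT x:{a..b}|lborel. (g x)\<^sup>2 * \<phi> x)"
    unfolding G2 set_lebesgue_integral_def ..
  moreover have "(LINT x|lborel. G x * R x)
      = (LINT x:{a..b}|lborel. g x * sqrt (\<phi> x) * (sqrt (f x) * sqrt (\<phi> x)))"
    unfolding set_lebesgue_integral_def G_def R_def
    by (rule Bochner_Integration.integral_cong) (auto simp: indicator_def)
  ultimately show ?thesis by simp
qed

lemma rho_oscillation:
  assumes "a \<le> b"
  shows "\<bar>\<rho> b - \<rho> a\<bar> \<le> sqrt L * sqrt (F b - F a)"
proof -
  have i: "set_integrable lborel {a..b} (\<lambda>x. (u x - x * sqrt (f x))\<^sup>2 * \<phi> x)"
    unfolding set_integrable_def by (rule integrable_mult_indicator[OF _ L_integrable]) simp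
  have eq: "\<rho> b - \<rho> a = (LINT x:{a..b}|lborel. (u x - x * sqrt (f x)) * sqrt (\<phi> x) * (sqrt (f x) * sqrt (\<phi> x)))"
    using primitive_on_diff[OF rho_primitive[OF assms], of a b] assms
    unfolding rho_derivative_factors by simp
  have "\<bar>\<rho> b - \<rho> a\<bar> \<le> sqrt (LINT x:{a..b}|lborel. (u x - x * sqrt (f x))\<^sup>2 * \<phi> x) * sqrt (F b - F a)"
    unfolding eq by (rule Cauchy_Schwarz_density[OF assms _ i]) measurable
  also have "\<dots> \<le> sqrt L * sqrt (F b - F a)"
  proof (intro mult_right_mono real_sqrt_le_mono)
    show "(LINT x:{a..b}|lborel. (u x - x * sqrt (f x))\<^sup>2 * \<phi> x) \<le> L"
      unfolding L_def set_lebesgue_integral_def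
      using i L_integrable by (intro integral_mono) (auto simp: set_integrable_def indicator_def)
    show "0 \<le> sqrt (F b - F a)" using rho.cumulative_mono[OF assms] by simp
  qed
  finally show ?thesis .
qed

lemma small_rho_exists:
  assumes "0 < e"
  shows "\<exists>y\<ge>x. \<rho> y < e" and "\<exists>y\<le>x. \<rho> y < e"
proof -
  have *: False if "\<And>y. a \<le> y \<Longrightarrow> y \<le> b \<Longrightarrow> e \<le> \<rho> y" "b - a = 2 / e" for a b
  proof -
    have ab: "a \<le> b" using that(2) assms by (smt (verit) divide_pos_pos)
    have "(LINT y:{a..b}|lborel. e) \<le> (LINT y:{a..b}|lborel. \<rho> y)"
    proof (rule set_integral_mono)
      show "set_integrable lborel {a..b} (\<lambda>_. e)" by (intro borel_integrable_atLeastAtMost') simp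
    qed (use that(1) rho.set_integrable in auto)
    moreover have "(LINT y:{a..b}|lborel. e) = 2"
      using ab that(2) assms by (simp add: set_lebesgue_integral_def)
    ultimately have "2 \<le> F b - F a" using rho.cumulative_diff[OF ab] by simp
    then show False using rho.cumulative_le_1[of b] rho.cumulative_nonneg[of a] by simp
  qed
  show "\<exists>y\<ge>x. \<rho> y < e" using *[of x "x + 2 / e"] by force
  show "\<exists>y\<le>x. \<rho> y < e" using *[of "x - 2 / e" x] by force
qed

text \<open>Since \<open>\<rho>\<close> is integrable, it is small at suitable points arbitrarily far out; the oscillation bound
  is applied between \<open>x\<close> and such a point.\<close>

lemma rho_tail: "\<rho> x \<le> sqrt L * sqrt (1 - F x)" "\<rho> x \<le> sqrt L * sqrt (F x)"
proof -
  show "\<rho> x \<le> sqrt L * sqrt (1 - F x)"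
  proof (rule field_le_epsilon)
    fix e :: real assume "0 < e"
    then obtain y where y: "x \<le> y" "\<rho> y < e" using small_rho_exists(1) by blast
    have "sqrt L * sqrt (F y - F x) \<le> sqrt L * sqrt (1 - F x)"
      using rho.cumulative_le_1 L_nonneg by (intro mult_left_mono real_sqrt_le_mono) auto
    then show "\<rho> x \<le> sqrt L * sqrt (1 - F x) + e"
      using rho_oscillation[OF y(1)] y(2) by linarith
  qed
  show "\<rho> x \<le> sqrt L * sqrt (F x)"
  proof (rule field_le_epsilon)
    fix e :: real assume "0 < e"
    then obtain y where y: "y \<le> x" "\<rho> y < e" using small_rho_exists(2) by blast
    have "sqrt L * sqrt (F x - F y) \<le> sqrt L * sqrt (F x)"
      using rho.cumulative_nonneg L_nonneg by (intro mult_left_mono real_sqrt_le_mono) auto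
    then show "\<rho> x \<le> sqrt L * sqrt (F x) + e"
      using rho_oscillation[OF y(1)] y(2) by linarith
  qed
qed

lemma rho_le: "\<rho> x \<le> sqrt L"
proof -
  have "sqrt L * sqrt (F x) \<le> sqrt L * 1"
    using rho.cumulative_le_1 L_nonneg by (intro mult_left_mono) auto
  then show ?thesis using rho_tail(2)[of x] by simp
qed

text \<open>From below, \<open>f ln f \<ge> f - 1\<close>. From above, \<open>ln f = ln \<rho> - ln \<phi>\<close> grows at most quadratically
  because \<open>\<rho>\<close> is bounded, and \<open>\<rho>\<close> has a second moment.\<close>

lemma entropy_integrable: "integrable lborel (\<lambda>x. f x * ln (f x) * \<phi> x)"
proof (rule Bochner_Integration.integrable_bound)
  let ?c = "sqrt L + ln (2 * pi) / 2 + 1"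
  show "integrable lborel (\<lambda>x. ?c * \<rho> x + x\<^sup>2 * (f x * \<phi> x) + \<phi> x)"
    using rho.integrable moment_integrable normal.integrable by auto
  show "AE x in lborel. norm (f x * ln (f x) * \<phi> x) \<le> norm (?c * \<rho> x + x\<^sup>2 * (f x * \<phi> x) + \<phi> x)"
  proof (rule AE_I2)
    fix x
    have lnpi: "0 \<le> ln (2 * pi)" using pi_ge_two by (intro ln_ge_zero) simp
    have 0: "0 \<le> sqrt L" "0 \<le> \<rho> x" "0 \<le> x\<^sup>2 * (f x * \<phi> x)" "0 \<le> \<phi> x"
      using L_nonneg rho.nonneg f_nonneg by auto
    have c: "0 \<le> ?c" using 0(1) lnpi by simp
    have "\<bar>f x * ln (f x) * \<phi> x\<bar> \<le> ?c * \<rho> x + x\<^sup>2 * (f x * \<phi> x) + \<phi> x"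
    proof (cases "f x = 0")
      case False
      then have fp: "0 < f x" using f_nonneg[of x] by simp
      have "1 - 1 / f x \<le> ln (f x)"
        using ln_le_minus_one[of "1 / f x"] fp by (simp add: ln_div)
      then have "f x * (1 - 1 / f x) \<le> f x * ln (f x)" using fp by (intro mult_left_mono) auto
      then have "f x - 1 \<le> f x * ln (f x)" using fp by (simp add: algebra_simps)
      then have "(f x - 1) * \<phi> x \<le> f x * ln (f x) * \<phi> x" by (intro mult_right_mono) auto
      then have "\<rho> x - \<phi> x \<le> f x * ln (f x) * \<phi> x" by (simp add: \<rho>_def algebra_simps)
      moreover have "f x * ln (f x) * \<phi> x \<le> \<rho> x * (sqrt L + x\<^sup>2 / 2 + ln (2 * pi) / 2)"
      proof -
        have "ln (\<rho> x) = ln (f x) + ln (\<phi> x)"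
          unfolding \<rho>_def using fp \<phi>_pos[of x] by (simp add: ln_mult)
        then have "ln (f x) = ln (\<rho> x) + x\<^sup>2 / 2 + ln (2 * pi) / 2" by (simp add: ln_\<phi>)
        moreover have "ln (\<rho> x) \<le> sqrt L"
          using ln_le_minus_one[of "\<rho> x"] rho_le[of x] fp \<phi>_pos[of x] by (simp add: \<rho>_def)
        ultimately have "ln (f x) \<le> sqrt L + x\<^sup>2 / 2 + ln (2 * pi) / 2" by simp
        then have "\<rho> x * ln (f x) \<le> \<rho> x * (sqrt L + x\<^sup>2 / 2 + ln (2 * pi) / 2)"
          using 0 by (intro mult_left_mono) auto
        then show ?thesis by (simp add: \<rho>_def mult_ac)
      qed
      moreover have "\<rho> x * (sqrt L + x\<^sup>2 / 2 + ln (2 * pi) / 2)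
          = sqrt L * \<rho> x + x\<^sup>2 * (f x * \<phi> x) / 2 + ln (2 * pi) * \<rho> x / 2"
        by (simp add: \<rho>_def algebra_simps)
      moreover have "?c * \<rho> x = sqrt L * \<rho> x + ln (2 * pi) * \<rho> x / 2 + \<rho> x" by (simp add: algebra_simps)
      ultimately show ?thesis using 0 mult_nonneg_nonneg[OF 0(1,2)] mult_nonneg_nonneg[OF lnpi 0(2)]
        unfolding abs_le_iff by linarith
    qed (use 0 c in simp)
    then show "norm (f x * ln (f x) * \<phi> x) \<le> norm (?c * \<rho> x + x\<^sup>2 * (f x * \<phi> x) + \<phi> x)"
      using c 0 by simp
  qed
qed measurable

lemma T_deriv:
  assumes "0 < F x" "F x < 1"
  shows "(T has_real_derivative \<rho> x / \<phi> (T x)) (at x)"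
  unfolding T_def[abs_def] divide_inverse
  using DERIV_chain2[OF quantile_deriv[OF assms] rho.cumulative_deriv] by (simp add: mult.commute T_def)

lemma \<Phi>_T: "0 < F x \<Longrightarrow> F x < 1 \<Longrightarrow> \<Phi> (T x) = F x"
  unfolding T_def by (rule \<Phi>_quantile)

lemma T_eqI: "F x = \<Phi> t \<Longrightarrow> T x = t"
  unfolding T_def by (simp add: quantile_\<Phi>)

lemma F_interior:
  assumes "0 < F a" "F b < 1" "a \<le> x" "x \<le> b"
  shows "0 < F x" "F x < 1"
  using rho.cumulative_mono[OF assms(3)] rho.cumulative_mono[OF assms(4)] assms by auto

lemma T_continuous_on:
  assumes "0 < F a" "F b < 1"
  shows "continuous_on {a..b} T"
  using DERIV_isCont[OF T_deriv] F_interior[OF assms] by (intro continuous_at_imp_continuous_on) auto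

lemma T_diff_primitive:
  assumes "0 < F a" "F b < 1"
  shows "primitive_on a b (\<lambda>x. T x - x) (\<lambda>x. \<rho> x / \<phi> (T x) - 1)"
proof (rule primitive_on_C1)
  show "((\<lambda>x. T x - x) has_real_derivative \<rho> x / \<phi> (T x) - 1) (at x)" if "a \<le> x" "x \<le> b" for x
    by (auto intro!: derivative_eq_intros T_deriv F_interior[OF assms that])
  show "continuous_on {a..b} (\<lambda>x. \<rho> x / \<phi> (T x) - 1)"
    using \<phi>_pos by (intro continuous_intros continuous_on_subset[OF rho.continuous]
        continuous_on_compose2[OF \<phi>_continuous[of UNIV] T_continuous_on[OF assms]]) (auto simp: less_imp_neq[symmetric])
qed

lemma q_sq: "(q x)\<^sup>2 = (h x)\<^sup>2 / f x + 2 * (T x - x) * h x + (T x - x)\<^sup>2 * f x"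
proof -
  have "(q x)\<^sup>2 = (u x)\<^sup>2 + 2 * (T x - x) * (u x * sqrt (f x)) + (T x - x)\<^sup>2 * (sqrt (f x) * sqrt (f x))"
  proof -
    have "(a + b * c)\<^sup>2 = a\<^sup>2 + 2 * b * (a * c) + b\<^sup>2 * (c * c)" for a b c :: real
      by (simp add: power2_eq_square algebra_simps)
    then show ?thesis unfolding q_def .
  qed
  then show ?thesis by (simp only: u_sq u_sqrt sqrt_f_sq)
qed

lemma relative_fisher_set_integrable:
  "A \<in> sets borel \<Longrightarrow> set_integrable lborel A (\<lambda>x. ((h x)\<^sup>2 / f x - 2 * f x * ln (f x)) * \<phi> x)"
  unfolding set_integrable_def
proof (rule integrable_mult_indicator)
  have "integrable lborel (\<lambda>x. (h x)\<^sup>2 / f x * \<phi> x - 2 * (f x * ln (f x) * \<phi> x))"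
    using fisher_integrable entropy_integrable by auto
  then show "integrable lborel (\<lambda>x. ((h x)\<^sup>2 / f x - 2 * f x * ln (f x)) * \<phi> x)"
    by (simp add: algebra_simps)
qed simp

lemma q_indicator_measurable:
  assumes "0 < F a" "F b < 1"
  shows "(\<lambda>x. indicator {a..b} x * q x) \<in> borel_measurable borel"
proof -
  have "(\<lambda>x. indicator {a..b} x *\<^sub>R T x) \<in> borel_measurable borel"
    by (rule borel_measurable_continuous_on_indicator[OF _ T_continuous_on[OF assms]]) simp
  then have "(\<lambda>x. indicator {a..b} x * u x + (indicator {a..b} x *\<^sub>R T x - indicator {a..b} x * x) * sqrt (f x)) \<in> borel_measurable borel"
    by measurable
  moreover have "(\<lambda>x. indicator {a..b} x * u x + (indicator {a..b} x *\<^sub>R T x - indicator {a..b} x * x) * sqrt (f x)) = (\<lambda>x. indicator {a..b} x * q x)"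
    unfolding q_def by (auto simp: indicator_def)
  ultimately show ?thesis by simp
qed

lemma q_sq_integrable:
  assumes "0 < F a" "F b < 1"
  shows "set_integrable lborel {a..b} (\<lambda>x. (q x)\<^sup>2 * \<phi> x)"
proof (cases "a \<le> b")
  case True
  have T: "continuous_on {a..b} (\<lambda>x. T x - x)"
    by (intro continuous_intros T_continuous_on[OF assms])
  have 1: "set_integrable lborel {a..b} (\<lambda>x. (h x)\<^sup>2 / f x * \<phi> x)"
    unfolding set_integrable_def by (rule integrable_mult_indicator[OF _ fisher_integrable]) simp
  have 2: "set_integrable lborel {a..b} (\<lambda>x. h x * (2 * (T x - x) * \<phi> x))"
    by (intro set_integrable_mult_continuous primitive_on_integrable[OF f_primitive[OF True]]
        continuous_intros T \<phi>_continuous)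
  have 3: "set_integrable lborel {a..b} (\<lambda>x. (T x - x)\<^sup>2 * f x * \<phi> x)"
    by (intro borel_integrable_atLeastAtMost' continuous_intros T f_continuous \<phi>_continuous)
  have "set_integrable lborel {a..b} (\<lambda>x. (h x)\<^sup>2 / f x * \<phi> x + h x * (2 * (T x - x) * \<phi> x) + (T x - x)\<^sup>2 * f x * \<phi> x)"
    by (rule set_integral_add(1)[OF set_integral_add(1)[OF 1 2] 3])
  moreover have "(h x)\<^sup>2 / f x * \<phi> x + h x * (2 * (T x - x) * \<phi> x) + (T x - x)\<^sup>2 * f x * \<phi> x = (q x)\<^sup>2 * \<phi> x" for x
    unfolding q_sq by (simp add: algebra_simps)
  ultimately show ?thesis by simp
qed (simp add: set_integrable_def)

text \<open>The term added to the density of \<open>I - 2 H\<close> is twice the derivative of \<open>(T - x) \<rho>\<close>. After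
  expanding \<open>q\<^sup>2\<close> and cancelling, the inequality reads
  \<open>T\<^sup>2 - x\<^sup>2 \<le> 2 (T' - 1) - 2 ln f\<close>, and \<open>ln T' = ln f - x\<^sup>2 / 2 + T\<^sup>2 / 2\<close> because
  \<open>T' = \<rho> / \<phi>(T)\<close>. So it is \<open>ln T' \<le> T' - 1\<close>.\<close>

lemma transport_pointwise:
  assumes "0 < F x" "F x < 1"
  shows "(q x)\<^sup>2 * \<phi> x \<le> ((h x)\<^sup>2 / f x - 2 * f x * ln (f x)) * \<phi> x
    + 2 * ((\<rho> x / \<phi> (T x) - 1) * \<rho> x + (h x * \<phi> x + (- x * \<phi> x) * f x) * (T x - x))"
proof -
  have "f x * ((T x)\<^sup>2 - x\<^sup>2) \<le> - 2 * f x * ln (f x) + 2 * (\<rho> x / \<phi> (T x) - 1) * f x"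
  proof (cases "f x = 0")
    case False
    then have fp: "0 < f x" using f_nonneg[of x] by simp
    have "ln (\<rho> x / \<phi> (T x)) \<le> \<rho> x / \<phi> (T x) - 1"
      using fp \<phi>_pos by (intro ln_le_minus_one) (auto simp: \<rho>_def)
    moreover have "ln (\<rho> x / \<phi> (T x)) = ln (f x) - x\<^sup>2 / 2 + (T x)\<^sup>2 / 2"
    proof -
      have "ln (\<rho> x / \<phi> (T x)) = ln (f x) + ln (\<phi> x) - ln (\<phi> (T x))"
        unfolding \<rho>_def using fp \<phi>_pos[of x] \<phi>_pos[of "T x"] by (simp add: ln_mult ln_div)
      then show ?thesis by (simp add: ln_\<phi>)
    qed
    ultimately have "(T x)\<^sup>2 - x\<^sup>2 \<le> - 2 * ln (f x) + 2 * (\<rho> x / \<phi> (T x) - 1)" by simp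
    then have "f x * ((T x)\<^sup>2 - x\<^sup>2) \<le> f x * (- 2 * ln (f x) + 2 * (\<rho> x / \<phi> (T x) - 1))"
      using fp by (intro mult_left_mono) auto
    then show ?thesis by (simp add: algebra_simps)
  qed simp
  then have "f x * ((T x)\<^sup>2 - x\<^sup>2) * \<phi> x \<le> (- 2 * f x * ln (f x) + 2 * (\<rho> x / \<phi> (T x) - 1) * f x) * \<phi> x"
    by (intro mult_right_mono) auto
  moreover have "2 * ((\<rho> x / \<phi> (T x) - 1) * \<rho> x) = 2 * (\<rho> x / \<phi> (T x) - 1) * f x * \<phi> x"
    by (simp add: \<rho>_def)
  ultimately show ?thesis unfolding q_sq by (simp add: algebra_simps power2_eq_square)
qed

lemma energy_on_interval:
  assumes "0 < F a" "F b < 1" "a \<le> b"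
  shows "(LINT x:{a..b}|lborel. (q x)\<^sup>2 * \<phi> x)
    \<le> (LINT x:{a..b}|lborel. ((h x)\<^sup>2 / f x - 2 * f x * ln (f x)) * \<phi> x)
      + 2 * ((T b - b) * \<rho> b - (T a - a) * \<rho> a)"
proof -
  let ?D = "\<lambda>x. (\<rho> x / \<phi> (T x) - 1) * \<rho> x + (h x * \<phi> x + (- x * \<phi> x) * f x) * (T x - x)"
  have p: "primitive_on a b (\<lambda>x. (T x - x) * \<rho> x) ?D"
    by (rule primitive_on_mult[OF T_diff_primitive[OF assms(1,2)] rho_primitive[OF assms(3)]])
  have D: "set_integrable lborel {a..b} (\<lambda>x. 2 * ?D x)"
    by (rule set_integrable_mult_right) (rule primitive_on_integrable[OF p])
  have "(LINT x:{a..b}|lborel. (q x)\<^sup>2 * \<phi> x)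
     \<le> (LINT x:{a..b}|lborel. ((h x)\<^sup>2 / f x - 2 * f x * ln (f x)) * \<phi> x + 2 * ?D x)"
  proof (rule set_integral_mono)
    show "set_integrable lborel {a..b} (\<lambda>x. (q x)\<^sup>2 * \<phi> x)" by (rule q_sq_integrable[OF assms(1,2)])
    show "set_integrable lborel {a..b} (\<lambda>x. ((h x)\<^sup>2 / f x - 2 * f x * ln (f x)) * \<phi> x + 2 * ?D x)"
      by (rule set_integral_add(1)[OF relative_fisher_set_integrable D]) simp
    show "(q x)\<^sup>2 * \<phi> x \<le> ((h x)\<^sup>2 / f x - 2 * f x * ln (f x)) * \<phi> x + 2 * ?D x" if "x \<in> {a..b}" for x
      by (rule transport_pointwise) (use F_interior[OF assms(1,2), of x] that in auto)
  qed
  also have "\<dots> = (LINT x:{a..b}|lborel. ((h x)\<^sup>2 / f x - 2 * f x * ln (f x)) * \<phi> x) + (LINT x:{a..b}|lborel. 2 * ?D x)"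
    by (rule set_integral_add(2)[OF relative_fisher_set_integrable D]) simp
  also have "(LINT x:{a..b}|lborel. 2 * ?D x) = 2 * (LINT x:{a..b}|lborel. ?D x)"
    by (rule set_integral_mult_right)
  also have "(LINT x:{a..b}|lborel. ?D x) = (T b - b) * \<rho> b - (T a - a) * \<rho> a"
    using primitive_on_diff[OF p, of a b] assms by simp
  finally show ?thesis .
qed

end

section \<open>The energy is at most twice the deficit\<close>

context sobolev_density
begin

text \<open>The inverse of \<open>T\<close>, up to the choice of a point where \<open>F\<close> is constant.\<close>

definition P :: "real \<Rightarrow> real" where "P t = (SOME x. F x = \<Phi> t)"

lemma F_P: "F (P t) = \<Phi> t"
proof -
  obtain x where "F x = \<Phi> t" using rho.cumulative_surj[OF \<Phi>_bounds] by blast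
  then show ?thesis unfolding P_def by (rule someI)
qed

lemma T_P: "T (P t) = t"
  by (rule T_eqI) (rule F_P)

lemma first_moment_integrable: "integrable lborel (\<lambda>x. x * \<rho> x)"
proof (rule Bochner_Integration.integrable_bound)
  show "integrable lborel (\<lambda>x. \<rho> x + x\<^sup>2 * (f x * \<phi> x))"
    using rho.integrable moment_integrable by (rule Bochner_Integration.integrable_add)
  show "AE x in lborel. norm (x * \<rho> x) \<le> norm (\<rho> x + x\<^sup>2 * (f x * \<phi> x))"
  proof (rule AE_I2)
    fix x :: real
    have "\<bar>x\<bar> * \<rho> x \<le> (1 + x\<^sup>2) * \<rho> x"
      using rho.nonneg by (intro mult_right_mono abs_le_1_plus_square) auto
    then show "norm (x * \<rho> x) \<le> norm (\<rho> x + x\<^sup>2 * (f x * \<phi> x))"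
      using rho.nonneg[of x] by (simp add: \<rho>_def abs_mult f_nonneg algebra_simps)
  qed
qed measurable

text \<open>A centered measure with a density charges both half-lines. Hence the cut points \<open>P (-n) < 0 < P n\<close>
  eventually have these signs, and the boundary terms \<open>- x \<rho>\<close> of the energy are favourable.\<close>

lemma F_0: "0 < F 0" "F 0 < 1"
proof -
  have *: False if "\<And>x. 0 \<le> c * x * \<rho> x" "c = 1 \<or> c = -1" for c
  proof -
    have "(LINT x|lborel. c * x * \<rho> x) = c * (LINT x|lborel. x * \<rho> x)" by (simp add: mult.assoc)
    then have "(LINT x|lborel. c * x * \<rho> x) = 0" using mean_0 by (simp add: \<rho>_def)
    moreover have "integrable lborel (\<lambda>x. c * x * \<rho> x)"
      using first_moment_integrable by (simp add: mult.assoc)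
    ultimately have "AE x in lborel. c * x * \<rho> x = 0"
      using integral_nonneg_eq_0_iff_AE[of lborel "\<lambda>x. c * x * \<rho> x"] that(1) by simp
    then have "AE x in lborel. \<rho> x = 0"
      using AE_lborel_singleton[of 0] by eventually_elim (use that(2) in auto)
    then have "(LINT x|lborel. \<rho> x) = (LINT x|(lborel :: real measure). 0 :: real)"
      by (intro integral_cong_AE) auto
    then show False using rho.mass by simp
  qed
  show "0 < F 0"
  proof (rule ccontr)
    assume "\<not> 0 < F 0"
    then have F0: "F 0 = 0" using rho.cumulative_nonneg[of 0] by simp
    have "\<rho> x = 0" if "x \<le> 0" for x
      using zero_le_mult_iff rho.cumulative_mono[OF that] rho.cumulative_nonneg[of x] F0
      by (intro rho.zero_where_cumulative_extremal) simp
    then have "0 \<le> 1 * x * \<rho> x" for x using rho.nonneg[of x] by (cases "x \<le> 0") auto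
    then show False using *[of 1] by blast
  qed
  show "F 0 < 1"
  proof (rule ccontr)
    assume "\<not> F 0 < 1"
    then have F0: "F 0 = 1" using rho.cumulative_le_1[of 0] by simp
    have "\<rho> x = 0" if "0 \<le> x" for x
      using rho.cumulative_mono[OF that] rho.cumulative_le_1[of x] F0
      by (intro rho.zero_where_cumulative_extremal) simp
    then have "0 \<le> -1 * x * \<rho> x" for x
      using rho.nonneg[of x] by (cases "0 \<le> x") (auto simp: mult_nonpos_nonneg)
    then show False using *[of "-1"] by blast
  qed
qed

lemma real_at_bot: "filterlim (\<lambda>n. - real n) at_bot sequentially"
  by (simp add: filterlim_uminus_at_top[symmetric] filterlim_real_sequentially)

lemma \<Phi>_tendsto_1: "(\<lambda>n. \<Phi> (real n)) \<longlonglongrightarrow> 1"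
  by (rule filterlim_compose[OF normal.cumulative_at_top filterlim_real_sequentially])

lemma \<Phi>_tendsto_0: "(\<lambda>n. \<Phi> (- real n)) \<longlonglongrightarrow> 0"
  by (rule filterlim_compose[OF normal.cumulative_at_bot real_at_bot])

lemma eventually_P_less:
  assumes "0 < F x"
  shows "eventually (\<lambda>n. P (- real n) < x) sequentially"
proof -
  have "eventually (\<lambda>n. \<Phi> (- real n) < F x) sequentially"
    by (rule order_tendstoD(2)[OF \<Phi>_tendsto_0 assms])
  then show ?thesis by (rule eventually_mono) (rule rho.cumulative_le_iff_less, simp add: F_P)
qed

lemma eventually_P_greater:
  assumes "F x < 1"
  shows "eventually (\<lambda>n. x < P (real n)) sequentially"
proof -
  have "eventually (\<lambda>n. F x < \<Phi> (real n)) sequentially"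
    by (rule order_tendstoD(1)[OF \<Phi>_tendsto_1 assms])
  then show ?thesis by (rule eventually_mono) (rule rho.cumulative_le_iff_less, simp add: F_P)
qed

text \<open>The cut points exhaust the set where \<open>0 < F < 1\<close>, and outside this set \<open>f\<close> and the integrand
  vanish.\<close>

lemma deficit_as_limit:
  "(\<lambda>n. LINT x:{P (- real n)..P (real n)}|lborel. ((h x)\<^sup>2 / f x - 2 * f x * ln (f x)) * \<phi> x) \<longlonglongrightarrow> 2 * deficit"
proof -
  let ?R = "\<lambda>x. ((h x)\<^sup>2 / f x - 2 * f x * ln (f x)) * \<phi> x"
  have R: "integrable lborel ?R"
    using relative_fisher_set_integrable[of UNIV] by (simp add: set_integrable_def)
  have "(LINT x|lborel. ?R x) = (LINT x|lborel. (h x)\<^sup>2 / f x * \<phi> x - 2 * (f x * ln (f x) * \<phi> x))"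
    by (intro Bochner_Integration.integral_cong) (simp_all add: algebra_simps)
  also have "\<dots> = (LINT x|lborel. (h x)\<^sup>2 / f x * \<phi> x) - (LINT x|lborel. 2 * (f x * ln (f x) * \<phi> x))"
    by (intro Bochner_Integration.integral_diff fisher_integrable integrable_mult_right entropy_integrable)
  also have "(LINT x|lborel. 2 * (f x * ln (f x) * \<phi> x)) = 2 * (LINT x|lborel. f x * ln (f x) * \<phi> x)"
    by (rule integral_mult_right_zero)
  finally have eq: "(LINT x|lborel. ?R x) = 2 * deficit" unfolding deficit_def by simp
  have "(\<lambda>n. LINT x|lborel. indicator {P (- real n)..P (real n)} x *\<^sub>R ?R x) \<longlonglongrightarrow> (LINT x|lborel. ?R x)"
  proof (rule integral_dominated_convergence[where w = "\<lambda>x. \<bar>?R x\<bar>"])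
    show "AE x in lborel. (\<lambda>n. indicator {P (- real n)..P (real n)} x *\<^sub>R ?R x) \<longlonglongrightarrow> ?R x"
    proof (rule AE_I2)
      fix x
      show "(\<lambda>n. indicator {P (- real n)..P (real n)} x *\<^sub>R ?R x) \<longlonglongrightarrow> ?R x"
      proof (cases "0 < F x \<and> F x < 1")
        case True
        then have "eventually (\<lambda>n. P (- real n) < x \<and> x < P (real n)) sequentially"
          using eventually_P_less[of x] eventually_P_greater[of x] by (simp add: eventually_conj)
        then have "eventually (\<lambda>n. indicator {P (- real n)..P (real n)} x *\<^sub>R ?R x = ?R x) sequentially"
          by (rule eventually_mono) (simp add: indicator_def)
        then show ?thesis by (rule tendsto_eventually)
      next
        case False
        then have "F x = 0 \<or> F x = 1"
          using rho.cumulative_nonneg[of x] rho.cumulative_le_1[of x] by linarith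
        then have "\<rho> x = 0" by (rule rho.zero_where_cumulative_extremal)
        then have "f x = 0" using \<phi>_pos[of x] by (simp add: \<rho>_def)
        then show ?thesis by simp
      qed
    qed
    show "integrable lborel (\<lambda>x. \<bar>?R x\<bar>)" using R by (rule integrable_abs)
    show "AE x in lborel. norm (indicator {P (- real n)..P (real n)} x *\<^sub>R ?R x) \<le> \<bar>?R x\<bar>" for n
      by (intro AE_I2) (simp add: indicator_def)
  qed measurable
  then show ?thesis unfolding set_lebesgue_integral_def eq .
qed

text \<open>The bound on an interval is applied to \<open>[P (-n), P n]\<close>, where \<open>T = \<mp>n\<close> at the ends. Of the
  boundary term \<open>(T - x) \<rho>\<close> the part with \<open>x\<close> has a favourable sign, and
  \<open>n \<rho> \<le> n \<surd>L \<surd>(1 - \<Phi> n)\<close> tends to \<open>0\<close>.\<close>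

lemma energy_bound:
  assumes "0 < F a" "F b < 1" "a \<le> b"
  shows "(LINT x:{a..b}|lborel. (q x)\<^sup>2 * \<phi> x) \<le> 2 * deficit"
proof -
  let ?R = "\<lambda>x. ((h x)\<^sup>2 / f x - 2 * f x * ln (f x)) * \<phi> x"
  let ?I = "\<lambda>n. LINT x:{P (- real n)..P (real n)}|lborel. ?R x"
  \<comment> \<open>the boundary terms at both ends, each counted twice\<close>
  let ?J = "\<lambda>n. ?I n + 4 * sqrt L * (real n * sqrt (1 - \<Phi> (real n)))"
  have "eventually (\<lambda>n. P (- real n) < a \<and> b < P (real n) \<and> P (- real n) < 0 \<and> 0 < P (real n)) sequentially"
    using eventually_P_less[OF assms(1)] eventually_P_greater[OF assms(2)]
      eventually_P_less[OF F_0(1)] eventually_P_greater[OF F_0(2)] by (simp add: eventually_conj)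
  then have "eventually (\<lambda>n. (LINT x:{a..b}|lborel. (q x)\<^sup>2 * \<phi> x) \<le> ?J n) sequentially"
  proof (rule eventually_mono)
    fix n :: nat
    let ?A = "P (- real n)" and ?B = "P (real n)"
    assume n: "?A < a \<and> b < ?B \<and> ?A < 0 \<and> 0 < ?B"
    have AB: "0 < F ?A" "F ?B < 1" by (simp_all add: F_P \<Phi>_bounds)
    have "(LINT x:{a..b}|lborel. (q x)\<^sup>2 * \<phi> x) \<le> (LINT x:{?A..?B}|lborel. (q x)\<^sup>2 * \<phi> x)"
      unfolding set_lebesgue_integral_def
    proof (rule integral_mono)
      show "integrable lborel (\<lambda>x. indicator {a..b} x *\<^sub>R ((q x)\<^sup>2 * \<phi> x))"
        using q_sq_integrable[OF assms(1,2)] by (simp add: set_integrable_def)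
      show "integrable lborel (\<lambda>x. indicator {?A..?B} x *\<^sub>R ((q x)\<^sup>2 * \<phi> x))"
        using q_sq_integrable[OF AB] by (simp add: set_integrable_def)
      show "indicator {a..b} x *\<^sub>R ((q x)\<^sup>2 * \<phi> x) \<le> indicator {?A..?B} x *\<^sub>R ((q x)\<^sup>2 * \<phi> x)" for x
        using n by (auto simp: indicator_def)
    qed
    also have "\<dots> \<le> ?I n + 2 * ((T ?B - ?B) * \<rho> ?B - (T ?A - ?A) * \<rho> ?A)"
      by (rule energy_on_interval[OF AB]) (use n in simp)
    finally have 1: "(LINT x:{a..b}|lborel. (q x)\<^sup>2 * \<phi> x)
        \<le> ?I n + 2 * ((T ?B - ?B) * \<rho> ?B - (T ?A - ?A) * \<rho> ?A)" .
    \<comment> \<open>the terms with \<open>x\<close> are dropped, since \<open>?A < 0 < ?B\<close>\<close>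
    have 2: "(T ?B - ?B) * \<rho> ?B \<le> real n * \<rho> ?B"
      using n rho.nonneg by (intro mult_right_mono) (auto simp: T_P)
    have "(real n + ?A) * \<rho> ?A \<le> real n * \<rho> ?A"
      using n rho.nonneg by (intro mult_right_mono) auto
    then have 3: "- ((T ?A - ?A) * \<rho> ?A) \<le> real n * \<rho> ?A" by (simp add: T_P algebra_simps)
    have 4: "real n * \<rho> ?B \<le> real n * (sqrt L * sqrt (1 - \<Phi> (real n)))"
      using rho_tail(1)[of ?B] by (intro mult_left_mono) (simp_all add: F_P)
    have 5: "real n * \<rho> ?A \<le> real n * (sqrt L * sqrt (1 - \<Phi> (real n)))"
      using rho_tail(2)[of ?A] by (intro mult_left_mono) (simp_all add: F_P \<Phi>_minus)
    have 6: "4 * sqrt L * (real n * sqrt (1 - \<Phi> (real n))) = 4 * (real n * (sqrt L * sqrt (1 - \<Phi> (real n))))"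
      by simp
    have arith: "v \<le> i + 4 * e"
      if "v \<le> i + 2 * (p - r)" "p \<le> p'" "- r \<le> r'" "p' \<le> e" "r' \<le> e" for v i p r p' r' e :: real
      using that by argo
    show "(LINT x:{a..b}|lborel. (q x)\<^sup>2 * \<phi> x) \<le> ?J n"
      unfolding 6 by (rule arith[OF 1 2 3 4 5])
  qed
  moreover have "?J \<longlonglongrightarrow> 2 * deficit + 4 * sqrt L * 0"
    by (intro tendsto_add tendsto_mult tendsto_const deficit_as_limit scaled_normal_tail_tendsto_0)
  ultimately show ?thesis
    using tendsto_lowerbound[of ?J "2 * deficit + 4 * sqrt L * 0" sequentially] by simp
qed

lemma deficit_nonneg: "0 \<le> deficit"
proof -
  have "0 \<le> (LINT x:{0..0}|lborel. (q x)\<^sup>2 * \<phi> x)"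
    unfolding set_lebesgue_integral_def by (rule Bochner_Integration.integral_nonneg) simp
  also have "\<dots> \<le> 2 * deficit" by (rule energy_bound) (use F_0 in auto)
  finally show ?thesis by simp
qed

lemma \<phi>_T_primitive:
  assumes "0 < F a" "F b < 1" "a \<le> b"
  shows "primitive_on a b (\<lambda>x. \<phi> (T x)) (\<lambda>x. - T x * \<rho> x)"
proof (rule primitive_on_C1)
  show "((\<lambda>x. \<phi> (T x)) has_real_derivative - T x * \<rho> x) (at x)" if "a \<le> x" "x \<le> b" for x
    using DERIV_chain2[OF \<phi>_deriv T_deriv[OF F_interior[OF assms(1,2) that]]] \<phi>_pos[of "T x"]
    by simp
  show "continuous_on {a..b} (\<lambda>x. - T x * \<rho> x)"
    by (intro continuous_intros T_continuous_on[OF assms(1,2)] continuous_on_subset[OF rho.continuous]) auto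
qed

text \<open>Read as functions of the mass \<open>F\<close>, the densities \<open>\<rho>\<close> and \<open>\<phi>(T)\<close> are the isoperimetric profiles
  of \<open>\<rho>\<close> and of the Gaussian; \<open>q\<close> is the derivative of their difference.\<close>

lemma profile_primitive:
  assumes "0 < F a" "F b < 1" "a \<le> b"
  shows "primitive_on a b (\<lambda>x. \<rho> x - \<phi> (T x)) (\<lambda>x. q x * sqrt (\<phi> x) * (sqrt (f x) * sqrt (\<phi> x)))"
proof -
  have "primitive_on a b (\<lambda>x. \<phi> (T x)) (\<lambda>x. - T x * \<rho> x)"
    by (rule \<phi>_T_primitive[OF assms])
  then have "primitive_on a b (\<lambda>x. \<rho> x - \<phi> (T x)) (\<lambda>x. (h x * \<phi> x + (- x * \<phi> x) * f x) - (- T x * \<rho> x))"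
    by (rule primitive_on_diff_fun[OF rho_primitive[OF assms(3)]])
  then show ?thesis
  proof (rule primitive_on_cong)
    fix x
    have "q x * sqrt (\<phi> x) * (sqrt (f x) * sqrt (\<phi> x)) = (u x * sqrt (f x) + (T x - x) * (sqrt (f x) * sqrt (f x))) * (sqrt (\<phi> x) * sqrt (\<phi> x))"
      by (simp only: q_def algebra_simps)
    also have "\<dots> = (h x + (T x - x) * f x) * \<phi> x" by (simp only: u_sqrt sqrt_f_sq) simp
    finally show "(h x * \<phi> x + (- x * \<phi> x) * f x) - (- T x * \<rho> x) = q x * sqrt (\<phi> x) * (sqrt (f x) * sqrt (\<phi> x))"
      by (simp add: \<rho>_def algebra_simps)
  qed simp
qed

lemma profile_oscillation:
  assumes "0 < F a" "F b < 1" "a \<le> b"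
  shows "\<bar>(\<rho> b - \<phi> (T b)) - (\<rho> a - \<phi> (T a))\<bar> \<le> sqrt (2 * deficit) * sqrt (F b - F a)"
proof -
  have eq: "(\<rho> b - \<phi> (T b)) - (\<rho> a - \<phi> (T a)) = (LINT x:{a..b}|lborel. q x * sqrt (\<phi> x) * (sqrt (f x) * sqrt (\<phi> x)))"
    using primitive_on_diff[OF profile_primitive[OF assms], of a b] assms by simp
  have "\<bar>(\<rho> b - \<phi> (T b)) - (\<rho> a - \<phi> (T a))\<bar> \<le> sqrt (LINT x:{a..b}|lborel. (q x)\<^sup>2 * \<phi> x) * sqrt (F b - F a)"
    unfolding eq
    by (rule Cauchy_Schwarz_density[OF assms(3) q_indicator_measurable q_sq_integrable]) (use assms in auto)
  also have "\<dots> \<le> sqrt (2 * deficit) * sqrt (F b - F a)"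
    using rho.cumulative_mono[OF assms(3)]
    by (intro mult_right_mono real_sqrt_le_mono energy_bound assms) auto
  finally show ?thesis .
qed

lemma rho_P_tendsto_0: "(\<lambda>n. \<rho> (P (real n))) \<longlonglongrightarrow> 0" "(\<lambda>n. \<rho> (P (- real n))) \<longlonglongrightarrow> 0"
proof -
  have "(\<lambda>n. sqrt L * sqrt (1 - \<Phi> (real n))) \<longlonglongrightarrow> sqrt L * sqrt (1 - 1)"
    by (intro tendsto_intros \<Phi>_tendsto_1)
  then have lim: "(\<lambda>n. sqrt L * sqrt (1 - \<Phi> (real n))) \<longlonglongrightarrow> 0" by simp
  show "(\<lambda>n. \<rho> (P (real n))) \<longlonglongrightarrow> 0"
    by (rule Lim_null_comparison[OF _ lim])
      (use rho_tail(1) rho.nonneg F_P in \<open>auto intro!: always_eventually\<close>, metis)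
  show "(\<lambda>n. \<rho> (P (- real n))) \<longlonglongrightarrow> 0"
    by (rule Lim_null_comparison[OF _ lim])
      (use rho_tail(2) rho.nonneg F_P \<Phi>_minus in \<open>auto intro!: always_eventually\<close>, metis)
qed

text \<open>Both \<open>\<rho>\<close> and \<open>\<phi>(T)\<close> vanish at the two ends of the line, so the oscillation bound can be started
  at either end.\<close>

lemma profile_distance:
  assumes "0 < F x" "F x < 1"
  shows "\<bar>\<rho> x - \<phi> (T x)\<bar> \<le> sqrt (2 * deficit) * sqrt (min (F x) (1 - F x))"
proof -
  have l: "\<bar>\<rho> x - \<phi> (T x)\<bar> \<le> sqrt (2 * deficit) * sqrt (F x)"
  proof (rule tendsto_upperbound)
    show "(\<lambda>n. \<bar>(\<rho> x - \<phi> (T x)) - (\<rho> (P (- real n)) - \<phi> (real n))\<bar>) \<longlonglongrightarrow> \<bar>\<rho> x - \<phi> (T x)\<bar>"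
      using tendsto_rabs[OF tendsto_diff[OF tendsto_const
            tendsto_diff[OF rho_P_tendsto_0(2) \<phi>_tendsto_0]], of "\<rho> x - \<phi> (T x)"] by simp
    show "\<forall>\<^sub>F n in sequentially. \<bar>(\<rho> x - \<phi> (T x)) - (\<rho> (P (- real n)) - \<phi> (real n))\<bar> \<le> sqrt (2 * deficit) * sqrt (F x)"
      using eventually_P_less[OF assms(1)]
    proof (rule eventually_mono)
      fix n assume n: "P (- real n) < x"
      have "\<bar>(\<rho> x - \<phi> (T x)) - (\<rho> (P (- real n)) - \<phi> (real n))\<bar> \<le> sqrt (2 * deficit) * sqrt (F x - F (P (- real n)))"
        using profile_oscillation[of "P (- real n)" x] n assms by (simp add: F_P \<Phi>_bounds T_P \<phi>_minus)
      also have "\<dots> \<le> sqrt (2 * deficit) * sqrt (F x)"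
        using deficit_nonneg rho.cumulative_nonneg by (intro mult_left_mono real_sqrt_le_mono) auto
      finally show "\<bar>(\<rho> x - \<phi> (T x)) - (\<rho> (P (- real n)) - \<phi> (real n))\<bar> \<le> sqrt (2 * deficit) * sqrt (F x)" .
    qed
  qed simp
  have r: "\<bar>\<rho> x - \<phi> (T x)\<bar> \<le> sqrt (2 * deficit) * sqrt (1 - F x)"
  proof (rule tendsto_upperbound)
    show "(\<lambda>n. \<bar>(\<rho> (P (real n)) - \<phi> (real n)) - (\<rho> x - \<phi> (T x))\<bar>) \<longlonglongrightarrow> \<bar>\<rho> x - \<phi> (T x)\<bar>"
      using tendsto_rabs[OF tendsto_diff[OF tendsto_diff[OF rho_P_tendsto_0(1) \<phi>_tendsto_0] tendsto_const], of "\<rho> x - \<phi> (T x)"]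
      by (simp add: abs_minus_commute)
    show "\<forall>\<^sub>F n in sequentially. \<bar>(\<rho> (P (real n)) - \<phi> (real n)) - (\<rho> x - \<phi> (T x))\<bar> \<le> sqrt (2 * deficit) * sqrt (1 - F x)"
      using eventually_P_greater[OF assms(2)]
    proof (rule eventually_mono)
      fix n assume n: "x < P (real n)"
      have "\<bar>(\<rho> (P (real n)) - \<phi> (real n)) - (\<rho> x - \<phi> (T x))\<bar> \<le> sqrt (2 * deficit) * sqrt (F (P (real n)) - F x)"
        using profile_oscillation[of x "P (real n)"] n assms by (simp add: F_P \<Phi>_bounds T_P)
      also have "\<dots> \<le> sqrt (2 * deficit) * sqrt (1 - F x)"
        using deficit_nonneg rho.cumulative_le_1 by (intro mult_left_mono real_sqrt_le_mono) auto
      finally show "\<bar>(\<rho> (P (real n)) - \<phi> (real n)) - (\<rho> x - \<phi> (T x))\<bar> \<le> sqrt (2 * deficit) * sqrt (1 - F x)" .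
    qed
  qed simp
  show ?thesis using l r by (simp add: min_def)
qed

end

section \<open>The estimate in one dimension\<close>

text \<open>With \<open>\<bar>a\<bar> \<le> \<bar>b\<bar>\<close> one has \<open>\<phi>(b) = \<phi>(a) exp(-d)\<close> for \<open>d = (b\<^sup>2 - a\<^sup>2) / 2\<close>, and
  \<open>1 - exp(-d) \<le> d\<close>. Keeping a Gaussian factor on the right makes the bound integrable in the
  variable \<open>a\<close> as well as in \<open>b\<close>.\<close>

lemma \<phi>_diff:
  "\<bar>\<phi> a - \<phi> b\<bar> \<le> \<bar>a - b\<bar> * ((\<bar>a\<bar> + \<bar>a - b\<bar>) * \<phi> a + (\<bar>b\<bar> + \<bar>a - b\<bar>) * \<phi> b)"
proof -
  have *: "\<bar>\<phi> a - \<phi> b\<bar> \<le> \<bar>a - b\<bar> * ((\<bar>a\<bar> + \<bar>a - b\<bar>) * \<phi> a)" if "\<bar>a\<bar> \<le> \<bar>b\<bar>" for a b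
  proof -
    have ab: "a\<^sup>2 \<le> b\<^sup>2" using that by (simp add: abs_le_square_iff)
    have e: "\<phi> b = \<phi> a * exp (- ((b\<^sup>2 - a\<^sup>2) / 2))"
      unfolding std_normal_density_def by (simp add: exp_add[symmetric] field_simps)
    have "exp (- ((b\<^sup>2 - a\<^sup>2) / 2)) \<le> 1" using ab by simp
    moreover have "1 - (b\<^sup>2 - a\<^sup>2) / 2 \<le> exp (- ((b\<^sup>2 - a\<^sup>2) / 2))"
      using exp_ge_add_one_self[of "- ((b\<^sup>2 - a\<^sup>2) / 2)"] by simp
    ultimately have "\<bar>1 - exp (- ((b\<^sup>2 - a\<^sup>2) / 2))\<bar> \<le> (b\<^sup>2 - a\<^sup>2) / 2"
      using ab unfolding abs_le_iff by argo
    then have "\<phi> a * \<bar>1 - exp (- ((b\<^sup>2 - a\<^sup>2) / 2))\<bar> \<le> \<phi> a * ((b\<^sup>2 - a\<^sup>2) / 2)"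
      by (intro mult_left_mono) auto
    moreover have "\<bar>\<phi> a - \<phi> b\<bar> = \<phi> a * \<bar>1 - exp (- ((b\<^sup>2 - a\<^sup>2) / 2))\<bar>"
    proof -
      have "\<phi> a - \<phi> b = \<phi> a * (1 - exp (- ((b\<^sup>2 - a\<^sup>2) / 2)))" by (simp add: e algebra_simps)
      then show ?thesis by (simp add: abs_mult)
    qed
    moreover have "(b\<^sup>2 - a\<^sup>2) / 2 \<le> \<bar>a - b\<bar> * (\<bar>a\<bar> + \<bar>a - b\<bar>)"
    proof -
      have "b\<^sup>2 - a\<^sup>2 = (\<bar>b\<bar> - \<bar>a\<bar>) * (\<bar>b\<bar> + \<bar>a\<bar>)" by (simp add: power2_eq_square algebra_simps)
      also have "\<dots> \<le> \<bar>a - b\<bar> * (2 * (\<bar>a\<bar> + \<bar>a - b\<bar>))"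
      proof (rule mult_mono)
        show "\<bar>b\<bar> - \<bar>a\<bar> \<le> \<bar>a - b\<bar>" by (rule abs_triangle_ineq2_sym)
        then have "\<bar>b\<bar> \<le> \<bar>a\<bar> + \<bar>a - b\<bar>" by simp
        then show "\<bar>b\<bar> + \<bar>a\<bar> \<le> 2 * (\<bar>a\<bar> + \<bar>a - b\<bar>)"
          using abs_ge_zero[of "a - b"] by argo
      qed auto
      also have "\<dots> = 2 * (\<bar>a - b\<bar> * (\<bar>a\<bar> + \<bar>a - b\<bar>))" by simp
      finally show ?thesis by argo
    qed
    then have "\<phi> a * ((b\<^sup>2 - a\<^sup>2) / 2) \<le> \<phi> a * (\<bar>a - b\<bar> * (\<bar>a\<bar> + \<bar>a - b\<bar>))"
      by (intro mult_left_mono) auto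
    ultimately show ?thesis by (simp add: mult_ac)
  qed
  have pos: "0 \<le> \<bar>a - b\<bar> * ((\<bar>a\<bar> + \<bar>a - b\<bar>) * \<phi> a)" "0 \<le> \<bar>a - b\<bar> * ((\<bar>b\<bar> + \<bar>a - b\<bar>) * \<phi> b)"
    by simp_all
  show ?thesis
  proof (cases "\<bar>a\<bar> \<le> \<bar>b\<bar>")
    case True
    then show ?thesis using *[of a b] pos(2) unfolding distrib_left by linarith
  next
    case False
    then have "\<bar>b\<bar> \<le> \<bar>a\<bar>" by simp
    from *[OF this] have "\<bar>\<phi> a - \<phi> b\<bar> \<le> \<bar>a - b\<bar> * ((\<bar>b\<bar> + \<bar>a - b\<bar>) * \<phi> b)"
      unfolding abs_minus_commute[of b a] abs_minus_commute[of "\<phi> b" "\<phi> a"] .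
    then show ?thesis using pos(1) unfolding distrib_left by linarith
  qed
qed

context sobolev_density
begin

lemma M_nonneg: "0 \<le> M"
proof -
  have "0 \<le> (LINT x|lborel. x\<^sup>2 * (f x * \<phi> x))"
    by (rule Bochner_Integration.integral_nonneg) (simp add: f_nonneg)
  then show ?thesis using moment_le by simp
qed

text \<open>On the bulk \<open>\<bar>T x - x\<bar> \<le> K s\<close>: the median contributes \<open>M + 122\<close> and the deviation from the
  translation \<open>60\<close>.\<close>

definition K :: real where "K = M + 182"

definition m :: "real \<Rightarrow> real" where "m x = min (F x) (1 - F x)"

lemma m_le_\<phi>_T: "0 < F x \<Longrightarrow> F x < 1 \<Longrightarrow> m x \<le> 3 * \<phi> (T x)"
  using \<Phi>_profile[of "T x"] \<Phi>_T[of x] by (simp add: m_def)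

lemma profile_distance_small:
  assumes "0 < F x" "F x < 1" "0 < s" "deficit \<le> s ^ 4"
  shows "\<bar>\<rho> x - \<phi> (T x)\<bar> \<le> 3 / 2 * s\<^sup>2 * sqrt (m x)"
proof -
  have "2 * deficit \<le> (3 / 2 * s\<^sup>2)\<^sup>2"
  proof -
    have "(3 / 2 * s\<^sup>2)\<^sup>2 = 9 / 4 * s ^ 4" by (simp add: power2_eq_square power4_eq_xxxx)
    moreover have "0 \<le> s ^ 4" by simp
    ultimately show ?thesis using assms(4) by linarith
  qed
  then have "sqrt (2 * deficit) \<le> 3 / 2 * s\<^sup>2" by (intro real_le_lsqrt) (use deficit_nonneg in auto)
  then have "sqrt (2 * deficit) * sqrt (m x) \<le> 3 / 2 * s\<^sup>2 * sqrt (m x)"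
    by (intro mult_right_mono) (use assms in \<open>simp_all add: m_def\<close>)
  then show ?thesis using profile_distance[OF assms(1,2)] by (simp add: m_def)
qed

text \<open>On the bulk \<open>\<surd>m \<ge> s\<close>, so the error \<open>3/2 s\<^sup>2 \<surd>m\<close> in the profile is small compared with
  \<open>\<phi>(T) \<ge> m / 3\<close>: the relative error is at most \<open>5 s\<^sup>2 / \<surd>m \<le> 5 s \<le> 1/2\<close>. This is where
  \<open>s \<le> 1 / 10\<close> is used.\<close>

lemma bulk_pointwise:
  assumes s: "0 < s" "s \<le> 1 / 10" "deficit \<le> s ^ 4" and x: "s\<^sup>2 \<le> F x" "F x \<le> 1 - s\<^sup>2"
  shows "\<bar>\<rho> x / \<phi> (T x) - 1\<bar> \<le> 5 * s\<^sup>2 / sqrt (m x)"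
    and "m x \<le> 6 * \<rho> x" and "\<phi> (T x) \<le> 2 * \<rho> x" and "\<bar>\<rho> x - \<phi> (T x)\<bar> \<le> 9 * s * \<rho> x"
    and "s \<le> sqrt (m x)" and "0 < m x"
proof -
  have s2: "0 < s\<^sup>2" using s by simp
  have F: "0 < F x" "F x < 1" using x s2 by linarith+
  have ms: "s\<^sup>2 \<le> m x" using x by (simp add: m_def)
  then show m0: "0 < m x" using s2 by linarith
  show sm: "s \<le> sqrt (m x)" using ms by (rule real_le_rsqrt)
  have sqm: "sqrt (m x) * sqrt (m x) = m x" using m0 by simp
  have sq0: "0 < sqrt (m x)" using m0 by simp
  note E = profile_distance_small[OF F s(1,3)]
  note mphi = m_le_\<phi>_T[OF F]
  have "5 * s\<^sup>2 / sqrt (m x) * \<phi> (T x) \<ge> 5 * s\<^sup>2 / sqrt (m x) * (m x / 3)"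
    using mphi sq0 by (intro mult_left_mono) auto
  moreover have "5 * s\<^sup>2 / sqrt (m x) * (m x / 3) = 5 / 3 * s\<^sup>2 * sqrt (m x)"
    using sq0 sqm by (simp add: field_simps)
  moreover have "3 / 2 * s\<^sup>2 * sqrt (m x) \<le> 5 / 3 * s\<^sup>2 * sqrt (m x)"
    using s2 sq0 by (intro mult_right_mono) auto
  ultimately have E5: "\<bar>\<rho> x - \<phi> (T x)\<bar> \<le> 5 * s\<^sup>2 / sqrt (m x) * \<phi> (T x)" using E by linarith
  have eq: "\<bar>\<rho> x / \<phi> (T x) - 1\<bar> = \<bar>\<rho> x - \<phi> (T x)\<bar> / \<phi> (T x)"
  proof -
    have "\<rho> x / \<phi> (T x) - 1 = (\<rho> x - \<phi> (T x)) / \<phi> (T x)"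
      using \<phi>_pos[of "T x"] by (simp add: field_simps)
    then show ?thesis by simp
  qed
  show slope: "\<bar>\<rho> x / \<phi> (T x) - 1\<bar> \<le> 5 * s\<^sup>2 / sqrt (m x)"
    unfolding eq using E5 \<phi>_pos[of "T x"] by (simp add: pos_divide_le_eq)
  have "5 * s\<^sup>2 / sqrt (m x) \<le> 5 * s\<^sup>2 / s"
    using sm s sq0 by (intro divide_left_mono mult_pos_pos) auto
  also have "\<dots> \<le> 1 / 2" using s by (simp add: power2_eq_square)
  finally have half: "5 * s\<^sup>2 / sqrt (m x) \<le> 1 / 2" .
  have "5 * s\<^sup>2 / sqrt (m x) * \<phi> (T x) \<le> 1 / 2 * \<phi> (T x)"
    by (rule mult_right_mono[OF half]) simp
  then show phi2: "\<phi> (T x) \<le> 2 * \<rho> x" using E5 by linarith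
  then show m6: "m x \<le> 6 * \<rho> x" using mphi by linarith
  have "3 / 2 * s\<^sup>2 * sqrt (m x) = 3 / 2 * s * (s * sqrt (m x))" by (simp add: power2_eq_square)
  also have "\<dots> \<le> 3 / 2 * s * (sqrt (m x) * sqrt (m x))"
    using sm s sq0 by (intro mult_left_mono mult_right_mono) auto
  also have "\<dots> = 3 / 2 * s * m x" by (simp only: sqm)
  also have "\<dots> \<le> 3 / 2 * s * (6 * \<rho> x)" using m6 s by (intro mult_left_mono) auto
  also have "\<dots> = 9 * s * \<rho> x" by simp
  finally show "\<bar>\<rho> x - \<phi> (T x)\<bar> \<le> 9 * s * \<rho> x" using E by linarith
qed

text \<open>The function \<open>k = F\<^sup>-\<^sup>1\<^sup>/\<^sup>2 - (1 - F)\<^sup>-\<^sup>1\<^sup>/\<^sup>2\<close> is decreasing with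
  \<open>- k' \<ge> \<rho> / (2 m \<surd>m) \<ge> 1 / (12 \<surd>m)\<close>, hence \<open>\<bar>T' - 1\<bar> \<le> - 60 s\<^sup>2 k'\<close>. So \<open>T - x\<close>
  becomes monotone after adding or subtracting \<open>60 s\<^sup>2 k\<close>. At the median \<open>P 0\<close> both \<open>T\<close> and
  \<open>k\<close> vanish, and \<open>\<bar>k\<bar> \<le> 1 / s\<close> on the bulk.\<close>

lemma deviation_from_shift:
  assumes s: "0 < s" "s \<le> 1 / 10" "deficit \<le> s ^ 4" and x: "s\<^sup>2 \<le> F x" "F x \<le> 1 - s\<^sup>2"
  shows "\<bar>T x - x + P 0\<bar> \<le> 60 * s"
proof -
  define k where "k = (\<lambda>x. 1 / sqrt (F x) - 1 / sqrt (1 - F x))"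
  define k' where "k' = (\<lambda>x. - (\<rho> x / 2 * (1 / (F x * sqrt (F x)) + 1 / ((1 - F x) * sqrt (1 - F x)))))"
  have s2: "0 < s\<^sup>2" "s\<^sup>2 \<le> 1 / 2" using s power_mono[of s "1 / 10" 2] by (auto simp: power2_eq_square)
  have k_deriv: "(k has_real_derivative k' y) (at y)" if "0 < F y" "F y < 1" for y
  proof -
    have inv_sqrt: "((\<lambda>v. 1 / sqrt v) has_real_derivative - (1 / (v * sqrt v)) / 2) (at v)" if "0 < v" for v :: real
    proof -
      have v: "sqrt v * sqrt v = v" using that by simp
      have "((\<lambda>v. inverse (sqrt v)) has_real_derivative
          - (inverse (sqrt v) * (inverse (sqrt v) / 2) * inverse (sqrt v))) (at v)"
        by (rule DERIV_inverse'[OF DERIV_real_sqrt[OF that]]) (use that in simp)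
      moreover have "- (inverse (sqrt v) * (inverse (sqrt v) / 2) * inverse (sqrt v)) = - (1 / (sqrt v * sqrt v * sqrt v)) / 2"
        by (simp add: divide_simps del: real_sqrt_mult_self)
      ultimately show ?thesis unfolding v by (simp only: divide_inverse mult_1_left)
    qed
    have c: "((\<lambda>x. 1 - F x) has_real_derivative - \<rho> y) (at y)"
      using DERIV_diff[OF DERIV_const rho.cumulative_deriv, of 1 y] by simp
    have "0 < 1 - F y" using that by simp
    from DERIV_diff[OF DERIV_chain2[OF inv_sqrt[OF that(1)] rho.cumulative_deriv] DERIV_chain2[OF inv_sqrt[OF this] c]]
    show ?thesis unfolding k_def by (rule DERIV_cong) (simp add: k'_def algebra_simps)
  qed
  have T_deriv': "((\<lambda>x. T x - x) has_real_derivative \<rho> y / \<phi> (T y) - 1) (at y)" if "0 < F y" "F y < 1" for y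
    by (auto intro!: derivative_eq_intros T_deriv that)
  have slope: "\<bar>\<rho> y / \<phi> (T y) - 1\<bar> \<le> 60 * s\<^sup>2 * (- k' y)" if y: "s\<^sup>2 \<le> F y" "F y \<le> 1 - s\<^sup>2" for y
  proof -
    note b = bulk_pointwise[OF s y]
    have F: "0 < F y" "F y < 1" using y s2 by linarith+
    have sq: "0 < sqrt (m y)" using b(6) by simp
    have "1 / (m y * sqrt (m y)) \<le> 1 / (F y * sqrt (F y)) + 1 / ((1 - F y) * sqrt (1 - F y))"
      using F by (cases "F y \<le> 1 - F y") (auto simp: m_def min_def)
    then have "m y / 6 / 2 * (1 / (m y * sqrt (m y))) \<le> \<rho> y / 2 * (1 / (F y * sqrt (F y)) + 1 / ((1 - F y) * sqrt (1 - F y)))"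
      using b(2,6) F by (intro mult_mono) auto
    moreover have "m y / 6 / 2 * (1 / (m y * sqrt (m y))) = 1 / (12 * sqrt (m y))"
      using b(6) sq by (simp add: field_simps)
    ultimately have "1 / (12 * sqrt (m y)) \<le> - k' y" by (simp add: k'_def)
    then have "60 * s\<^sup>2 * (1 / (12 * sqrt (m y))) \<le> 60 * s\<^sup>2 * (- k' y)"
      by (intro mult_left_mono) auto
    then show ?thesis using b(1) by simp
  qed
  have mono: "(T z - z) + 60 * s\<^sup>2 * k z \<le> (T y - y) + 60 * s\<^sup>2 * k y"
    "(T y - y) - 60 * s\<^sup>2 * k y \<le> (T z - z) - 60 * s\<^sup>2 * k z"
    if yz: "y \<le> z" "s\<^sup>2 \<le> F y" "F z \<le> 1 - s\<^sup>2" for y z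
  proof -
    have in_bulk: "s\<^sup>2 \<le> F t" "F t \<le> 1 - s\<^sup>2" "0 < F t" "F t < 1" if "y \<le> t" "t \<le> z" for t
      using rho.cumulative_mono[OF that(1)] rho.cumulative_mono[OF that(2)] yz s2 by linarith+
    show "(T z - z) + 60 * s\<^sup>2 * k z \<le> (T y - y) + 60 * s\<^sup>2 * k y"
    proof (rule DERIV_nonpos_imp_nonincreasing[OF yz(1), of "\<lambda>x. (T x - x) + 60 * s\<^sup>2 * k x"])
      fix t assume t: "y \<le> t" "t \<le> z"
      have "((\<lambda>x. (T x - x) + 60 * s\<^sup>2 * k x) has_real_derivative (\<rho> t / \<phi> (T t) - 1) + 60 * s\<^sup>2 * k' t) (at t)"
        by (intro DERIV_add T_deriv' DERIV_cmult k_deriv in_bulk t)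
      moreover have "(\<rho> t / \<phi> (T t) - 1) + 60 * s\<^sup>2 * k' t \<le> 0" using slope[OF in_bulk(1,2)[OF t]] by simp
      ultimately show "\<exists>d. ((\<lambda>x. (T x - x) + 60 * s\<^sup>2 * k x) has_real_derivative d) (at t) \<and> d \<le> 0" by blast
    qed
    show "(T y - y) - 60 * s\<^sup>2 * k y \<le> (T z - z) - 60 * s\<^sup>2 * k z"
    proof (rule DERIV_nonneg_imp_nondecreasing[OF yz(1), of "\<lambda>x. (T x - x) - 60 * s\<^sup>2 * k x"])
      fix t assume t: "y \<le> t" "t \<le> z"
      have "((\<lambda>x. (T x - x) - 60 * s\<^sup>2 * k x) has_real_derivative (\<rho> t / \<phi> (T t) - 1) - 60 * s\<^sup>2 * k' t) (at t)"
        by (intro DERIV_diff T_deriv' DERIV_cmult k_deriv in_bulk t)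
      moreover have "0 \<le> (\<rho> t / \<phi> (T t) - 1) - 60 * s\<^sup>2 * k' t" using slope[OF in_bulk(1,2)[OF t]] by simp
      ultimately show "\<exists>d. ((\<lambda>x. (T x - x) - 60 * s\<^sup>2 * k x) has_real_derivative d) (at t) \<and> 0 \<le> d" by blast
    qed
  qed
  have "\<Phi> 0 = 1 / 2" using \<Phi>_minus[of 0] by simp
  then have F0: "F (P 0) = 1 / 2" by (simp add: F_P)
  then have k0: "k (P 0) = 0" by (simp add: k_def)
  have dev: "\<bar>T x - x + P 0\<bar> \<le> 60 * s\<^sup>2 * \<bar>k x\<bar>"
  proof (cases "P 0 \<le> x")
    case True
    from mono[OF True] have "T x - x + 60 * s\<^sup>2 * k x \<le> - P 0" "- P 0 \<le> T x - x - 60 * s\<^sup>2 * k x"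
      using x F0 k0 s2 by (simp_all add: T_P)
    moreover have "60 * s\<^sup>2 * k x \<le> 60 * s\<^sup>2 * \<bar>k x\<bar>" "- (60 * s\<^sup>2 * k x) \<le> 60 * s\<^sup>2 * \<bar>k x\<bar>"
      using mult_left_mono[of "k x" "\<bar>k x\<bar>" "60 * s\<^sup>2"] mult_left_mono[of "- k x" "\<bar>k x\<bar>" "60 * s\<^sup>2"] by auto
    ultimately show ?thesis by linarith
  next
    case False
    then have "x \<le> P 0" by simp
    from mono[OF this] have "- P 0 \<le> T x - x + 60 * s\<^sup>2 * k x" "T x - x - 60 * s\<^sup>2 * k x \<le> - P 0"
      using x F0 k0 s2 by (simp_all add: T_P)
    moreover have "60 * s\<^sup>2 * k x \<le> 60 * s\<^sup>2 * \<bar>k x\<bar>" "- (60 * s\<^sup>2 * k x) \<le> 60 * s\<^sup>2 * \<bar>k x\<bar>"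
      using mult_left_mono[of "k x" "\<bar>k x\<bar>" "60 * s\<^sup>2"] mult_left_mono[of "- k x" "\<bar>k x\<bar>" "60 * s\<^sup>2"] by auto
    ultimately show ?thesis by linarith
  qed
  have "\<bar>k x\<bar> \<le> 1 / s"
  proof -
    have "s \<le> sqrt (F x)" "s \<le> sqrt (1 - F x)" using x by (auto intro!: real_le_rsqrt)
    then have "1 / sqrt (F x) \<le> 1 / s" "1 / sqrt (1 - F x) \<le> 1 / s" "0 \<le> 1 / sqrt (F x)" "0 \<le> 1 / sqrt (1 - F x)"
      using s less_le_trans[OF s(1) \<open>s \<le> sqrt (F x)\<close>] less_le_trans[OF s(1) \<open>s \<le> sqrt (1 - F x)\<close>]
      by (auto intro!: divide_left_mono simp: zero_less_mult_iff)
    then show ?thesis unfolding k_def by linarith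
  qed
  then have "60 * s\<^sup>2 * \<bar>k x\<bar> \<le> 60 * s\<^sup>2 * (1 / s)" by (intro mult_left_mono) auto
  also have "\<dots> = 60 * s" using s by (simp add: power2_eq_square)
  finally show ?thesis using dev by linarith
qed

text \<open>On the bulk \<open>\<integral> T \<rho> = 0\<close>, because \<open>- \<phi>(T)\<close> is a primitive of \<open>T \<rho>\<close> and takes the same value at
  both ends \<open>T = \<mp>t\<close>. The total mean of \<open>\<rho>\<close> is \<open>0\<close>, and outside the bulk
  \<open>\<bar>x\<bar> \<le> s x\<^sup>2 / 2 + 1 / (2 s)\<close> bounds the mean by the second moment and the mass \<open>2 s\<^sup>2\<close>. Thus
  \<open>T - x\<close> has mean \<open>O(s)\<close> on the bulk, while it is \<open>- P 0 + O(s)\<close> there.\<close>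

lemma median_small:
  assumes s: "0 < s" "s \<le> 1 / 10" "deficit \<le> s ^ 4" and t: "\<Phi> (- t) = s\<^sup>2"
  shows "\<bar>P 0\<bar> \<le> (M + 122) * s"
proof -
  let ?A = "P (- t)" and ?B = "P t"
  have FA: "F ?A = s\<^sup>2" and FB: "F ?B = 1 - s\<^sup>2" using t by (simp_all add: F_P \<Phi>_minus)
  have s2: "0 < s\<^sup>2" "s\<^sup>2 \<le> 1 / 4" using s power_mono[of s "1 / 10" 2] by (auto simp: power2_eq_square)
  have AB: "0 < F ?A" "F ?B < 1" using s2 FA FB by auto
  have le: "?A \<le> ?B" using rho.cumulative_le_iff_less[of ?A ?B] FA FB s2 by auto
  have Tc: "continuous_on {?A..?B} T" by (rule T_continuous_on[OF AB])
  have rc: "continuous_on {?A..?B} \<rho>" by (rule continuous_on_subset[OF rho.continuous]) simp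
  have i1: "set_integrable lborel {?A..?B} (\<lambda>x. T x * \<rho> x)"
    and i2: "set_integrable lborel {?A..?B} (\<lambda>x. x * \<rho> x)"
    and i3: "set_integrable lborel {?A..?B} (\<lambda>x. (T x - x + P 0) * \<rho> x)"
    and i4: "set_integrable lborel {?A..?B} (\<lambda>x. P 0 * \<rho> x)"
    and i5: "set_integrable lborel {?A..?B} \<rho>"
    by (intro borel_integrable_atLeastAtMost' continuous_intros Tc rc)+
  have T0: "(LINT x:{?A..?B}|lborel. T x * \<rho> x) = 0"
  proof -
    have "\<phi> (T ?B) - \<phi> (T ?A) = (LINT x:{?A..?B}|lborel. - T x * \<rho> x)"
      by (rule primitive_on_diff[OF \<phi>_T_primitive[OF AB le]]) (use le in auto)
    then have "(LINT x:{?A..?B}|lborel. - T x * \<rho> x) = 0" by (simp add: T_P \<phi>_minus)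
    then show ?thesis by (simp add: set_lebesgue_integral_def)
  qed
  have mass_in: "(LINT x:{?A..?B}|lborel. \<rho> x) = 1 - 2 * s\<^sup>2"
    using rho.cumulative_diff[OF le] FA FB by simp
  have x_in: "\<bar>LINT x:{?A..?B}|lborel. x * \<rho> x\<bar> \<le> (M + 2) * s / 2"
  proof -
    let ?O = "\<lambda>x. x * \<rho> x - indicator {?A..?B} x * (x * \<rho> x)"
    \<comment> \<open>the mean outside the bulk, and the function that dominates it\<close>
    let ?U = "\<lambda>x. s / 2 * (x\<^sup>2 * \<rho> x) + 1 / (2 * s) * (\<rho> x - indicator {?A..?B} x * \<rho> x)"
    have ii: "integrable lborel (\<lambda>x. indicator {?A..?B} x * (x * \<rho> x))"
      "integrable lborel (\<lambda>x. indicator {?A..?B} x * \<rho> x)"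
      using i2 i5 by (simp_all add: set_integrable_def)
    have iO: "integrable lborel ?O" by (rule Bochner_Integration.integrable_diff[OF first_moment_integrable ii(1)])
    have mom: "integrable lborel (\<lambda>x. x\<^sup>2 * \<rho> x)" using moment_integrable by (simp add: \<rho>_def)
    have iU: "integrable lborel ?U"
      by (intro Bochner_Integration.integrable_add integrable_mult_right Bochner_Integration.integrable_diff mom rho.integrable ii)
    have "(LINT x|lborel. ?O x) = (LINT x|lborel. x * \<rho> x) - (LINT x:{?A..?B}|lborel. x * \<rho> x)"
      using Bochner_Integration.integral_diff[OF first_moment_integrable ii(1)] by (simp add: set_lebesgue_integral_def)
    then have "(LINT x:{?A..?B}|lborel. x * \<rho> x) = - (LINT x|lborel. ?O x)"
      using mean_0 by (simp add: \<rho>_def)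
    then have "\<bar>LINT x:{?A..?B}|lborel. x * \<rho> x\<bar> \<le> (LINT x|lborel. \<bar>?O x\<bar>)"
      using integral_abs_bound[of lborel ?O] by simp
    also have "\<dots> \<le> (LINT x|lborel. ?U x)"
    proof (rule integral_mono[OF integrable_abs[OF iO] iU])
      fix x :: real
      have "0 \<le> (s * \<bar>x\<bar> - 1)\<^sup>2" by simp
      then have "2 * s * \<bar>x\<bar> \<le> s\<^sup>2 * x\<^sup>2 + 1" by (simp add: power2_diff power_mult_distrib)
      then have "\<bar>x\<bar> \<le> s / 2 * x\<^sup>2 + 1 / (2 * s)" using s by (simp add: field_simps power2_eq_square)
      then have "\<bar>x\<bar> * \<rho> x \<le> (s / 2 * x\<^sup>2 + 1 / (2 * s)) * \<rho> x" using rho.nonneg by (intro mult_right_mono) auto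
      then show "\<bar>?O x\<bar> \<le> ?U x"
        using s rho.nonneg[of x] by (cases "x \<in> {?A..?B}") (simp_all add: abs_mult algebra_simps)
    qed
    also have "\<dots> = s / 2 * (LINT x|lborel. x\<^sup>2 * \<rho> x) + 1 / (2 * s) * ((LINT x|lborel. \<rho> x) - (LINT x:{?A..?B}|lborel. \<rho> x))"
      using mom rho.integrable ii(2) by (simp add: set_lebesgue_integral_def)
    also have "\<dots> = s / 2 * (LINT x|lborel. x\<^sup>2 * \<rho> x) + s"
      using s by (simp add: mass_in rho.mass power2_eq_square)
    also have "\<dots> \<le> s / 2 * M + s"
      using moment_le s by (intro add_right_mono mult_left_mono) (simp_all add: \<rho>_def)
    finally show ?thesis by (simp add: algebra_simps)
  qed
  have dev: "\<bar>LINT x:{?A..?B}|lborel. (T x - x + P 0) * \<rho> x\<bar> \<le> 60 * s"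
  proof -
    have "\<bar>LINT x:{?A..?B}|lborel. (T x - x + P 0) * \<rho> x\<bar> \<le> (LINT x|lborel. \<bar>indicator {?A..?B} x *\<^sub>R ((T x - x + P 0) * \<rho> x)\<bar>)"
      unfolding set_lebesgue_integral_def by (rule integral_abs_bound)
    also have "\<dots> \<le> (LINT x|lborel. 60 * s * \<rho> x)"
    proof (rule integral_mono)
      show "integrable lborel (\<lambda>x. \<bar>indicator {?A..?B} x *\<^sub>R ((T x - x + P 0) * \<rho> x)\<bar>)"
        using i3 unfolding set_integrable_def by (rule integrable_abs)
      show "integrable lborel (\<lambda>x. 60 * s * \<rho> x)" using rho.integrable by simp
      fix x
      show "\<bar>indicator {?A..?B} x *\<^sub>R ((T x - x + P 0) * \<rho> x)\<bar> \<le> 60 * s * \<rho> x"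
      proof (cases "x \<in> {?A..?B}")
        case True
        then have "s\<^sup>2 \<le> F x" "F x \<le> 1 - s\<^sup>2"
          using rho.cumulative_mono[of ?A x] rho.cumulative_mono[of x ?B] FA FB by auto
        then have "\<bar>T x - x + P 0\<bar> * \<rho> x \<le> 60 * s * \<rho> x"
          using rho.nonneg by (intro mult_right_mono deviation_from_shift s) auto
        then show ?thesis using True rho.nonneg[of x] by (simp add: abs_mult)
      next
        case False
        then show ?thesis using s rho.nonneg[of x] by simp
      qed
    qed
    also have "\<dots> = 60 * s" using rho.mass by simp
    finally show ?thesis .
  qed
  have "(LINT x:{?A..?B}|lborel. (T x - x + P 0) * \<rho> x)
      = (LINT x:{?A..?B}|lborel. (T x * \<rho> x - x * \<rho> x) + P 0 * \<rho> x)"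
    by (simp add: algebra_simps)
  also have "\<dots> = (LINT x:{?A..?B}|lborel. T x * \<rho> x) - (LINT x:{?A..?B}|lborel. x * \<rho> x) + (LINT x:{?A..?B}|lborel. P 0 * \<rho> x)"
    using i1 i2 i4 by (simp add: set_integral_add set_integral_diff)
  also have "(LINT x:{?A..?B}|lborel. P 0 * \<rho> x) = P 0 * (1 - 2 * s\<^sup>2)"
    by (simp add: mass_in)
  finally have eq: "P 0 * (1 - 2 * s\<^sup>2) = (LINT x:{?A..?B}|lborel. (T x - x + P 0) * \<rho> x) + (LINT x:{?A..?B}|lborel. x * \<rho> x)"
    using T0 by simp
  have "\<bar>P 0 * (1 - 2 * s\<^sup>2)\<bar> \<le> 60 * s + (M + 2) * s / 2"
    unfolding eq using dev x_in by linarith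
  moreover have "\<bar>P 0\<bar> * (1 / 2) \<le> \<bar>P 0\<bar> * (1 - 2 * s\<^sup>2)" using s2 by (intro mult_left_mono) auto
  moreover have "\<bar>P 0 * (1 - 2 * s\<^sup>2)\<bar> = \<bar>P 0\<bar> * (1 - 2 * s\<^sup>2)" using s2 by (simp add: abs_mult)
  ultimately have "\<bar>P 0\<bar> * (1 / 2) \<le> 60 * s + (M + 2) * s / 2" by linarith
  then show ?thesis by (simp add: algebra_simps add_divide_distrib)
qed

lemma \<phi>_second_moment: "integrable lborel (\<lambda>x. x\<^sup>2 * \<phi> x)" "(LINT x|lborel. x\<^sup>2 * \<phi> x) = 1"
  using integrable_std_normal_moment[of 2] integral_std_normal_moment_even[of 1]
  by (simp_all add: mult.commute)

text \<open>As \<open>\<rho>\<close> and \<open>\<phi>\<close> have the same mass, their distance is \<open>2 \<integral> (\<rho> - \<phi>)\<^sup>+\<close>, so an upper bound for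
  \<open>\<rho> - \<phi>\<close> is enough: the function \<open>G\<close> on the bulk and \<open>\<rho>\<close> itself outside.\<close>

lemma L1_distance_small:
  assumes s: "0 < s" "s \<le> 1 / 10" "deficit \<le> s ^ 4"
  shows "(LINT x|lborel. \<bar>\<rho> x - \<phi> x\<bar>) \<le> 2 * (10 + K * (4 + 2 * M + 5 * K)) * s"
proof -
  define t where "t = - quantile (s\<^sup>2)"
  have s2: "0 < s\<^sup>2" "s\<^sup>2 \<le> s / 2" "s\<^sup>2 < 1" using s power_mono[of s "1 / 10" 2] by (auto simp: power2_eq_square)
  have t: "\<Phi> (- t) = s\<^sup>2" unfolding t_def using s2 by (simp add: \<Phi>_quantile)
  let ?A = "P (- t)" and ?B = "P t"
  have FA: "F ?A = s\<^sup>2" and FB: "F ?B = 1 - s\<^sup>2" using t by (simp_all add: F_P \<Phi>_minus)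
  have le: "?A \<le> ?B" using rho.cumulative_le_iff_less[of ?A ?B] FA FB s2 s by auto
  have K0: "0 \<le> K" unfolding K_def using M_nonneg by simp
  define G where "G = (\<lambda>x. s * (9 * \<rho> x + K * (2 * ((1 + 2 * K) * \<rho> x + x\<^sup>2 * \<rho> x) + ((1 + K) * \<phi> x + x\<^sup>2 * \<phi> x))))"
  have mom: "integrable lborel (\<lambda>x. x\<^sup>2 * \<rho> x)" using moment_integrable by (simp add: \<rho>_def)
  have G_int: "integrable lborel G"
    unfolding G_def
    by (intro integrable_mult_right Bochner_Integration.integrable_add rho.integrable mom normal.integrable \<phi>_second_moment)
  have "(LINT x|lborel. G x) = s * (9 + K * (2 * ((1 + 2 * K) + (LINT x|lborel. x\<^sup>2 * \<rho> x)) + ((1 + K) + 1)))"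
    unfolding G_def using mom rho.integrable normal.integrable \<phi>_second_moment by (simp add: rho.mass normal.mass)
  also have "\<dots> \<le> s * (9 + K * (2 * ((1 + 2 * K) + M) + ((1 + K) + 1)))"
    using moment_le s K0 by (intro mult_left_mono add_left_mono add_right_mono) (simp_all add: \<rho>_def)
  finally have G_le: "(LINT x|lborel. G x) \<le> s * (9 + K * (4 + 2 * M + 5 * K))" by (simp add: algebra_simps)
  have G_nonneg: "0 \<le> G x" for x
    unfolding G_def using s K0 rho.nonneg[of x] by (intro mult_nonneg_nonneg add_nonneg_nonneg) auto
  have bulk: "\<rho> x - \<phi> x \<le> G x" if x: "x \<in> {?A..?B}" for x
  proof -
    have Fx: "s\<^sup>2 \<le> F x" "F x \<le> 1 - s\<^sup>2"
      using rho.cumulative_mono[of ?A x] rho.cumulative_mono[of x ?B] FA FB x by auto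
    note b = bulk_pointwise[OF s Fx]
    have th: "\<bar>T x - x\<bar> \<le> K * s"
      using deviation_from_shift[OF s Fx] median_small[OF s t] by (simp add: K_def algebra_simps)
    also have KK: "K * s \<le> K" using mult_left_mono[of s 1 K] K0 s by simp
    finally have thK: "\<bar>T x - x\<bar> \<le> K" .
    note ax = abs_le_1_plus_square[of x]
    have "\<bar>\<phi> (T x) - \<phi> x\<bar> \<le> \<bar>T x - x\<bar> * ((\<bar>T x\<bar> + \<bar>T x - x\<bar>) * \<phi> (T x) + (\<bar>x\<bar> + \<bar>T x - x\<bar>) * \<phi> x)"
      by (rule \<phi>_diff)
    also have "\<dots> \<le> K * s * ((1 + 2 * K + x\<^sup>2) * (2 * \<rho> x) + (1 + K + x\<^sup>2) * \<phi> x)"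
    proof (rule mult_mono[OF th])
      have 1: "\<bar>T x\<bar> + \<bar>T x - x\<bar> \<le> 1 + 2 * K + x\<^sup>2" using ax thK by linarith
      have 2: "\<bar>x\<bar> + \<bar>T x - x\<bar> \<le> 1 + K + x\<^sup>2" using ax thK by linarith
      show "(\<bar>T x\<bar> + \<bar>T x - x\<bar>) * \<phi> (T x) + (\<bar>x\<bar> + \<bar>T x - x\<bar>) * \<phi> x
          \<le> (1 + 2 * K + x\<^sup>2) * (2 * \<rho> x) + (1 + K + x\<^sup>2) * \<phi> x"
        using K0 by (intro add_mono mult_mono[OF 1 b(3)] mult_right_mono[OF 2]) auto
    qed (use K0 s in auto)
    finally have "\<bar>\<phi> (T x) - \<phi> x\<bar> \<le> K * s * ((1 + 2 * K + x\<^sup>2) * (2 * \<rho> x) + (1 + K + x\<^sup>2) * \<phi> x)" .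
    then have "\<rho> x - \<phi> x \<le> 9 * s * \<rho> x + K * s * ((1 + 2 * K + x\<^sup>2) * (2 * \<rho> x) + (1 + K + x\<^sup>2) * \<phi> x)"
      using b(4) by linarith
    also have "\<dots> = G x" unfolding G_def by (simp add: algebra_simps)
    finally show ?thesis .
  qed
  \<comment> \<open>\<open>\<bar>y\<bar> = 2 y\<^sup>+ - y\<close> with \<open>y = \<rho> - \<phi>\<close>\<close>
  let ?U = "\<lambda>x. 2 * (G x + (\<rho> x - indicator {?A..?B} x * \<rho> x)) - (\<rho> x - \<phi> x)"
  have ii: "integrable lborel (\<lambda>x. indicator {?A..?B} x * \<rho> x)"
    using rho.set_integrable[of "{?A..?B}"] by (simp add: set_integrable_def)
  have U_int: "integrable lborel ?U"
    by (intro integrable_mult_right Bochner_Integration.integrable_add Bochner_Integration.integrable_diff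
        rho.integrable normal.integrable G_int ii)
  have "(LINT x|lborel. \<bar>\<rho> x - \<phi> x\<bar>) \<le> (LINT x|lborel. ?U x)"
  proof (rule integral_mono[OF integrable_abs[OF Bochner_Integration.integrable_diff[OF rho.integrable normal.integrable]] U_int])
    fix x :: real
    show "\<bar>\<rho> x - \<phi> x\<bar> \<le> ?U x"
    proof (cases "x \<in> {?A..?B}")
      case True
      then show ?thesis using bulk[OF True] G_nonneg[of x] by simp
    next
      case False
      then have "?U x = 2 * G x + \<rho> x + \<phi> x" by simp
      moreover have "\<bar>\<rho> x - \<phi> x\<bar> \<le> \<rho> x + \<phi> x"
        using rho.nonneg[of x] normal.nonneg[of x] by linarith
      ultimately show ?thesis using G_nonneg[of x] by linarith
    qed
  qed
  also have "\<dots> = 2 * ((LINT x|lborel. G x) + (1 - (LINT x:{?A..?B}|lborel. \<rho> x)))"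
    using G_int rho.integrable normal.integrable ii by (simp add: rho.mass normal.mass set_lebesgue_integral_def)
  also have "(LINT x:{?A..?B}|lborel. \<rho> x) = 1 - 2 * s\<^sup>2"
    using rho.cumulative_diff[OF le] FA FB by simp
  also have "2 * ((LINT x|lborel. G x) + (1 - (1 - 2 * s\<^sup>2))) \<le> 2 * (s * (9 + K * (4 + 2 * M + 5 * K)) + s)"
    using G_le s2(2) by (intro mult_left_mono add_mono) auto
  also have "\<dots> = 2 * (10 + K * (4 + 2 * M + 5 * K)) * s" by (simp add: algebra_simps)
  finally show ?thesis .
qed

lemma L1_distance:
  assumes s: "0 < s" "deficit \<le> s ^ 4"
  shows "(LINT x|lborel. \<bar>f x - 1\<bar> * \<phi> x) \<le> 2 * (10 + K * (4 + 2 * M + 5 * K)) * s"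
proof -
  have "(LINT x|lborel. \<bar>f x - 1\<bar> * \<phi> x) = (LINT x|lborel. \<bar>\<rho> x - \<phi> x\<bar>)"
  proof (rule Bochner_Integration.integral_cong[OF refl])
    fix x
    have "\<rho> x - \<phi> x = (f x - 1) * \<phi> x" by (simp add: \<rho>_def algebra_simps)
    then show "\<bar>f x - 1\<bar> * \<phi> x = \<bar>\<rho> x - \<phi> x\<bar>" by (simp add: abs_mult)
  qed
  also have "\<dots> \<le> 2 * (10 + K * (4 + 2 * M + 5 * K)) * s"
  proof (cases "s \<le> 1 / 10")
    case True
    then show ?thesis using L1_distance_small s by blast
  next
    case False
    have K0: "0 \<le> K" unfolding K_def using M_nonneg by simp
    have "(LINT x|lborel. \<bar>\<rho> x - \<phi> x\<bar>) \<le> (LINT x|lborel. \<rho> x + \<phi> x)"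
    proof (rule integral_mono)
      show "\<bar>\<rho> x - \<phi> x\<bar> \<le> \<rho> x + \<phi> x" for x using rho.nonneg[of x] normal.nonneg[of x] by linarith
    qed (use rho.integrable normal.integrable in auto)
    also have "\<dots> = 2" using rho.integrable normal.integrable by (simp add: rho.mass normal.mass)
    also have "\<dots> \<le> 20 * s" using False by simp
    also have "\<dots> \<le> 2 * (10 + K * (4 + 2 * M + 5 * K)) * s"
      using K0 M_nonneg s by (intro mult_right_mono) auto
    finally show ?thesis .
  qed
  finally show ?thesis .
qed

end

section \<open>Test functions\<close>

text \<open>On the line the recursion through Frechet derivatives becomes one through ordinary derivatives;
  the closure properties below follow from it by induction on \<open>k\<close>.\<close>

lemma C_k_Suc_real:
  fixes g :: "real \<Rightarrow> real"
  shows "C_k (Suc k) g \<longleftrightarrow> (\<exists>g'. (\<forall>x. (g has_real_derivative g' x) (at x)) \<and> C_k k g')"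
proof
  assume g: "C_k (Suc k) g"
  have "(g has_real_derivative frechet_derivative g (at x) 1) (at x)" for x
  proof -
    have d: "(g has_derivative frechet_derivative g (at x)) (at x)"
      using g frechet_derivative_works[of g "at x"] by simp
    have "frechet_derivative g (at x) y = frechet_derivative g (at x) 1 * y" for y
      using linear_scale[OF has_derivative_linear[OF d], of y 1] by simp
    then have "frechet_derivative g (at x) = (*) (frechet_derivative g (at x) 1)" by (rule ext)
    then show ?thesis unfolding has_field_derivative_def by (rule has_derivative_eq_rhs[OF d])
  qed
  moreover have "C_k k (\<lambda>x. frechet_derivative g (at x) 1)" using g by simp
  ultimately show "\<exists>g'. (\<forall>x. (g has_real_derivative g' x) (at x)) \<and> C_k k g'"
    by (intro exI[of _ "\<lambda>x. frechet_derivative g (at x) 1"] conjI allI)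
next
  assume "\<exists>g'. (\<forall>x. (g has_real_derivative g' x) (at x)) \<and> C_k k g'"
  then obtain g' where g': "\<And>x. (g has_real_derivative g' x) (at x)" "C_k k g'" by blast
  have "frechet_derivative g (at x) = (*) (g' x)" for x
    using frechet_derivative_at[of g "(*) (g' x)" x] g'(1)[of x] by (simp add: has_field_derivative_def)
  moreover have "g differentiable (at x)" for x
    using g'(1)[of x] by (metis has_field_derivative_def differentiable_def)
  ultimately show "C_k (Suc k) g" using g'(2) by simp
qed

lemma C_k_Suc_realI:
  fixes g :: "real \<Rightarrow> real"
  assumes "\<And>x. (g has_real_derivative g' x) (at x)" "C_k k g'"
  shows "C_k (Suc k) g"
  using assms C_k_Suc_real by blast

lemma C_k_Suc_imp_C_k: "C_k (Suc k) g \<Longrightarrow> C_k k g" for g :: "real \<Rightarrow> real"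
proof (induction k arbitrary: g)
  case 0
  then obtain g' where "\<And>x. (g has_real_derivative g' x) (at x)" using C_k_Suc_real by blast
  then have "isCont g x" for x by (rule DERIV_isCont)
  then show ?case by (simp add: continuous_at_imp_continuous_on)
next
  case (Suc k)
  from Suc.prems obtain g' where "\<And>x. (g has_real_derivative g' x) (at x)" "C_k (Suc k) g'"
    unfolding C_k_Suc_real[of "Suc k"] by blast
  from C_k_Suc_realI[OF this(1) Suc.IH[OF this(2)]] show ?case .
qed

lemma C_k_add: "C_k k f \<Longrightarrow> C_k k g \<Longrightarrow> C_k k (\<lambda>x. f x + g x)" for f g :: "real \<Rightarrow> real"
proof (induction k arbitrary: f g)
  case 0
  then show ?case by (simp add: continuous_on_add)
next
  case (Suc k)
  obtain f' g' where d: "\<And>x. (f has_real_derivative f' x) (at x)" "C_k k f'"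
    "\<And>x. (g has_real_derivative g' x) (at x)" "C_k k g'"
    using Suc.prems unfolding C_k_Suc_real by blast
  show ?case by (rule C_k_Suc_realI[OF DERIV_add[OF d(1,3)] Suc.IH[OF d(2,4)]])
qed

lemma C_k_mult: "C_k k f \<Longrightarrow> C_k k g \<Longrightarrow> C_k k (\<lambda>x. f x * g x)" for f g :: "real \<Rightarrow> real"
proof (induction k arbitrary: f g)
  case 0
  then show ?case by (simp add: continuous_on_mult)
next
  case (Suc k)
  obtain f' g' where d: "\<And>x. (f has_real_derivative f' x) (at x)" "C_k k f'"
    "\<And>x. (g has_real_derivative g' x) (at x)" "C_k k g'"
    using Suc.prems unfolding C_k_Suc_real by blast
  have "C_k k (\<lambda>x. f' x * g x + g' x * f x)"
    by (rule C_k_add[OF Suc.IH[OF d(2) C_k_Suc_imp_C_k[OF Suc.prems(2)]]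
          Suc.IH[OF d(4) C_k_Suc_imp_C_k[OF Suc.prems(1)]]])
  with DERIV_mult[OF d(1,3)] show ?case by (rule C_k_Suc_realI)
qed

lemma C_k_affine: "C_k k g \<Longrightarrow> C_k k (\<lambda>t. c * g (\<alpha> * t + \<beta>))" for g :: "real \<Rightarrow> real"
proof (induction k arbitrary: g c)
  case 0
  then have "continuous_on UNIV (\<lambda>t. g (\<alpha> * t + \<beta>))"
    by (intro continuous_on_compose2[of UNIV g UNIV "\<lambda>t. \<alpha> * t + \<beta>"]) (auto intro!: continuous_intros)
  then show ?case by (simp add: continuous_on_mult_left)
next
  case (Suc k)
  obtain g' where g': "\<And>x. (g has_real_derivative g' x) (at x)" "C_k k g'"
    using Suc.prems unfolding C_k_Suc_real by blast
  show ?case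
  proof (rule C_k_Suc_realI[of _ "\<lambda>t. (c * \<alpha>) * g' (\<alpha> * t + \<beta>)"])
    fix t
    have "((\<lambda>t. \<alpha> * t + \<beta>) has_real_derivative \<alpha>) (at t)" by (auto intro!: derivative_eq_intros)
    from DERIV_cmult[OF DERIV_chain2[OF g'(1) this], of c]
    show "((\<lambda>t. c * g (\<alpha> * t + \<beta>)) has_real_derivative (c * \<alpha>) * g' (\<alpha> * t + \<beta>)) (at t)"
      by (simp add: mult_ac)
  qed (rule Suc.IH[OF g'(2)])
qed

text \<open>The functions \<open>p(1/t) exp(-1/t)\<close> for \<open>t > 0\<close>, extended by \<open>0\<close>, form a class that is closed under
  differentiation; so its members are smooth. For \<open>p = 1\<close> this is the standard flat function.\<close>

definition flat_exp :: "real poly \<Rightarrow> real \<Rightarrow> real" where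
  "flat_exp p t = (if 0 < t then poly p (1 / t) * exp (- (1 / t)) else 0)"

lemma poly_div_exp_tendsto_0: "((\<lambda>y. poly p y / exp y) \<longlongrightarrow> 0) at_top" for p :: "real poly"
proof -
  have "((\<lambda>y. \<Sum>i\<le>degree p. coeff p i * (y ^ i / exp y)) \<longlongrightarrow> (\<Sum>i\<le>degree p. coeff p i * 0)) at_top"
    by (intro tendsto_sum tendsto_mult tendsto_const tendsto_power_div_exp_0)
  then show ?thesis by (simp add: poly_altdef sum_divide_distrib)
qed

lemma flat_exp_tendsto_0: "(flat_exp p \<longlongrightarrow> 0) (at 0)"
proof -
  have "((\<lambda>t. poly p (inverse t) / exp (inverse t)) \<longlongrightarrow> 0) (at_right (0::real))"
    by (rule filterlim_compose[OF poly_div_exp_tendsto_0 filterlim_inverse_at_top_right])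
  moreover have "eventually (\<lambda>t. poly p (inverse t) / exp (inverse t) = flat_exp p t) (at_right 0)"
    using eventually_at_right_less[of 0]
    by eventually_elim (simp add: flat_exp_def exp_minus divide_inverse)
  ultimately have "(flat_exp p \<longlongrightarrow> 0) (at_right 0)" by (rule Lim_transform_eventually)
  moreover have "eventually (\<lambda>t. flat_exp p t = 0) (at_left 0)"
    by (simp add: eventually_at_filter flat_exp_def)
  then have "(flat_exp p \<longlongrightarrow> 0) (at_left 0)" by (rule tendsto_eventually)
  ultimately show ?thesis by (simp add: filterlim_split_at)
qed

lemma flat_exp_deriv:
  "(flat_exp p has_real_derivative flat_exp ([:0, 0, 1:] * (p - pderiv p)) t) (at t)"
proof -
  consider "0 < t" | "t < 0" | "t = 0" by linarith
  then show ?thesis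
  proof cases
    case 1
    have "((\<lambda>t. poly p (1 / t) * exp (- (1 / t))) has_real_derivative flat_exp ([:0, 0, 1:] * (p - pderiv p)) t) (at t)"
    proof -
      have inv: "((\<lambda>t. 1 / t) has_real_derivative - (1 / t) * (1 / t)) (at t)"
        using 1 by (auto intro!: derivative_eq_intros simp: divide_simps)
      have 2: "((\<lambda>t. exp (- (1 / t))) has_real_derivative exp (- (1 / t)) * - (- (1 / t) * (1 / t))) (at t)"
        by (rule DERIV_chain2[OF DERIV_exp DERIV_minus[OF inv]])
      have "((\<lambda>t. poly p (1 / t)) has_real_derivative poly (pderiv p) (1 / t) * (- (1 / t) * (1 / t))) (at t)"
        by (rule DERIV_chain2[OF poly_DERIV inv])
      from DERIV_mult[OF this 2] show ?thesis
        by (rule DERIV_cong) (use 1 in \<open>simp add: flat_exp_def algebra_simps\<close>)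
    qed
    moreover have "eventually (\<lambda>s. poly p (1 / s) * exp (- (1 / s)) = flat_exp p s) (nhds t)"
      using eventually_nhds_in_open[of "{0<..}" t] 1 by (auto elim!: eventually_mono simp: flat_exp_def)
    ultimately show ?thesis by (subst (asm) DERIV_cong_ev) auto
  next
    case 2
    have "eventually (\<lambda>s. 0 = flat_exp p s) (nhds t)"
      using eventually_nhds_in_open[of "{..<0}" t] 2 by (auto elim!: eventually_mono simp: flat_exp_def)
    moreover have "((\<lambda>s. 0) has_real_derivative flat_exp ([:0, 0, 1:] * (p - pderiv p)) t) (at t)"
      using 2 by (simp add: flat_exp_def)
    ultimately show ?thesis by (subst (asm) DERIV_cong_ev) auto
  next
    case 3
    have "((\<lambda>s. flat_exp p s / s) \<longlongrightarrow> 0) (at 0)"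
    proof (rule Lim_transform_eventually[OF flat_exp_tendsto_0[of "[:0, 1:] * p"]])
      show "eventually (\<lambda>s. flat_exp ([:0, 1:] * p) s = flat_exp p s / s) (at 0)"
        by (intro always_eventually) (simp add: flat_exp_def)
    qed
    then show ?thesis using 3 by (simp add: has_field_derivative_iff flat_exp_def)
  qed
qed

lemma flat_exp_C_k: "C_k k (flat_exp p)"
proof (induction k arbitrary: p)
  case 0
  have "isCont (flat_exp p) t" for t using flat_exp_deriv by (rule DERIV_isCont)
  then show ?case by (simp add: continuous_at_imp_continuous_on)
next
  case (Suc k)
  then show ?case by (intro C_k_Suc_realI[OF flat_exp_deriv])
qed

text \<open>A smooth function that is positive exactly on \<open>(a, b)\<close>. The dilation by \<open>n + 1\<close> makes it increase
  to the indicator function of this interval.\<close>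

definition bump :: "nat \<Rightarrow> real \<Rightarrow> real \<Rightarrow> real \<Rightarrow> real" where
  "bump n a b t = flat_exp 1 (real (Suc n) * (t - a)) * flat_exp 1 (real (Suc n) * (b - t))"

lemma bump_eq: "bump n a b t = (if a < t \<and> t < b
    then exp (- (1 / (real (Suc n) * (t - a)))) * exp (- (1 / (real (Suc n) * (b - t)))) else 0)"
  by (auto simp: bump_def flat_exp_def zero_less_mult_iff)

lemma bump_bounds: "0 \<le> bump n a b t" "bump n a b t \<le> 1"
proof -
  show "0 \<le> bump n a b t" by (simp add: bump_eq)
  have "exp (- (1 / (real (Suc n) * u))) \<le> 1" if "0 < u" for u
    using that by simp
  then have "exp (- (1 / (real (Suc n) * (t - a)))) * exp (- (1 / (real (Suc n) * (b - t)))) \<le> 1 * 1"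
    if "a < t" "t < b" using that by (intro mult_mono) auto
  then show "bump n a b t \<le> 1" by (simp add: bump_eq)
qed

lemma bump_pos: "a < t \<Longrightarrow> t < b \<Longrightarrow> 0 < bump n a b t"
  by (simp add: bump_eq)

lemma bump_zero: "\<not> (a < t \<and> t < b) \<Longrightarrow> bump n a b t = 0"
  by (simp add: bump_eq)

lemma bump_tendsto: "(\<lambda>n. bump n a b t) \<longlonglongrightarrow> indicator {a<..<b} t"
proof (cases "a < t \<and> t < b")
  case True
  have *: "(\<lambda>n. exp (- (1 / (real (Suc n) * u)))) \<longlonglongrightarrow> 1" if "0 < u" for u
  proof -
    have "(\<lambda>n. exp (- (inverse (real (Suc n)) * (1 / u)))) \<longlonglongrightarrow> exp (- (0 * (1 / u)))"
      by (intro tendsto_exp tendsto_minus tendsto_mult tendsto_const LIMSEQ_inverse_real_of_nat)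
    then show ?thesis by (simp add: divide_inverse mult_ac)
  qed
  have "(\<lambda>n. exp (- (1 / (real (Suc n) * (t - a)))) * exp (- (1 / (real (Suc n) * (b - t))))) \<longlonglongrightarrow> 1 * 1"
    using True by (intro tendsto_mult *) auto
  then show ?thesis using True by (simp add: bump_eq)
qed (simp add: bump_zero)

lemma test_function_boundedI:
  fixes g :: "'a::euclidean_space \<Rightarrow> real"
  assumes "\<And>k. C_k k g" "bounded {x. g x \<noteq> 0}"
  shows "test_function g"
  using assms by (simp add: test_function_def compact_eq_bounded_closed bounded_closure)

lemma bump_test_function: "test_function (bump n a b)"
proof (rule test_function_boundedI)
  fix k
  have "C_k k (\<lambda>t. (1 * flat_exp 1 (real (Suc n) * t + (- (real (Suc n) * a)))) * (1 * flat_exp 1 (- (real (Suc n)) * t + real (Suc n) * b)))"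
    by (rule C_k_mult[OF C_k_affine[OF flat_exp_C_k] C_k_affine[OF flat_exp_C_k]])
  then show "C_k k (bump n a b)"
    unfolding bump_def[abs_def] by (simp add: algebra_simps)
  have "{x. bump n a b x \<noteq> 0} \<subseteq> {a..b}" by (auto simp: bump_eq split: if_splits)
  then show "bounded {x. bump n a b x \<noteq> 0}" by (rule bounded_subset[OF bounded_closed_interval])
qed

lemma test_function_support:
  fixes g :: "'a::euclidean_space \<Rightarrow> real"
  assumes "test_function g"
  obtains R where "0 < R" "\<And>x. g x \<noteq> 0 \<Longrightarrow> norm x \<le> R"
proof -
  have "bounded {x. g x \<noteq> 0}"
    using assms bounded_subset[OF compact_imp_bounded closure_subset] by (auto simp: test_function_def)
  then obtain R where "\<And>x. g x \<noteq> 0 \<Longrightarrow> norm x \<le> R" by (auto simp: bounded_iff)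
  then show ?thesis by (intro that[of "max R 1"]) (auto simp: max.coboundedI1)
qed

lemma test_function_real_deriv:
  fixes g :: "real \<Rightarrow> real"
  assumes "test_function g"
  obtains g' where "\<And>x. (g has_real_derivative g' x) (at x)" "test_function g'"
    "\<And>x. frechet_derivative g (at x) 1 = g' x"
proof -
  define g' where "g' = (\<lambda>x. frechet_derivative g (at x) 1)"
  have d: "(g has_real_derivative g' x) (at x)" for x
  proof -
    have "C_k (Suc 0) g" using assms by (simp add: test_function_def)
    then obtain h where h: "\<And>x. (g has_real_derivative h x) (at x)" using C_k_Suc_real by blast
    have "frechet_derivative g (at x) = (*) (h x)"
      using frechet_derivative_at[of g "(*) (h x)" x] h[of x] by (simp add: has_field_derivative_def)
    then show ?thesis using h[of x] by (simp add: g'_def)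
  qed
  obtain R where R: "0 < R" "\<And>x. g x \<noteq> 0 \<Longrightarrow> norm x \<le> R" using test_function_support[OF assms] by blast
  have "g' x = 0" if "R < \<bar>x\<bar>" for x
  proof -
    have "open {y. R < \<bar>y :: real\<bar>}" by (intro open_Collect_less continuous_intros)
    then have "eventually (\<lambda>y. y \<in> {y. R < \<bar>y\<bar>}) (nhds x)" using that by (intro eventually_nhds_in_open) auto
    then have "eventually (\<lambda>y. g y = 0) (nhds x)" by (rule eventually_mono) (use R(2) in force)
    then have "((\<lambda>y. 0) has_real_derivative g' x) (at x)" using d[of x] by (subst (asm) DERIV_cong_ev) auto
    then show ?thesis using DERIV_unique DERIV_const by blast
  qed
  then have "{x. g' x \<noteq> 0} \<subseteq> {-R..R}" by force
  then have "bounded {x. g' x \<noteq> 0}" by (rule bounded_subset[OF bounded_closed_interval])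
  moreover have "C_k k g'" for k
    using assms unfolding test_function_def g'_def by (auto dest: spec[of _ "Suc k"])
  ultimately have "test_function g'" by (intro test_function_boundedI)
  with d show ?thesis by (intro that) (simp_all add: g'_def)
qed

lemma test_function_continuous:
  fixes g :: "'a::euclidean_space \<Rightarrow> real"
  assumes "test_function g"
  shows "continuous_on S g"
proof -
  have "C_k 0 g" using assms unfolding test_function_def by blast
  then show ?thesis by (auto intro: continuous_on_subset)
qed

lemma test_function_bounded:
  fixes g :: "'a::euclidean_space \<Rightarrow> real"
  assumes "test_function g"
  obtains B where "0 < B" "\<And>x. \<bar>g x\<bar> \<le> B"
proof -
  obtain R where R: "0 < R" "\<And>x. g x \<noteq> 0 \<Longrightarrow> norm x \<le> R" using test_function_support[OF assms] by blast
  have "bounded (g ` cball 0 R)"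
    by (intro compact_imp_bounded compact_continuous_image test_function_continuous assms) simp
  then obtain B where B: "\<And>x. x \<in> cball 0 R \<Longrightarrow> \<bar>g x\<bar> \<le> B"
    unfolding bounded_iff by (metis imageI real_norm_def)
  have "\<bar>g x\<bar> \<le> max B 1" for x using B[of x] R(2)[of x] by (cases "g x = 0") (auto simp: max.coboundedI1)
  then show ?thesis by (intro that[of "max B 1"]) auto
qed

lemma locally_integrable_mult_test_function:
  fixes D g :: "'a::euclidean_space \<Rightarrow> real"
  assumes D: "locally_integrable D" and g: "test_function g"
  shows "integrable lborel (\<lambda>x. D x * g x)"
proof -
  obtain R where R: "0 < R" "\<And>x. g x \<noteq> 0 \<Longrightarrow> norm x \<le> R" using test_function_support[OF g] by blast
  obtain B where B: "0 < B" "\<And>x. \<bar>g x\<bar> \<le> B" using test_function_bounded[OF g] by blast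
  have [measurable]: "D \<in> borel_measurable borel" using D by (simp add: locally_integrable_def)
  have [measurable]: "g \<in> borel_measurable borel"
    by (rule borel_measurable_continuous_onI) (rule test_function_continuous[OF g])
  have "integrable lborel (\<lambda>x. indicator (cball 0 R) x *\<^sub>R D x)"
    using D unfolding locally_integrable_def set_integrable_def by simp
  then have "integrable lborel (\<lambda>x. B * (indicator (cball 0 R) x *\<^sub>R D x))" by simp
  then show ?thesis
  proof (rule Bochner_Integration.integrable_bound)
    show "AE x in lborel. norm (D x * g x) \<le> norm (B * (indicator (cball 0 R) x *\<^sub>R D x))"
    proof (rule AE_I2)
      fix x
      show "norm (D x * g x) \<le> norm (B * (indicator (cball 0 R) x *\<^sub>R D x))"
      proof (cases "g x = 0")
        case False
        then have "x \<in> cball 0 R" using R(2) by simp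
        then show ?thesis using B(1) mult_right_mono[OF B(2)[of x], of "\<bar>D x\<bar>"] by (simp add: abs_mult mult.commute)
      qed simp
    qed
  qed measurable
qed

text \<open>Products of functions of single coordinates: their partial derivatives are again of this form.\<close>

definition tensor :: "('a::euclidean_space \<Rightarrow> real \<Rightarrow> real) \<Rightarrow> 'a \<Rightarrow> real" where
  "tensor \<psi> x = (\<Prod>b\<in>Basis. \<psi> b (x \<bullet> b))"

lemma tensor_has_derivative:
  assumes "\<And>b t. b \<in> Basis \<Longrightarrow> (\<psi> b has_real_derivative \<psi>' b t) (at t)"
  shows "(tensor \<psi> has_derivative
      (\<lambda>y. \<Sum>c\<in>Basis. \<psi>' c (x \<bullet> c) * (y \<bullet> c) * (\<Prod>b\<in>Basis - {c}. \<psi> b (x \<bullet> b)))) (at x)"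
  unfolding tensor_def[abs_def]
proof (rule has_derivative_prod)
  fix b :: 'a assume b: "b \<in> Basis"
  have "((\<lambda>x. x \<bullet> b) has_derivative (\<lambda>y. y \<bullet> b)) (at x)" by (auto intro!: derivative_eq_intros)
  from has_derivative_compose[OF this, of "\<psi> b" "(*) (\<psi>' b (x \<bullet> b))"] assms[OF b, of "x \<bullet> b"]
  show "((\<lambda>x. \<psi> b (x \<bullet> b)) has_derivative (\<lambda>y. \<psi>' b (x \<bullet> b) * (y \<bullet> b))) (at x)"
    by (simp add: has_field_derivative_def)
qed

lemma tensor_update:
  assumes "c \<in> Basis"
  shows "tensor (\<psi>(c := g)) x = g (x \<bullet> c) * (\<Prod>b\<in>Basis - {c}. \<psi> b (x \<bullet> b))"
proof -
  have "tensor (\<psi>(c := g)) x = g (x \<bullet> c) * (\<Prod>b\<in>Basis - {c}. (\<psi>(c := g)) b (x \<bullet> b))"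
    unfolding tensor_def using prod.remove[OF finite_Basis assms, of "\<lambda>b. (\<psi>(c := g)) b (x \<bullet> b)"] by simp
  also have "(\<Prod>b\<in>Basis - {c}. (\<psi>(c := g)) b (x \<bullet> b)) = (\<Prod>b\<in>Basis - {c}. \<psi> b (x \<bullet> b))"
    by (intro prod.cong) auto
  finally show ?thesis .
qed

lemma tensor_frechet_derivative:
  assumes "\<And>b t. b \<in> Basis \<Longrightarrow> (\<psi> b has_real_derivative \<psi>' b t) (at t)" and c: "c \<in> Basis"
  shows "frechet_derivative (tensor \<psi>) (at x) c = tensor (\<psi>(c := \<psi>' c)) x"
proof -
  have "(\<lambda>y. \<Sum>b\<in>Basis. \<psi>' b (x \<bullet> b) * (y \<bullet> b) * (\<Prod>d\<in>Basis - {b}. \<psi> d (x \<bullet> d)))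
      = frechet_derivative (tensor \<psi>) (at x)"
    by (rule frechet_derivative_at[OF tensor_has_derivative[OF assms(1)]])
  from fun_cong[OF this, of c] have "frechet_derivative (tensor \<psi>) (at x) c
      = (\<Sum>b\<in>Basis. \<psi>' b (x \<bullet> b) * (c \<bullet> b) * (\<Prod>d\<in>Basis - {b}. \<psi> d (x \<bullet> d)))"
    by simp
  also have "\<dots> = (\<Sum>b\<in>Basis. if b = c then \<psi>' c (x \<bullet> c) * (\<Prod>d\<in>Basis - {c}. \<psi> d (x \<bullet> d)) else 0)"
    using c by (intro sum.cong) (auto simp: inner_Basis)
  also have "\<dots> = tensor (\<psi>(c := \<psi>' c)) x" using c by (simp add: tensor_update)
  finally show ?thesis .
qed

lemma tensor_C_k:
  fixes \<psi> :: "'a::euclidean_space \<Rightarrow> real \<Rightarrow> real"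
  shows "(\<And>b. b \<in> Basis \<Longrightarrow> C_k k (\<psi> b)) \<Longrightarrow> C_k k (tensor \<psi>)"
proof (induction k arbitrary: \<psi>)
  case 0
  then have "continuous_on UNIV (\<psi> b)" if "b \<in> Basis" for b using that by simp
  then show ?case unfolding tensor_def[abs_def]
    by (auto intro!: continuous_on_prod continuous_on_compose2[of UNIV "\<psi> b" UNIV "\<lambda>x. x \<bullet> b" for b] continuous_intros)
next
  case (Suc k)
  have "\<forall>b\<in>Basis. \<exists>g'. (\<forall>x. (\<psi> b has_real_derivative g' x) (at x)) \<and> C_k k g'"
    using Suc.prems C_k_Suc_real by blast
  from bchoice[OF this] obtain \<psi>' where
    d: "\<And>b t. b \<in> Basis \<Longrightarrow> (\<psi> b has_real_derivative \<psi>' b t) (at t)" "\<And>b. b \<in> Basis \<Longrightarrow> C_k k (\<psi>' b)" by blast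
  have "C_k k (\<lambda>x. frechet_derivative (tensor \<psi>) (at x) c)" if c: "c \<in> Basis" for c
  proof -
    have "C_k k (tensor (\<psi>(c := \<psi>' c)))"
      using d(2) C_k_Suc_imp_C_k[OF Suc.prems] by (intro Suc.IH) auto
    moreover have "(\<lambda>x. frechet_derivative (tensor \<psi>) (at x) c) = tensor (\<psi>(c := \<psi>' c))"
      by (rule ext) (rule tensor_frechet_derivative[OF d(1) c])
    ultimately show ?thesis by (simp only:)
  qed
  moreover have "tensor \<psi> differentiable (at x)" for x
    using tensor_has_derivative[of \<psi> \<psi>', OF d(1)] by (auto simp: differentiable_def)
  ultimately show ?case by simp
qed

lemma tensor_test_function:
  fixes \<psi> :: "'a::euclidean_space \<Rightarrow> real \<Rightarrow> real"
  assumes "\<And>b. b \<in> Basis \<Longrightarrow> test_function (\<psi> b)"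
  shows "test_function (tensor \<psi>)"
proof (rule test_function_boundedI)
  show "C_k k (tensor \<psi>)" for k using assms by (intro tensor_C_k) (auto simp: test_function_def)
  have "\<forall>b\<in>Basis. \<exists>R. \<forall>t. \<psi> b t \<noteq> 0 \<longrightarrow> \<bar>t\<bar> \<le> R"
    using test_function_support[OF assms] by (metis real_norm_def)
  from bchoice[OF this] obtain R where R: "\<And>b t. b \<in> Basis \<Longrightarrow> \<psi> b t \<noteq> 0 \<Longrightarrow> \<bar>t\<bar> \<le> R b" by blast
  have "{x. tensor \<psi> x \<noteq> 0} \<subseteq> cball 0 (\<Sum>b\<in>Basis. R b)"
  proof
    fix x assume "x \<in> {x. tensor \<psi> x \<noteq> 0}"
    then have "\<psi> b (x \<bullet> b) \<noteq> 0" if "b \<in> Basis" for b using that by (auto simp: tensor_def)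
    then have "(\<Sum>b\<in>Basis. \<bar>x \<bullet> b\<bar>) \<le> (\<Sum>b\<in>Basis. R b)" using R by (intro sum_mono) auto
    then show "x \<in> cball 0 (\<Sum>b\<in>Basis. R b)" using norm_le_l1[of x] by simp
  qed
  then show "bounded {x. tensor \<psi> x \<noteq> 0}" by (rule bounded_subset[OF bounded_cball])
qed

definition box_bump :: "nat \<Rightarrow> 'a::euclidean_space \<Rightarrow> 'a \<Rightarrow> 'a \<Rightarrow> real" where
  "box_bump n l r = tensor (\<lambda>b. bump n (l \<bullet> b) (r \<bullet> b))"

lemma box_bump_test_function: "test_function (box_bump n l r)"
  unfolding box_bump_def by (intro tensor_test_function bump_test_function)

lemma box_bump_tendsto: "(\<lambda>n. box_bump n l r x) \<longlonglongrightarrow> indicator (box l r) x"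
proof -
  have "(\<lambda>n. box_bump n l r x) \<longlonglongrightarrow> (\<Prod>b\<in>Basis. indicator {l \<bullet> b<..<r \<bullet> b} (x \<bullet> b))"
    unfolding box_bump_def tensor_def by (intro tendsto_prod bump_tendsto)
  also have "(\<Prod>b\<in>Basis. indicator {l \<bullet> b<..<r \<bullet> b} (x \<bullet> b)) = (indicator (box l r) x :: real)"
    by (auto simp: indicator_def mem_box)
  finally show ?thesis .
qed

lemma box_bump_bound: "\<bar>box_bump n l r x\<bar> \<le> indicator (cbox l r) x"
proof (cases "x \<in> cbox l r")
  case True
  have "box_bump n l r x \<le> 1"
    unfolding box_bump_def tensor_def by (intro prod_le_1) (auto simp: bump_bounds)
  moreover have "0 \<le> box_bump n l r x"
    unfolding box_bump_def tensor_def by (intro prod_nonneg) (auto simp: bump_bounds)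
  ultimately show ?thesis using True by simp
next
  case False
  then obtain b where "b \<in> Basis" "\<not> (l \<bullet> b < x \<bullet> b \<and> x \<bullet> b < r \<bullet> b)"
    by (auto simp: mem_box)
  then have "box_bump n l r x = 0"
    unfolding box_bump_def tensor_def using bump_zero by (auto intro!: bexI[of _ b])
  then show ?thesis by simp
qed

section \<open>The fundamental lemma of the calculus of variations\<close>

text \<open>The positive and the negative part of \<open>D\<close> are densities of measures that agree on boxes, hence
  everywhere.\<close>

lemma AE_zero_if_box_integrals_zero:
  fixes D :: "'a::euclidean_space \<Rightarrow> real"
  assumes D: "locally_integrable D"
    and zero: "\<And>l r. (LINT x:box l r|lborel. D x) = 0"
  shows "AE x in lborel. D x = 0"
proof -
  have [measurable]: "D \<in> borel_measurable borel" using D by (simp add: locally_integrable_def)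
  have int: "set_integrable lborel (box l r) D" for l r
    by (rule set_integrable_subset[of _ "cbox l r"])
      (use D in \<open>auto simp: locally_integrable_def box_subset_cbox\<close>)
  have pm: "emeasure (density lborel (\<lambda>x. ennreal (D x))) (box l r) = emeasure (density lborel (\<lambda>x. ennreal (- D x))) (box l r)"
    "emeasure (density lborel (\<lambda>x. ennreal (D x))) (box l r) \<noteq> \<infinity>" for l r
  proof -
    have i: "integrable lborel (\<lambda>x. indicator (box l r) x * D x)" using int[of l r] by (simp add: set_integrable_def)
    have im: "integrable lborel (\<lambda>x. max 0 (indicator (box l r) x * D x))"
      "integrable lborel (\<lambda>x. max 0 (- (indicator (box l r) x * D x)))"
      using i by (auto intro!: integrable_max)
    have p: "emeasure (density lborel (\<lambda>x. ennreal (D x))) (box l r) = ennreal (LINT x|lborel. max 0 (indicator (box l r) x * D x))"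
      by (subst nn_integral_eq_integral[OF im(1), symmetric])
        (auto simp: emeasure_density indicator_def ennreal_neg max_def intro!: nn_integral_cong)
    have n: "emeasure (density lborel (\<lambda>x. ennreal (- D x))) (box l r) = ennreal (LINT x|lborel. max 0 (- (indicator (box l r) x * D x)))"
      by (subst nn_integral_eq_integral[OF im(2), symmetric])
        (auto simp: emeasure_density indicator_def ennreal_neg max_def intro!: nn_integral_cong)
    have "(LINT x|lborel. max 0 (indicator (box l r) x * D x)) - (LINT x|lborel. max 0 (- (indicator (box l r) x * D x)))
        = (LINT x|lborel. max 0 (indicator (box l r) x * D x) - max 0 (- (indicator (box l r) x * D x)))"
      using i by (intro Bochner_Integration.integral_diff[symmetric]) auto
    also have "\<dots> = (LINT x|lborel. indicator (box l r) x * D x)"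
      by (intro Bochner_Integration.integral_cong) auto
    also have "\<dots> = 0" using zero[of l r] by (simp add: set_lebesgue_integral_def)
    finally show "emeasure (density lborel (\<lambda>x. ennreal (D x))) (box l r) = emeasure (density lborel (\<lambda>x. ennreal (- D x))) (box l r)"
      "emeasure (density lborel (\<lambda>x. ennreal (D x))) (box l r) \<noteq> \<infinity>"
      unfolding p n by auto
  qed
  have "density lborel (\<lambda>x. ennreal (D x)) = density lborel (\<lambda>x. ennreal (- D x))"
  proof (rule measure_eqI_generator_eq)
    let ?E = "range (\<lambda>(a, b). box a b :: 'a set)"
    show "Int_stable ?E" by (auto simp: Int_stable_def box_Int_box)
    show "?E \<subseteq> Pow UNIV" "sets (density lborel (\<lambda>x. ennreal (D x))) = sigma_sets UNIV ?E"
      "sets (density lborel (\<lambda>x. ennreal (- D x))) = sigma_sets UNIV ?E"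
      by (simp_all add: borel_eq_box)
    let ?A = "\<lambda>n::nat. box (- (real n *\<^sub>R One)) (real n *\<^sub>R One) :: 'a set"
    show "range ?A \<subseteq> ?E" "(\<Union>i. ?A i) = UNIV" unfolding UN_box_eq_UNIV by auto
    show "emeasure (density lborel (\<lambda>x. ennreal (D x))) (?A i) \<noteq> \<infinity>" for i by (rule pm(2))
    show "emeasure (density lborel (\<lambda>x. ennreal (D x))) X = emeasure (density lborel (\<lambda>x. ennreal (- D x))) X"
      if "X \<in> ?E" for X using that pm(1) by auto
  qed
  then have "AE x in lborel. ennreal (D x) = ennreal (- D x)"
    by (subst (asm) sigma_finite_measure.density_unique_iff[OF sigma_finite_lborel]) auto
  then show ?thesis
  proof (rule eventually_mono)
    fix x assume "ennreal (D x) = ennreal (- D x)"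
    then show "D x = 0" by (cases "0 \<le> D x") (auto simp: ennreal_neg ennreal_eq_0_iff)
  qed
qed

lemma AE_zero_if_orthogonal_to_bumps:
  fixes D :: "'a::euclidean_space \<Rightarrow> real"
  assumes D: "locally_integrable D"
    and zero: "\<And>n l r. (LINT x|lborel. D x * box_bump n l r x) = 0"
  shows "AE x in lborel. D x = 0"
proof (rule AE_zero_if_box_integrals_zero[OF D])
  fix l r :: 'a
  have [measurable]: "D \<in> borel_measurable borel" using D by (simp add: locally_integrable_def)
  have [measurable]: "box_bump n l r \<in> borel_measurable borel" for n
    by (intro borel_measurable_continuous_onI test_function_continuous box_bump_test_function)
  have "(\<lambda>n. LINT x|lborel. D x * box_bump n l r x) \<longlonglongrightarrow> (LINT x|lborel. D x * indicator (box l r) x)"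
  proof (rule integral_dominated_convergence[where w = "\<lambda>x. \<bar>indicator (cbox l r) x *\<^sub>R D x\<bar>"])
    have "set_integrable lborel (cbox l r) D" using D by (simp add: locally_integrable_def)
    then show "integrable lborel (\<lambda>x. \<bar>indicator (cbox l r) x *\<^sub>R D x\<bar>)"
      unfolding set_integrable_def by (rule integrable_abs)
    show "AE x in lborel. (\<lambda>n. D x * box_bump n l r x) \<longlonglongrightarrow> D x * indicator (box l r) x"
      by (intro AE_I2 tendsto_mult tendsto_const box_bump_tendsto)
    show "AE x in lborel. norm (D x * box_bump n l r x) \<le> \<bar>indicator (cbox l r) x *\<^sub>R D x\<bar>" for n
    proof (rule AE_I2)
      fix x show "norm (D x * box_bump n l r x) \<le> \<bar>indicator (cbox l r) x *\<^sub>R D x\<bar>"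
        using mult_left_mono[OF box_bump_bound[of n l r x], of "\<bar>D x\<bar>"] by (simp add: abs_mult mult.commute)
    qed
  qed measurable
  then have "(LINT x|lborel. D x * indicator (box l r) x) = 0"
    unfolding zero using LIMSEQ_unique tendsto_const by blast
  then show "(LINT x:box l r|lborel. D x) = 0" by (simp add: set_lebesgue_integral_def mult.commute)
qed

section \<open>The lemma of du Bois-Reymond\<close>

text \<open>Zero is the base point, with the usual sign convention to its left.\<close>

definition primitive :: "(real \<Rightarrow> real) \<Rightarrow> real \<Rightarrow> real" where
  "primitive g x = (if 0 \<le> x then (LINT s:{0..x}|lborel. g s) else - (LINT s:{x..0}|lborel. g s))"

lemma locally_integrable_set_integrable:
  "locally_integrable g \<Longrightarrow> compact A \<Longrightarrow> set_integrable lborel A g"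
  by (simp add: locally_integrable_def)

lemma primitive_primitive_on:
  fixes g :: "real \<Rightarrow> real"
  assumes g: "locally_integrable g"
  shows "primitive_on a b (primitive g) g"
proof (rule primitive_onI)
  have i: "set_integrable lborel {c..d} g" for c d :: real
    using g by (intro locally_integrable_set_integrable) auto
  then show "set_integrable lborel {a..b} g" .
  show "primitive g x - primitive g a = (LINT s:{a..x}|lborel. g s)" if "a \<le> x" for x
  proof -
    consider "0 \<le> a" | "x < 0" | "a < 0" "0 \<le> x" by linarith
    then show ?thesis
    proof cases
      case 1
      then show ?thesis using set_integral_Icc_split[OF i[of 0 x], of a x] that by (simp add: primitive_def)
    next
      case 2
      then show ?thesis using set_integral_Icc_split[OF i[of a 0], of x 0] that by (simp add: primitive_def)
    next
      case 3
      then show ?thesis using set_integral_Icc_split[OF i[of a x], of 0 x] that by (simp add: primitive_def)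
    qed
  qed
qed

lemma continuous_locally_integrable:
  fixes V :: "real \<Rightarrow> real"
  assumes "continuous_on UNIV V"
  shows "locally_integrable V"
  unfolding locally_integrable_def
proof (intro conjI allI impI)
  show "V \<in> borel_measurable borel" by (rule borel_measurable_continuous_onI[OF assms])
  fix K :: "real set" assume "compact K"
  then show "set_integrable lborel K V"
    unfolding set_integrable_def by (intro borel_integrable_compact continuous_on_subset[OF assms]) auto
qed

lemma integral_eq_set_integral:
  fixes f :: "real \<Rightarrow> real"
  assumes "\<And>x. x \<notin> {a..b} \<Longrightarrow> f x = 0"
  shows "(LINT x|lborel. f x) = (LINT x:{a..b}|lborel. f x)"
  unfolding set_lebesgue_integral_def using assms
  by (intro Bochner_Integration.integral_cong) (auto simp: indicator_def)

lemma primitive_weak_derivative: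
  assumes V: "\<And>a b. a \<le> b \<Longrightarrow> primitive_on a b V g"
    and \<psi>: "\<And>x. (\<psi> has_real_derivative \<psi>' x) (at x)" "continuous_on UNIV \<psi>'"
    and supp: "\<And>x. R < \<bar>x\<bar> \<Longrightarrow> \<psi> x = 0" "\<And>x. R < \<bar>x\<bar> \<Longrightarrow> \<psi>' x = 0"
  shows "(LINT x|lborel. V x * \<psi>' x) = - (LINT x|lborel. g x * \<psi> x)"
proof -
  let ?R = "\<bar>R\<bar> + 1"
  have \<psi>c: "continuous_on {-?R..?R} \<psi>'" by (rule continuous_on_subset[OF \<psi>(2)]) simp
  have \<psi>p: "primitive_on (-?R) ?R \<psi> \<psi>'" by (rule primitive_on_C1[OF \<psi>(1) \<psi>c])
  have Vp: "primitive_on (-?R) ?R V g" by (rule V) simp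
  have "V ?R * \<psi> ?R - V (-?R) * \<psi> (-?R) = (LINT x:{-?R..?R}|lborel. g x * \<psi> x + \<psi>' x * V x)"
    by (rule primitive_on_mult_at_end[OF _ Vp \<psi>p]) simp
  moreover have "\<psi> ?R = 0" "\<psi> (-?R) = 0" using supp(1)[of ?R] supp(1)[of "-?R"] by auto
  ultimately have "(LINT x:{-?R..?R}|lborel. g x * \<psi> x + \<psi>' x * V x) = 0" by simp
  also have "(LINT x:{-?R..?R}|lborel. g x * \<psi> x + \<psi>' x * V x)
      = (LINT x:{-?R..?R}|lborel. g x * \<psi> x) + (LINT x:{-?R..?R}|lborel. \<psi>' x * V x)"
    by (rule set_integral_add(2)[OF
          set_integrable_mult_continuous[OF primitive_on_integrable[OF Vp] primitive_on_continuous[OF \<psi>p]]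
          set_integrable_mult_continuous[OF primitive_on_integrable[OF \<psi>p] primitive_on_continuous[OF Vp]]])
  also have "(LINT x:{-?R..?R}|lborel. g x * \<psi> x) = (LINT x|lborel. g x * \<psi> x)"
    by (rule integral_eq_set_integral[symmetric]) (use supp(1) in auto)
  also have "(LINT x:{-?R..?R}|lborel. \<psi>' x * V x) = (LINT x|lborel. \<psi>' x * V x)"
    by (rule integral_eq_set_integral[symmetric]) (use supp(2) in auto)
  finally show ?thesis by (simp add: mult.commute)
qed

text \<open>The vanishing integral is what makes the antiderivative vanish again to the right of the support.\<close>

lemma test_function_antiderivative:
  fixes \<zeta> :: "real \<Rightarrow> real"
  assumes \<zeta>: "test_function \<zeta>" and zero: "(LINT x|lborel. \<zeta> x) = 0"
  obtains \<psi> where "test_function \<psi>" "\<And>x. (\<psi> has_real_derivative \<zeta> x) (at x)"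
proof -
  obtain R where R: "0 < R" "\<And>x. \<zeta> x \<noteq> 0 \<Longrightarrow> \<bar>x\<bar> \<le> R" using test_function_support[OF \<zeta>] by (metis real_norm_def)
  have c: "continuous_on S \<zeta>" for S by (rule test_function_continuous[OF \<zeta>])
  have \<zeta>l: "locally_integrable \<zeta>" by (rule continuous_locally_integrable) (rule c)
  define \<psi> where "\<psi> = (\<lambda>x. primitive \<zeta> x - primitive \<zeta> (-R))"
  have p: "primitive_on a b (primitive \<zeta>) \<zeta>" for a b by (rule primitive_primitive_on[OF \<zeta>l])
  have d: "(\<psi> has_real_derivative \<zeta> x) (at x)" for x
    using DERIV_diff[OF primitive_on_has_derivative[OF p c] DERIV_const] by (simp add: \<psi>_def)
  have z: "\<psi> x = 0" if "R < \<bar>x\<bar>" for x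
  proof (cases "0 < x")
    case True
    have "\<psi> x = (LINT s:{-R..x}|lborel. \<zeta> s)"
      unfolding \<psi>_def by (rule primitive_on_diff[OF p[of "-R" x]]) (use True R that in auto)
    also have "\<dots> = (LINT s|lborel. \<zeta> s)"
      by (rule integral_eq_set_integral[symmetric]) (use R(2) True that in force)
    finally show ?thesis using zero by simp
  next
    case False
    have "- \<psi> x = (LINT s:{x..-R}|lborel. \<zeta> s)"
      using primitive_on_diff[OF p[of x "-R"], of x "-R"] False that by (simp add: \<psi>_def)
    also have "\<dots> = (LINT s:{x..-R}|lborel. 0 * \<zeta> s)"
      unfolding set_lebesgue_integral_def
    proof (rule integral_cong_AE)
      show "AE s in lborel. indicator {x..- R} s *\<^sub>R \<zeta> s = indicator {x..- R} s *\<^sub>R (0 * \<zeta> s)"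
        by (rule eventually_mono[OF AE_lborel_singleton[of "-R"]]) (use R in \<open>force simp: indicator_def\<close>)
    qed (use \<zeta>l in \<open>auto simp: locally_integrable_def\<close>)
    finally show ?thesis by simp
  qed
  have "test_function \<psi>"
  proof (rule test_function_boundedI)
    show "C_k k \<psi>" for k
    proof -
      have "C_k k \<zeta>" using \<zeta> by (simp add: test_function_def)
      from C_k_Suc_imp_C_k[OF C_k_Suc_realI[OF d this]] show ?thesis .
    qed
    have "{x. \<psi> x \<noteq> 0} \<subseteq> {-R..R}" using z by force
    then show "bounded {x. \<psi> x \<noteq> 0}" by (rule bounded_subset[OF bounded_closed_interval])
  qed
  then show ?thesis using d by (rule that)
qed

lemma locally_integrable_diff:
  fixes f g :: "'a::euclidean_space \<Rightarrow> real"
  assumes "locally_integrable f" "locally_integrable g"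
  shows "locally_integrable (\<lambda>x. f x - g x)"
  using assms unfolding locally_integrable_def by (auto intro!: set_integral_diff)

lemma locally_integrable_inner:
  fixes W :: "'a::euclidean_space \<Rightarrow> 'b::euclidean_space"
  assumes "locally_integrable W"
  shows "locally_integrable (\<lambda>x. W x \<bullet> b)"
  unfolding locally_integrable_def
proof (intro conjI allI impI)
  show "(\<lambda>x. W x \<bullet> b) \<in> borel_measurable borel" using assms by (auto simp: locally_integrable_def)
  fix K :: "'a set" assume "compact K"
  then have "integrable lborel (\<lambda>x. (indicator K x *\<^sub>R W x) \<bullet> b)"
    using assms by (intro integrable_inner_left) (auto simp: locally_integrable_def set_integrable_def)
  then show "set_integrable lborel K (\<lambda>x. W x \<bullet> b)" by (simp add: set_integrable_def)
qed

text \<open>After subtracting a primitive of \<open>g\<close> from \<open>v\<close>, the rest \<open>w\<close> is orthogonal to derivatives of test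
  functions, that is, to all test functions of integral zero. An arbitrary test function is
  brought to this form by subtracting a multiple of a fixed bump, so \<open>w\<close> is orthogonal to test
  functions up to a constant \<open>c\<close>, and \<open>w = c\<close>.\<close>

lemma du_Bois_Reymond:
  fixes v :: "real \<Rightarrow> real"
  assumes v: "locally_integrable v" and g: "locally_integrable g"
    and weak: "\<And>\<psi> \<psi>'. test_function \<psi> \<Longrightarrow> test_function \<psi>' \<Longrightarrow> (\<And>x. (\<psi> has_real_derivative \<psi>' x) (at x)) \<Longrightarrow>
      (LINT x|lborel. v x * \<psi>' x) = - (LINT x|lborel. g x * \<psi> x)"
  obtains V where "\<And>a b. primitive_on a b V g" "AE x in lborel. v x = V x"
proof -
  have p: "primitive_on a b (primitive g) g" for a b by (rule primitive_primitive_on[OF g])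
  have P: "locally_integrable (primitive g)"
    by (rule continuous_locally_integrable, rule continuous_on_UNIV_if_primitive_on, rule p)
  define w where "w = (\<lambda>x. v x - primitive g x)"
  have w: "locally_integrable w" unfolding w_def by (rule locally_integrable_diff[OF v P])
  have w0: "(LINT x|lborel. w x * \<psi>' x) = 0"
    if t: "test_function \<psi>" "test_function \<psi>'" "\<And>x. (\<psi> has_real_derivative \<psi>' x) (at x)" for \<psi> \<psi>'
  proof -
    obtain R1 where R1: "\<And>x. \<psi> x \<noteq> 0 \<Longrightarrow> norm x \<le> R1" using test_function_support[OF t(1)] by blast
    obtain R2 where R2: "\<And>x. \<psi>' x \<noteq> 0 \<Longrightarrow> norm x \<le> R2" using test_function_support[OF t(2)] by blast
    have "(LINT x|lborel. primitive g x * \<psi>' x) = - (LINT x|lborel. g x * \<psi> x)"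
    proof (rule primitive_weak_derivative[OF p t(3) test_function_continuous[OF t(2)], where R = "max R1 R2"])
      show "\<psi> x = 0" if "max R1 R2 < \<bar>x\<bar>" for x using R1[of x] that by (cases "\<psi> x = 0") auto
      show "\<psi>' x = 0" if "max R1 R2 < \<bar>x\<bar>" for x using R2[of x] that by (cases "\<psi>' x = 0") auto
    qed
    moreover have "(LINT x|lborel. w x * \<psi>' x) = (LINT x|lborel. v x * \<psi>' x) - (LINT x|lborel. primitive g x * \<psi>' x)"
      unfolding w_def left_diff_distrib
      by (intro Bochner_Integration.integral_diff locally_integrable_mult_test_function v P t)
    ultimately show ?thesis using weak[OF t] by simp
  qed
  define \<eta>0 where "\<eta>0 = bump 0 0 1"
  have \<eta>0t: "test_function \<eta>0" unfolding \<eta>0_def by (rule bump_test_function)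
  have test_int: "integrable lborel \<zeta>" if "test_function \<zeta>" for \<zeta> :: "real \<Rightarrow> real"
    using locally_integrable_mult_test_function[OF continuous_locally_integrable[of "\<lambda>_. 1"] that] by simp
  have \<eta>0p: "0 < (LINT x|lborel. \<eta>0 x)"
  proof (rule ccontr)
    assume "\<not> 0 < (LINT x|lborel. \<eta>0 x)"
    moreover have "0 \<le> (LINT x|lborel. \<eta>0 x)"
      by (rule Bochner_Integration.integral_nonneg) (simp add: \<eta>0_def bump_bounds)
    ultimately have "(LINT x|lborel. \<eta>0 x) = 0" by simp
    then have "AE x in lborel. \<eta>0 x = 0"
      using integral_nonneg_eq_0_iff_AE[OF test_int[OF \<eta>0t]] by (simp add: \<eta>0_def bump_bounds)
    then have "AE x in lborel. x \<notin> {0<..<1::real}"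
      by (rule eventually_mono) (use bump_pos[of 0 _ 1 0] in \<open>force simp: \<eta>0_def\<close>)
    then have "emeasure lborel {0<..<1::real} = 0"
      by (subst (asm) AE_iff_measurable[of "{0<..<1::real}"]) auto
    then show False by simp
  qed
  define c where "c = (LINT x|lborel. w x * \<eta>0 x) / (LINT x|lborel. \<eta>0 x)"
  have "AE x in lborel. w x - c = 0"
  proof (rule AE_zero_if_orthogonal_to_bumps)
    show "locally_integrable (\<lambda>x. w x - c)"
      by (intro locally_integrable_diff w continuous_locally_integrable) simp
    fix n and l r :: real
    define \<zeta> where "\<zeta> = (box_bump n l r :: real \<Rightarrow> real)"
    have \<zeta>: "test_function \<zeta>" unfolding \<zeta>_def by (rule box_bump_test_function)
    define \<kappa> where "\<kappa> = (LINT x|lborel. \<zeta> x) / (LINT x|lborel. \<eta>0 x)"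
    \<comment> \<open>a test function with integral zero\<close>
    define \<xi> where "\<xi> = (\<lambda>x. \<zeta> x + (- \<kappa>) * \<eta>0 x)"
    have \<xi>: "test_function \<xi>"
    proof (rule test_function_boundedI)
      show "C_k k \<xi>" for k
      proof -
        have "C_k k (\<lambda>t. (- \<kappa>) * \<eta>0 (1 * t + 0))"
          by (rule C_k_affine) (use \<eta>0t in \<open>simp add: test_function_def\<close>)
        moreover have "C_k k \<zeta>" using \<zeta> by (simp add: test_function_def)
        ultimately show ?thesis unfolding \<xi>_def using C_k_add[of k \<zeta> "\<lambda>t. (- \<kappa>) * \<eta>0 (1 * t + 0)"] by simp
      qed
      obtain R1 where R1: "\<And>x. \<zeta> x \<noteq> 0 \<Longrightarrow> norm x \<le> R1" using test_function_support[OF \<zeta>] by blast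
      obtain R2 where R2: "\<And>x. \<eta>0 x \<noteq> 0 \<Longrightarrow> norm x \<le> R2" using test_function_support[OF \<eta>0t] by blast
      have "{x. \<xi> x \<noteq> 0} \<subseteq> cball 0 (max R1 R2)"
      proof
        fix x assume "x \<in> {x. \<xi> x \<noteq> 0}"
        then have "\<zeta> x \<noteq> 0 \<or> \<eta>0 x \<noteq> 0" by (auto simp: \<xi>_def)
        then show "x \<in> cball 0 (max R1 R2)" using R1[of x] R2[of x] by auto
      qed
      then show "bounded {x. \<xi> x \<noteq> 0}" by (rule bounded_subset[OF bounded_cball])
    qed
    have "(LINT x|lborel. \<xi> x) = (LINT x|lborel. \<zeta> x) + (LINT x|lborel. (- \<kappa>) * \<eta>0 x)"
      unfolding \<xi>_def by (intro Bochner_Integration.integral_add integrable_mult_right test_int \<zeta> \<eta>0t)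
    also have "(LINT x|lborel. (- \<kappa>) * \<eta>0 x) = - \<kappa> * (LINT x|lborel. \<eta>0 x)" by simp
    finally have "(LINT x|lborel. \<xi> x) = 0" using \<eta>0p by (simp add: \<kappa>_def)
    then obtain \<psi> where "test_function \<psi>" "\<And>x. (\<psi> has_real_derivative \<xi> x) (at x)"
      using test_function_antiderivative[OF \<xi>] by blast
    then have "(LINT x|lborel. w x * \<xi> x) = 0" using w0 \<xi> by blast
    moreover have "(LINT x|lborel. w x * \<xi> x) = (LINT x|lborel. w x * \<zeta> x + (- \<kappa>) * (w x * \<eta>0 x))"
      unfolding \<xi>_def by (simp add: algebra_simps)
    moreover have "\<dots> = (LINT x|lborel. w x * \<zeta> x) + (LINT x|lborel. (- \<kappa>) * (w x * \<eta>0 x))"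
      by (intro Bochner_Integration.integral_add integrable_mult_right locally_integrable_mult_test_function w \<zeta> \<eta>0t)
    ultimately have "(LINT x|lborel. w x * \<zeta> x) = \<kappa> * (LINT x|lborel. w x * \<eta>0 x)" by simp
    also have "\<dots> = c * (LINT x|lborel. \<zeta> x)" by (simp add: \<kappa>_def c_def)
    finally have eq: "(LINT x|lborel. w x * \<zeta> x) = c * (LINT x|lborel. \<zeta> x)" .
    have "(LINT x|lborel. (w x - c) * \<zeta> x) = (LINT x|lborel. w x * \<zeta> x - c * \<zeta> x)" by (simp add: left_diff_distrib)
    also have "\<dots> = (LINT x|lborel. w x * \<zeta> x) - (LINT x|lborel. c * \<zeta> x)"
      by (intro Bochner_Integration.integral_diff integrable_mult_right locally_integrable_mult_test_function w \<zeta> test_int)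
    finally show "(LINT x|lborel. (w x - c) * box_bump n l r x) = 0"
      using eq by (simp add: \<zeta>_def)
  qed
  then have ae: "AE x in lborel. v x = primitive g x + c"
    by (rule eventually_mono) (simp add: w_def)
  have "primitive_on a b (\<lambda>x. primitive g x + c) g" for a b
    using p[of a b] unfolding primitive_on_def by simp
  then show ?thesis using ae by (rule that)
qed

section \<open>Product structure of Lebesgue and Gaussian measure\<close>

lemma prod_Basis_vec:
  fixes g :: "real ^ 'n::finite \<Rightarrow> 'b::comm_monoid_mult"
  shows "(\<Prod>b\<in>Basis. g b) = (\<Prod>i\<in>UNIV. g (axis i 1))"
proof -
  have B: "(Basis :: (real ^ 'n) set) = range (\<lambda>i. axis i 1)" by (auto simp: Basis_vec_def)
  have I: "inj (\<lambda>i::'n. axis i (1::real))" by (auto simp: inj_on_def axis_eq_axis)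
  show ?thesis unfolding B by (subst prod.reindex[OF I]) simp
qed

lemma vec_lambda_measurable:
  assumes "\<And>i. (\<lambda>x. g x i) \<in> borel_measurable N"
  shows "(\<lambda>x. \<chi> i. g x i) \<in> N \<rightarrow>\<^sub>M (borel :: (real ^ 'n::finite) measure)"
proof (rule borel_measurable_euclidean_space[THEN iffD2], rule ballI)
  fix b :: "real ^ 'n" assume "b \<in> Basis"
  then obtain i where "b = axis i 1" by (auto simp: Basis_vec_def)
  then show "(\<lambda>x. (\<chi> i. g x i) \<bullet> b) \<in> borel_measurable N" using assms[of i] by (simp add: inner_axis)
qed

lemma vec_nth_measurable [measurable]: "(\<lambda>x. x $ i) \<in> borel_measurable (borel :: (real ^ 'n::finite) measure)"
  by (intro borel_measurable_continuous_onI continuous_intros)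

lemma box_vec_iff: "x \<in> box l r \<longleftrightarrow> (\<forall>i. l $ i < x $ i \<and> x $ i < r $ i)" for x l r :: "real ^ 'n"
  by (simp add: mem_box_cart)

interpretation product_lborel: product_sigma_finite "\<lambda>_::'i. lborel :: real measure"
  by standard

lemma lborel_vec_eq_PiM:
  "(lborel :: (real ^ 'n) measure) = distr (Pi\<^sub>M UNIV (\<lambda>_::'n::finite. lborel)) borel (\<lambda>x. \<chi> i. x i)"
proof (rule lborel_eqI)
  fix l u :: "real ^ 'n" assume lu: "\<And>b. b \<in> Basis \<Longrightarrow> l \<bullet> b \<le> u \<bullet> b"
  have le: "l $ i \<le> u $ i" for i using lu[of "axis i 1"] by (simp add: inner_axis axis_in_Basis_iff)
  have [measurable]: "(\<lambda>x. \<chi> i. x i) \<in> (Pi\<^sub>M UNIV (\<lambda>_::'n. lborel)) \<rightarrow>\<^sub>M (borel :: (real ^ 'n) measure)"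
    by (rule vec_lambda_measurable) measurable
  have "emeasure (distr (Pi\<^sub>M UNIV (\<lambda>_::'n. lborel)) borel (\<lambda>x. \<chi> i. x i)) (box l u)
      = emeasure (Pi\<^sub>M UNIV (\<lambda>_::'n. lborel)) (Pi\<^sub>E UNIV (\<lambda>i. {l $ i<..<u $ i}))"
    by (subst emeasure_distr) (auto intro!: arg_cong2[where f = emeasure] simp: box_vec_iff space_PiM PiE_iff)
  also have "\<dots> = (\<Prod>i\<in>UNIV. emeasure lborel {l $ i<..<u $ i})"
    by (rule product_lborel.emeasure_PiM) auto
  also have "\<dots> = (\<Prod>i\<in>UNIV. ennreal (u $ i - l $ i))" using le by simp
  also have "\<dots> = ennreal (\<Prod>i\<in>UNIV. u $ i - l $ i)" using le by (intro prod_ennreal) simp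
  also have "(\<Prod>i\<in>UNIV. u $ i - l $ i) = (\<Prod>b\<in>Basis. (u - l) \<bullet> b)"
    by (simp add: prod_Basis_vec inner_axis)
  finally show "emeasure (distr (Pi\<^sub>M UNIV (\<lambda>_::'n. lborel)) borel (\<lambda>x. \<chi> i. x i)) (box l u)
      = ennreal (\<Prod>b\<in>Basis. (u - l) \<bullet> b)" .
qed simp

text \<open>Separates the coordinate \<open>i\<close> from the others, for Fubini's theorem in either order.\<close>

definition insert_coord :: "'n::finite \<Rightarrow> real \<times> ('n \<Rightarrow> real) \<Rightarrow> real ^ 'n" where
  "insert_coord i = (\<lambda>(t, y). \<chi> j. if j = i then t else y j)"

lemma insert_coord_nth [simp]: "insert_coord i z $ j = (if j = i then fst z else snd z j)"
  by (simp add: insert_coord_def case_prod_beta)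

abbreviation other_coords :: "'n::finite \<Rightarrow> ('n \<Rightarrow> real) measure" where
  "other_coords i \<equiv> Pi\<^sub>M (UNIV - {i}) (\<lambda>_. lborel)"

lemma insert_coord_measurable [measurable]:
  "insert_coord i \<in> (lborel \<Otimes>\<^sub>M other_coords i) \<rightarrow>\<^sub>M borel"
proof -
  have "(\<lambda>z. if j = i then fst z else snd z j) \<in> borel_measurable (lborel \<Otimes>\<^sub>M other_coords i)" for j
    by (cases "j = i") (simp_all, measurable)
  then show ?thesis unfolding insert_coord_def case_prod_beta by (rule vec_lambda_measurable)
qed

lemma lborel_vec_eq_pair:
  "(lborel :: (real ^ 'n) measure) = distr (lborel \<Otimes>\<^sub>M other_coords i) borel (insert_coord i)" for i :: "'n::finite"
proof (rule lborel_eqI)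
  interpret O: sigma_finite_measure "other_coords i" by (rule product_lborel.sigma_finite) simp
  fix l u :: "real ^ 'n" assume lu: "\<And>b. b \<in> Basis \<Longrightarrow> l \<bullet> b \<le> u \<bullet> b"
  have le: "l $ i \<le> u $ i" for i using lu[of "axis i 1"] by (simp add: inner_axis axis_in_Basis_iff)
  have "emeasure (distr (lborel \<Otimes>\<^sub>M other_coords i) borel (insert_coord i)) (box l u)
      = emeasure (lborel \<Otimes>\<^sub>M other_coords i) ({l $ i<..<u $ i} \<times> Pi\<^sub>E (UNIV - {i}) (\<lambda>j. {l $ j<..<u $ j}))"
  proof (subst emeasure_distr)
    have "z \<in> insert_coord i -` box l u \<inter> space (lborel \<Otimes>\<^sub>M other_coords i) \<longleftrightarrow>
        z \<in> {l $ i<..<u $ i} \<times> Pi\<^sub>E (UNIV - {i}) (\<lambda>j. {l $ j<..<u $ j})" for z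
    proof (cases z)
      case (Pair t y)
      have key: "(\<forall>j. l $ j < (if j = i then t else y j) \<and> (if j = i then t else y j) < u $ j) \<longleftrightarrow>
          (l $ i < t \<and> t < u $ i) \<and> (\<forall>j\<in>UNIV - {i}. l $ j < y j \<and> y j < u $ j)"
        (is "(\<forall>j. ?A j) \<longleftrightarrow> ?B \<and> ?C")
      proof
        assume A: "\<forall>j. ?A j"
        show "?B \<and> ?C"
        proof (intro conjI ballI)
          show "l $ i < t" "t < u $ i" using A[THEN spec, of i] by simp_all
          show "l $ j < y j" "y j < u $ j" if "j \<in> UNIV - {i}" for j
            using A[THEN spec, of j] that by simp_all
        qed
      next
        assume BC: "?B \<and> ?C"
        show "\<forall>j. ?A j"
        proof
          fix j show "?A j" using BC by (cases "j = i") simp_all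
        qed
      qed
      have "z \<in> insert_coord i -` box l u \<inter> space (lborel \<Otimes>\<^sub>M other_coords i) \<longleftrightarrow>
          (\<forall>j. l $ j < (if j = i then t else y j) \<and> (if j = i then t else y j) < u $ j) \<and> y \<in> extensional (UNIV - {i})"
        unfolding Pair
        by (simp add: box_vec_iff space_pair_measure space_PiM PiE_iff cong: if_cong split del: if_split)
      also have "\<dots> \<longleftrightarrow> z \<in> {l $ i<..<u $ i} \<times> Pi\<^sub>E (UNIV - {i}) (\<lambda>j. {l $ j<..<u $ j})"
        unfolding key Pair by (auto simp: PiE_iff)
      finally show ?thesis .
    qed
    then show "emeasure (lborel \<Otimes>\<^sub>M other_coords i) (insert_coord i -` box l u \<inter> space (lborel \<Otimes>\<^sub>M other_coords i))
        = emeasure (lborel \<Otimes>\<^sub>M other_coords i) ({l $ i<..<u $ i} \<times> Pi\<^sub>E (UNIV - {i}) (\<lambda>j. {l $ j<..<u $ j}))"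
      by (intro arg_cong2[where f = emeasure] refl set_eqI)
  qed simp_all
  also have "\<dots> = emeasure lborel {l $ i<..<u $ i} * (\<Prod>j\<in>UNIV - {i}. emeasure lborel {l $ j<..<u $ j})"
    by (subst O.emeasure_pair_measure_Times) (auto simp: product_lborel.emeasure_PiM intro!: sets_PiM_I_finite)
  also have "\<dots> = (\<Prod>j\<in>UNIV. emeasure lborel {l $ j<..<u $ j})" by (simp add: prod.remove[of UNIV i])
  also have "\<dots> = (\<Prod>i\<in>UNIV. ennreal (u $ i - l $ i))" using le by simp
  also have "\<dots> = ennreal (\<Prod>i\<in>UNIV. u $ i - l $ i)" using le by (intro prod_ennreal) simp
  also have "(\<Prod>i\<in>UNIV. u $ i - l $ i) = (\<Prod>b\<in>Basis. (u - l) \<bullet> b)"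
    by (simp add: prod_Basis_vec inner_axis)
  finally show "emeasure (distr (lborel \<Otimes>\<^sub>M other_coords i) borel (insert_coord i)) (box l u)
      = ennreal (\<Prod>b\<in>Basis. (u - l) \<bullet> b)" .
qed simp

definition coord_prod :: "('n::finite \<Rightarrow> real \<Rightarrow> real) \<Rightarrow> real ^ 'n \<Rightarrow> real" where
  "coord_prod h x = (\<Prod>i\<in>UNIV. h i (x $ i))"

lemma coord_prod_measurable [measurable (raw)]:
  assumes "\<And>i. h i \<in> borel_measurable borel"
  shows "coord_prod h \<in> borel_measurable borel"
proof -
  have "(\<lambda>x. h i (x $ i)) \<in> borel_measurable borel" for i
    using measurable_compose[OF vec_nth_measurable assms] by blast
  then show ?thesis unfolding coord_prod_def[abs_def] by (rule borel_measurable_prod)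
qed

lemma vec_lambda_PiM_measurable [measurable]:
  "(\<lambda>x. \<chi> i. x i) \<in> (Pi\<^sub>M UNIV (\<lambda>_::'n::finite. lborel)) \<rightarrow>\<^sub>M (borel :: (real ^ 'n) measure)"
  by (rule vec_lambda_measurable) measurable

lemma coord_prod_integrable:
  fixes h :: "'n::finite \<Rightarrow> real \<Rightarrow> real"
  assumes "\<And>i. integrable lborel (h i)"
  shows "integrable lborel (coord_prod h)"
proof -
  have [measurable]: "h i \<in> borel_measurable borel" for i using borel_measurable_integrable[OF assms] by simp
  show ?thesis
    unfolding lborel_vec_eq_PiM
    by (subst integrable_distr_eq) (auto simp: coord_prod_def intro!: product_lborel.product_integrable_prod assms, measurable)
qed

lemma coord_prod_integral:
  fixes h :: "'n::finite \<Rightarrow> real \<Rightarrow> real"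
  assumes "\<And>i. integrable lborel (h i)"
  shows "(LINT x|lborel. coord_prod h x) = (\<Prod>i\<in>UNIV. LINT t|lborel. h i t)"
proof -
  have [measurable]: "h i \<in> borel_measurable borel" for i using borel_measurable_integrable[OF assms] by simp
  have "(LINT x|lborel. coord_prod h x) = (LINT x|(Pi\<^sub>M UNIV (\<lambda>_. lborel)). (\<Prod>i\<in>UNIV. h i (x i)))"
    by (subst lborel_vec_eq_PiM, subst integral_distr) (simp_all add: coord_prod_def)
  also have "\<dots> = (\<Prod>i\<in>UNIV. LINT t|lborel. h i t)"
    by (rule product_lborel.product_integral_prod) (use assms in auto)
  finally show ?thesis .
qed

lemma coord_prod_nn_integral:
  fixes h :: "'n::finite \<Rightarrow> real \<Rightarrow> real"
  assumes [measurable]: "\<And>i. h i \<in> borel_measurable borel" and nonneg: "\<And>i t. 0 \<le> h i t"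
  shows "(\<integral>\<^sup>+x. ennreal (coord_prod h x) \<partial>lborel) = (\<Prod>i\<in>UNIV. \<integral>\<^sup>+t. ennreal (h i t) \<partial>lborel)"
proof -
  have "(\<integral>\<^sup>+x. ennreal (coord_prod h x) \<partial>lborel)
      = (\<integral>\<^sup>+x. (\<Prod>i\<in>UNIV. ennreal (h i (x i))) \<partial>Pi\<^sub>M UNIV (\<lambda>_. lborel))"
    by (subst lborel_vec_eq_PiM, subst nn_integral_distr) (simp_all add: coord_prod_def prod_ennreal nonneg)
  also have "\<dots> = (\<Prod>i\<in>UNIV. \<integral>\<^sup>+t. ennreal (h i t) \<partial>lborel)"
    by (rule product_lborel.product_nn_integral_prod) auto
  finally show ?thesis .
qed

lemma AE_coord:
  fixes i :: "'n::finite"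
  assumes "AE t in lborel. Q t"
  shows "AE x in (lborel :: (real ^ 'n) measure). Q (x $ i)"
proof -
  interpret O: sigma_finite_measure "other_coords i" by (rule product_lborel.sigma_finite) simp
  interpret pair_sigma_finite lborel "other_coords i" ..
  obtain N where N: "{t \<in> space lborel. \<not> Q t} \<subseteq> N" "emeasure lborel N = 0" "N \<in> sets (lborel :: real measure)"
    using AE_E[OF assms] by auto
  have [measurable]: "N \<in> sets borel" using N(3) by simp
  have "emeasure lborel ((\<lambda>x::real ^ 'n. x $ i) -` N) = emeasure (lborel \<Otimes>\<^sub>M other_coords i) (N \<times> space (other_coords i))"
  proof (subst lborel_vec_eq_pair[of i], subst emeasure_distr)
    show "(\<lambda>x::real ^ 'n. x $ i) -` N \<in> sets borel"
      using measurable_sets[OF vec_nth_measurable[of i], of N] by simp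
    have "insert_coord i -` ((\<lambda>x. x $ i) -` N) \<inter> space (lborel \<Otimes>\<^sub>M other_coords i) = N \<times> space (other_coords i)"
      by (auto simp: space_pair_measure)
    then show "emeasure (lborel \<Otimes>\<^sub>M other_coords i) (insert_coord i -` ((\<lambda>x. x $ i) -` N) \<inter> space (lborel \<Otimes>\<^sub>M other_coords i))
       = emeasure (lborel \<Otimes>\<^sub>M other_coords i) (N \<times> space (other_coords i))" by simp
  qed simp
  also have "\<dots> = 0" using N by (subst O.emeasure_pair_measure_Times) auto
  finally have "emeasure lborel ((\<lambda>x::real ^ 'n. x $ i) -` N) = 0" .
  moreover have "(\<lambda>x::real ^ 'n. x $ i) -` N \<in> sets lborel"
    using measurable_sets[OF vec_nth_measurable[of i], of N] by simp
  ultimately show ?thesis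
    by (intro AE_I[of _ _ "(\<lambda>x. x $ i) -` N"]) (use N(1) in auto)
qed

lemma coord_prod_update:
  "coord_prod (h(i := g)) x = g (x $ i) * (\<Prod>j\<in>UNIV - {i}. h j (x $ j))"
proof -
  have "coord_prod (h(i := g)) x = g (x $ i) * (\<Prod>j\<in>UNIV - {i}. (h(i := g)) j (x $ j))"
    unfolding coord_prod_def using prod.remove[of UNIV i "\<lambda>j. (h(i := g)) j (x $ j)"] by simp
  also have "(\<Prod>j\<in>UNIV - {i}. (h(i := g)) j (x $ j)) = (\<Prod>j\<in>UNIV - {i}. h j (x $ j))"
    by (intro prod.cong) auto
  finally show ?thesis .
qed

lemma coord_prod_mult: "coord_prod h x * coord_prod g x = coord_prod (\<lambda>i t. h i t * g i t) x"
  by (simp add: coord_prod_def prod.distrib)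

lemma coord_prod_locally_integrable:
  fixes h :: "'n::finite \<Rightarrow> real \<Rightarrow> real"
  assumes h: "\<And>i. locally_integrable (h i)"
  shows "locally_integrable (coord_prod h)"
  unfolding locally_integrable_def
proof (intro conjI allI impI)
  have [measurable]: "h i \<in> borel_measurable borel" for i using h by (simp add: locally_integrable_def)
  show m: "coord_prod h \<in> borel_measurable borel" by measurable
  fix K :: "(real ^ 'n) set" assume K: "compact K"
  then obtain R where R: "\<And>x. x \<in> K \<Longrightarrow> norm x \<le> R" using compact_imp_bounded[OF K] by (auto simp: bounded_iff)
  define h' where "h' = (\<lambda>i t. indicator {-R..R} t * h i t)"
  have "integrable lborel (coord_prod h')"
    using locally_integrable_set_integrable[OF h, of "{-R..R}"]
    by (intro coord_prod_integrable) (simp add: h'_def set_integrable_def)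
  then have "integrable lborel (\<lambda>x. indicator K x *\<^sub>R coord_prod h' x)"
    by (intro integrable_mult_indicator) (use K in \<open>auto simp: compact_imp_closed\<close>)
  moreover have eq: "indicator K x *\<^sub>R coord_prod h' x = indicator K x *\<^sub>R coord_prod h x" for x
  proof (cases "x \<in> K")
    case True
    have "x $ i \<in> {-R..R}" for i using component_le_norm_cart[of x i] R[OF True] by auto
    then show ?thesis by (simp add: coord_prod_def h'_def)
  qed simp
  ultimately show "set_integrable lborel K (coord_prod h)" unfolding set_integrable_def by (simp only:)
qed

definition axis_index :: "real ^ 'n \<Rightarrow> 'n" where
  "axis_index b = (THE i. b = axis i 1)"

lemma axis_index_axis [simp]: "axis_index (axis i 1) = i"
  unfolding axis_index_def by (auto simp: axis_eq_axis)

lemma coord_prod_eq_tensor: "coord_prod \<psi> = tensor (\<lambda>b. \<psi> (axis_index b))"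
  by (auto simp: coord_prod_def tensor_def prod_Basis_vec inner_axis fun_eq_iff)

lemma coord_prod_test_function: "(\<And>i. test_function (\<psi> i)) \<Longrightarrow> test_function (coord_prod \<psi>)"
  unfolding coord_prod_eq_tensor by (rule tensor_test_function)

lemma coord_prod_frechet_derivative:
  assumes "\<And>i t. (\<psi> i has_real_derivative \<psi>' i t) (at t)"
  shows "frechet_derivative (coord_prod \<psi>) (at x) (axis i 1) = coord_prod (\<psi>(i := \<psi>' i)) x"
proof -
  have "frechet_derivative (coord_prod \<psi>) (at x) (axis i 1)
      = tensor ((\<lambda>b. \<psi> (axis_index b))(axis i 1 := \<psi>' i)) x"
    unfolding coord_prod_eq_tensor
    using tensor_frechet_derivative[of "\<lambda>b. \<psi> (axis_index b)" "\<lambda>b. \<psi>' (axis_index b)" "axis i 1" x] assms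
    by (simp add: axis_in_Basis_iff)
  also have "\<dots> = coord_prod (\<psi>(i := \<psi>' i)) x"
    unfolding tensor_def coord_prod_def prod_Basis_vec
    by (intro prod.cong) (auto simp: axis_eq_axis inner_axis)
  finally show ?thesis .
qed

lemma box_bump_vec: "box_bump n l r = coord_prod (\<lambda>i. bump n (l $ i) (r $ i))"
  unfolding box_bump_def tensor_def coord_prod_def prod_Basis_vec by (simp add: inner_axis)

abbreviation \<gamma> :: "real ^ 'n \<Rightarrow> real" where "\<gamma> \<equiv> coord_prod (\<lambda>_. \<phi>)"

lemma powr_minus_half: "(2 * pi) powr (- (1 / 2)) = 1 / sqrt (2 * pi)"
  by (subst powr_minus_divide, subst powr_half_sqrt) simp_all

lemma gaussian_real_eq: "(gaussian :: real measure) = density lborel (\<lambda>x. ennreal (\<phi> x))"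
proof -
  have "- real DIM(real) / 2 = - (1 / 2)" by simp
  then show ?thesis
    unfolding gaussian_def std_normal_density_def by (simp only: powr_minus_half real_norm_def power2_abs)
qed

lemma gaussian_vec_eq: "(gaussian :: (real ^ 'n::finite) measure) = density lborel (\<lambda>x. ennreal (\<gamma> x))"
proof -
  have "(2 * pi) powr (- real DIM(real ^ 'n) / 2) * exp (- (norm x)\<^sup>2 / 2) = \<gamma> x" for x :: "real ^ 'n"
  proof -
    have "(norm x)\<^sup>2 = (\<Sum>i\<in>UNIV. (x $ i)\<^sup>2)"
      by (simp add: norm_vec_def L2_set_def sum_nonneg)
    then have "exp (- (norm x)\<^sup>2 / 2) = (\<Prod>i\<in>UNIV. exp (- (x $ i)\<^sup>2 / 2))"
      by (simp add: exp_sum[symmetric] sum_divide_distrib sum_negf)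
    moreover have "(2 * pi) powr (- real DIM(real ^ 'n) / 2) = (\<Prod>i\<in>(UNIV::'n set). 1 / sqrt (2 * pi))"
    proof -
      have "- real DIM(real ^ 'n) / 2 = - (1 / 2) * real CARD('n)" by simp
      then have "(2 * pi) powr (- real DIM(real ^ 'n) / 2) = ((2 * pi) powr (- (1 / 2))) powr (real CARD('n))"
        by (simp only: powr_powr)
      also have "\<dots> = (1 / sqrt (2 * pi)) ^ CARD('n)"
        unfolding powr_minus_half by (rule powr_realpow) simp
      finally show ?thesis by simp
    qed
    ultimately show ?thesis by (simp only: coord_prod_def std_normal_density_def prod.distrib)
  qed
  then show ?thesis unfolding gaussian_def by simp
qed

lemma \<gamma>_pos: "0 < \<gamma> x"
  unfolding coord_prod_def by (intro prod_pos) (simp add: \<phi>_pos)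

lemma \<phi>_measurable [measurable]: "\<phi> \<in> borel_measurable borel"
  by (rule borel_measurable_continuous_onI) (rule \<phi>_continuous)

lemma AE_gaussian_real: "(AE x in gaussian. Q x) \<longleftrightarrow> (AE x in (lborel :: real measure). Q x)"
  unfolding gaussian_real_eq by (subst AE_density) (auto simp: \<phi>_pos)

lemma AE_gaussian_vec: "(AE x in gaussian. Q x) \<longleftrightarrow> (AE x in (lborel :: (real ^ 'n::finite) measure). Q x)"
  unfolding gaussian_vec_eq by (subst AE_density) (auto simp: \<gamma>_pos)

lemma integral_gaussian_real:
  fixes g :: "real \<Rightarrow> real"
  assumes "g \<in> borel_measurable borel"
  shows "(LINT x|gaussian. g x) = (LINT x|lborel. g x * \<phi> x)"
    and "integrable gaussian g \<longleftrightarrow> integrable lborel (\<lambda>x. g x * \<phi> x)"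
  unfolding gaussian_real_eq using assms
  by (simp_all add: integral_density integrable_density mult.commute)

lemma integral_gaussian_vec:
  fixes g :: "real ^ 'n::finite \<Rightarrow> real"
  assumes "g \<in> borel_measurable borel"
  shows "(LINT x|gaussian. g x) = (LINT x|lborel. g x * \<gamma> x)"
    and "integrable gaussian g \<longleftrightarrow> integrable lborel (\<lambda>x. g x * \<gamma> x)"
proof -
  have "AE x in lborel. 0 \<le> \<gamma> x" by (intro AE_I2 less_imp_le \<gamma>_pos)
  moreover have "\<gamma> \<in> borel_measurable lborel" using coord_prod_measurable[OF \<phi>_measurable] by simp
  moreover have "g \<in> borel_measurable lborel" using assms by simp
  ultimately show "(LINT x|gaussian. g x) = (LINT x|lborel. g x * \<gamma> x)"
    "integrable gaussian g \<longleftrightarrow> integrable lborel (\<lambda>x. g x * \<gamma> x)"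
    unfolding gaussian_vec_eq
    using integral_density[of g lborel \<gamma>] integrable_density[of g lborel \<gamma>] by (simp_all add: mult.commute)
qed

section \<open>Weak derivatives of the factors\<close>

text \<open>Fubini for a function of all coordinates against a test function of one. As the test function has
  bounded support, integrability on slabs is the natural hypothesis.\<close>

lemma marginal:
  fixes H :: "real ^ 'n::finite \<Rightarrow> real" and i :: 'n
  assumes [measurable]: "H \<in> borel_measurable borel"
    and int: "\<And>R. integrable lborel (\<lambda>x. indicator {-R..R} (x $ i) * H x)"
  defines "g \<equiv> \<lambda>t. LINT y|other_coords i. H (insert_coord i (t, y))"
  shows "locally_integrable g"
    and "\<And>\<eta>. test_function \<eta> \<Longrightarrow> (LINT t|lborel. g t * \<eta> t) = (LINT x|lborel. H x * \<eta> (x $ i))"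
proof -
  interpret O: sigma_finite_measure "other_coords i" by (rule product_lborel.sigma_finite) simp
  interpret pair_sigma_finite lborel "other_coords i" ..
  have slice: "integrable lborel (\<lambda>t. g t * \<eta> t)"
      "(LINT t|lborel. g t * \<eta> t) = (LINT x|lborel. H x * \<eta> (x $ i))"
    if [measurable]: "\<eta> \<in> borel_measurable borel" and \<eta>: "\<And>t. \<bar>\<eta> t\<bar> \<le> B" "\<And>t. t \<notin> {-R..R} \<Longrightarrow> \<eta> t = 0" for \<eta> B R
  proof -
    have B: "0 \<le> B" using \<eta>(1)[of 0] by linarith
    have "integrable lborel (\<lambda>x. B * (indicator {-R..R} (x $ i) * H x))" using int by simp
    then have i: "integrable lborel (\<lambda>x. H x * \<eta> (x $ i))"
    proof (rule Bochner_Integration.integrable_bound)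
      show "AE x in lborel. norm (H x * \<eta> (x $ i)) \<le> norm (B * (indicator {-R..R} (x $ i) * H x))"
      proof (rule AE_I2)
        fix x :: "real ^ 'n"
        show "norm (H x * \<eta> (x $ i)) \<le> norm (B * (indicator {-R..R} (x $ i) * H x))"
          using \<eta>(2)[of "x $ i"] mult_right_mono[OF \<eta>(1)[of "x $ i"], of "\<bar>H x\<bar>"] B
          by (cases "x $ i \<in> {-R..R}") (simp_all add: abs_mult mult.commute)
      qed
    qed measurable
    then have iN: "integrable (lborel \<Otimes>\<^sub>M other_coords i) (\<lambda>z. H (insert_coord i z) * \<eta> (fst z))"
      unfolding lborel_vec_eq_pair[of i] by (subst (asm) integrable_distr_eq) simp_all
    from integrable_fst'[OF iN] show "integrable lborel (\<lambda>t. g t * \<eta> t)" unfolding g_def by simp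
    have "(LINT t|lborel. g t * \<eta> t) = (LINT z|(lborel \<Otimes>\<^sub>M other_coords i). H (insert_coord i z) * \<eta> (fst z))"
      using integral_fst'[OF iN] unfolding g_def by simp
    also have "\<dots> = (LINT x|lborel. H x * \<eta> (x $ i))"
      by (subst lborel_vec_eq_pair[of i], subst integral_distr) simp_all
    finally show "(LINT t|lborel. g t * \<eta> t) = (LINT x|lborel. H x * \<eta> (x $ i))" .
  qed
  have gm: "g \<in> borel_measurable borel"
  proof -
    have "g \<in> borel_measurable lborel" unfolding g_def by measurable
    then show ?thesis by simp
  qed
  show "locally_integrable g"
    unfolding locally_integrable_def
  proof (intro conjI gm allI impI)
    fix K :: "real set" assume K: "compact K"
    then obtain R where "\<And>t. t \<in> K \<Longrightarrow> \<bar>t\<bar> \<le> R"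
      using compact_imp_bounded[OF K] by (auto simp: bounded_iff)
    then have R: "K \<subseteq> {-R..R}" by force
    have "integrable lborel (\<lambda>t. g t * indicator {-R..R} t)"
      by (rule slice(1)[where B = 1 and R = R]) (auto simp: indicator_def)
    then have "set_integrable lborel {-R..R} g" by (simp add: set_integrable_def mult.commute)
    then show "set_integrable lborel K g"
      by (rule set_integrable_subset) (use K R in \<open>auto simp: compact_imp_closed\<close>)
  qed
  fix \<eta> :: "real \<Rightarrow> real" assume \<eta>: "test_function \<eta>"
  obtain R where "\<And>x. \<eta> x \<noteq> 0 \<Longrightarrow> norm x \<le> R" using test_function_support[OF \<eta>] by blast
  then have R: "\<eta> t = 0" if "t \<notin> {-R..R}" for t using that by fastforce
  obtain B where B: "\<And>x. \<bar>\<eta> x\<bar> \<le> B" using test_function_bounded[OF \<eta>] by blast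
  show "(LINT t|lborel. g t * \<eta> t) = (LINT x|lborel. H x * \<eta> (x $ i))"
    by (rule slice(2)[OF borel_measurable_continuous_onI[OF test_function_continuous[OF \<eta>]] B R])
qed

lemma sqrt_prod: "sqrt (\<Prod>i\<in>A. g i) = (\<Prod>i\<in>A. sqrt (g i))"
  by (induction A rule: infinite_finite_induct) (simp_all add: real_sqrt_mult)

lemma box_bump_real: "box_bump n l r = bump n l r" for l r :: real
  by (simp add: box_bump_def tensor_def fun_eq_iff)

lemma \<phi>_antimono: "\<bar>x\<bar> \<le> R \<Longrightarrow> \<phi> R \<le> \<phi> x"
  unfolding std_normal_density_def using abs_le_square_iff[of x R] by (intro mult_left_mono) auto

text \<open>The hypotheses on a product density, with a weak gradient \<open>G\<close> of its square root.\<close>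

locale product_sobolev =
  fixes fi :: "'n::finite \<Rightarrow> real \<Rightarrow> real" and G :: "real ^ 'n \<Rightarrow> real ^ 'n" and M :: real
  assumes density_fi: "gaussian_prob_density (fi i)"
    and moment_fi_integrable: "integrable gaussian (\<lambda>x. \<bar>x\<bar>\<^sup>2 * fi i x)"
    and moment_fi_le: "(LINT x|gaussian. \<bar>x\<bar>\<^sup>2 * fi i x) \<le> M"
    and centered_product: "centered (density gaussian (\<lambda>x. ennreal (coord_prod fi x)))"
    and weak_gradient_sqrt: "has_weak_gradient (\<lambda>x. sqrt (coord_prod fi x)) G"
    and gradient_square_integrable: "integrable gaussian (\<lambda>x. (norm (G x))\<^sup>2)"
begin

lemma fi_measurable [measurable]: "fi i \<in> borel_measurable borel"
  using density_fi by (simp add: gaussian_prob_density_def)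

lemma fi_nonneg_AE: "AE t in lborel. 0 \<le> fi i t"
  using density_fi by (simp add: gaussian_prob_density_def AE_gaussian_real)

lemma fi_mass: "integrable lborel (\<lambda>t. fi i t * \<phi> t)" "(LINT t|lborel. fi i t * \<phi> t) = 1"
proof -
  interpret p: prob_space "density gaussian (\<lambda>t. ennreal (fi i t))"
    using density_fi by (simp add: gaussian_prob_density_def)
  have "1 = emeasure (density gaussian (\<lambda>t. ennreal (fi i t))) UNIV"
    using p.emeasure_space_1 by (simp add: gaussian_real_eq)
  also have "\<dots> = (\<integral>\<^sup>+t. ennreal (fi i t) \<partial>gaussian)"
    by (subst emeasure_density) (simp_all add: gaussian_real_eq)
  also have "\<dots> = (\<integral>\<^sup>+t. ennreal (\<phi> t) * ennreal (fi i t) \<partial>lborel)"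
    unfolding gaussian_real_eq by (subst nn_integral_density) simp_all
  also have "\<dots> = (\<integral>\<^sup>+t. ennreal (fi i t * \<phi> t) \<partial>lborel)"
    by (intro nn_integral_cong_AE, use fi_nonneg_AE[of i] in eventually_elim) (simp add: ennreal_mult'' mult.commute)
  finally have eq: "(\<integral>\<^sup>+t. ennreal (fi i t * \<phi> t) \<partial>lborel) = ennreal 1" by simp
  have "AE t in lborel. 0 \<le> fi i t * \<phi> t" using fi_nonneg_AE[of i] by eventually_elim simp
  then have "integrable lborel (\<lambda>t. fi i t * \<phi> t) \<and> (LINT t|lborel. fi i t * \<phi> t) = 1"
    using nn_integral_eq_integrable[of "\<lambda>t. fi i t * \<phi> t" lborel 1] eq by simp
  then show "integrable lborel (\<lambda>t. fi i t * \<phi> t)" "(LINT t|lborel. fi i t * \<phi> t) = 1" by auto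
qed

lemma fi_locally_integrable: "locally_integrable (fi i)"
  unfolding locally_integrable_def
proof (intro conjI allI impI)
  show "fi i \<in> borel_measurable borel" by measurable
  fix K :: "real set" assume K: "compact K"
  then obtain R where R: "\<And>x. x \<in> K \<Longrightarrow> \<bar>x\<bar> \<le> R" using compact_imp_bounded[OF K] by (auto simp: bounded_iff)
  have [measurable]: "K \<in> sets borel" using K by (auto simp: compact_imp_closed)
  show "set_integrable lborel K (fi i)"
    unfolding set_integrable_def
  proof (rule Bochner_Integration.integrable_bound)
    show "integrable lborel (\<lambda>t. 1 / \<phi> R * (fi i t * \<phi> t))" using fi_mass(1) by (rule integrable_mult_right)
    show "AE x in lborel. norm (indicator K x *\<^sub>R fi i x) \<le> norm (1 / \<phi> R * (fi i x * \<phi> x))"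
    proof (rule AE_I2)
      fix x
      show "norm (indicator K x *\<^sub>R fi i x) \<le> norm (1 / \<phi> R * (fi i x * \<phi> x))"
      proof (cases "x \<in> K")
        case True
        have "1 \<le> \<phi> x / \<phi> R" using \<phi>_antimono[OF R[OF True]] \<phi>_pos[of R] by simp
        then have "\<bar>fi i x\<bar> * 1 \<le> \<bar>fi i x\<bar> * (\<phi> x / \<phi> R)" by (intro mult_left_mono) auto
        then show ?thesis using True \<phi>_pos[of R] \<phi>_pos[of x] by (simp add: abs_mult)
      qed simp
    qed
  qed measurable
qed

definition v :: "'n \<Rightarrow> real \<Rightarrow> real" where "v i t = sqrt (fi i t)"

lemma v_measurable [measurable]: "v i \<in> borel_measurable borel"
  unfolding v_def by measurable

lemma v_sq: "(v i t)\<^sup>2 = \<bar>fi i t\<bar>"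
  by (simp add: v_def power2_eq_square real_sqrt_abs2 flip: real_sqrt_mult)

lemma v_locally_integrable: "locally_integrable (v i)"
  unfolding locally_integrable_def
proof (intro conjI allI impI)
  show "v i \<in> borel_measurable borel" by measurable
  fix K :: "real set" assume K: "compact K"
  have [measurable]: "K \<in> sets borel" using K by (auto simp: compact_imp_closed)
  have f: "set_integrable lborel K (fi i)" by (rule locally_integrable_set_integrable[OF fi_locally_integrable K])
  have one: "set_integrable lborel K (\<lambda>_. 1 :: real)"
    by (rule locally_integrable_set_integrable[OF continuous_locally_integrable K]) simp
  show "set_integrable lborel K (v i)"
    unfolding set_integrable_def
  proof (rule Bochner_Integration.integrable_bound)
    show "integrable lborel (\<lambda>t. indicator K t *\<^sub>R 1 + \<bar>indicator K t *\<^sub>R fi i t\<bar>)"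
      by (rule Bochner_Integration.integrable_add[OF one[unfolded set_integrable_def] integrable_abs[OF f[unfolded set_integrable_def]]])
    show "AE t in lborel. norm (indicator K t *\<^sub>R v i t) \<le> norm (indicator K t *\<^sub>R 1 + \<bar>indicator K t *\<^sub>R fi i t\<bar>)"
    proof (rule AE_I2)
      fix t
      have "\<bar>v i t\<bar> \<le> 1 + \<bar>fi i t\<bar>" using abs_le_1_plus_square[of "v i t"] by (simp add: v_sq)
      then show "norm (indicator K t *\<^sub>R v i t) \<le> norm (indicator K t *\<^sub>R 1 + \<bar>indicator K t *\<^sub>R fi i t\<bar>)"
        by (cases "t \<in> K") auto
    qed
  qed measurable
qed

lemma sqrt_product: "sqrt (coord_prod fi x) = coord_prod v x"
  by (simp add: coord_prod_def v_def sqrt_prod)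

text \<open>Otherwise \<open>\<surd>f\<^sub>i\<close> would vanish almost everywhere, contrary to its total mass.\<close>

lemma ex_bump: "\<exists>\<psi>. test_function \<psi> \<and> (LINT t|lborel. v i t * \<psi> t) \<noteq> 0"
proof (rule ccontr)
  assume no: "\<nexists>\<psi>. test_function \<psi> \<and> (LINT t|lborel. v i t * \<psi> t) \<noteq> 0"
  have "AE t in lborel. v i t = 0"
    by (rule AE_zero_if_orthogonal_to_bumps[OF v_locally_integrable]) (use no box_bump_test_function in blast)
  then have "AE t in lborel. fi i t * \<phi> t = 0" by (rule eventually_mono) (simp add: v_def)
  then have "(LINT t|lborel. fi i t * \<phi> t) = (LINT t|(lborel :: real measure). 0 :: real)"
    by (intro integral_cong_AE) auto
  then show False using fi_mass(2)[of i] by simp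
qed

definition \<psi> :: "'n \<Rightarrow> real \<Rightarrow> real" where
  "\<psi> i = (SOME \<psi>. test_function \<psi> \<and> (LINT t|lborel. v i t * \<psi> t) \<noteq> 0)"

lemma \<psi>_test: "test_function (\<psi> i)" and \<psi>_nonzero: "(LINT t|lborel. v i t * \<psi> i t) \<noteq> 0"
  using someI_ex[OF ex_bump[of i]] unfolding \<psi>_def by auto

definition G_coord :: "'n \<Rightarrow> real ^ 'n \<Rightarrow> real" where "G_coord i x = G x \<bullet> axis i 1"

lemma G_coord_locally_integrable: "locally_integrable (G_coord i)"
  unfolding G_coord_def[abs_def]
  by (rule locally_integrable_inner) (use weak_gradient_sqrt in \<open>simp add: has_weak_gradient_def\<close>)

lemma G_coord_measurable [measurable]: "G_coord i \<in> borel_measurable borel"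
  using G_coord_locally_integrable by (simp add: locally_integrable_def)

lemma v_test_integrable: "test_function \<eta> \<Longrightarrow> integrable lborel (\<lambda>t. v i t * \<eta> t)"
  by (rule locally_integrable_mult_test_function[OF v_locally_integrable])

text \<open>The weak gradient of \<open>\<surd>f\<close> is tested with a product of test functions; the left-hand side then
  factors into one-dimensional integrals.\<close>

lemma weak_formula:
  assumes \<eta>: "\<And>j. test_function (\<eta> j)" and \<eta>': "test_function \<eta>'" "\<And>t. (\<eta> i has_real_derivative \<eta>' t) (at t)"
  shows "(LINT t|lborel. v i t * \<eta>' t) * (\<Prod>j\<in>UNIV - {i}. LINT t|lborel. v j t * \<eta> j t)
    = - (LINT x|lborel. G_coord i x * coord_prod \<eta> x)"
proof -
  have "\<forall>j. \<exists>\<delta>. (\<forall>t. (\<eta> j has_real_derivative \<delta> t) (at t))"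
    using test_function_real_deriv[OF \<eta>] by metis
  then obtain \<delta>0 where \<delta>0: "\<And>j t. (\<eta> j has_real_derivative \<delta>0 j t) (at t)" by metis
  define \<delta> where "\<delta> = \<delta>0(i := \<eta>')"
  have \<delta>: "(\<eta> j has_real_derivative \<delta> j t) (at t)" for j t
    using \<delta>0 \<eta>'(2) by (simp add: \<delta>_def)
  have int: "integrable lborel (\<lambda>t. v j t * (\<eta>(i := \<eta>')) j t)" for j
    using \<eta> \<eta>' by (intro v_test_integrable) simp
  have "(LINT x|lborel. sqrt (coord_prod fi x) * frechet_derivative (coord_prod \<eta>) (at x) (axis i 1))
      = - (LINT x|lborel. (G x \<bullet> axis i 1) * coord_prod \<eta> x)"
    using weak_gradient_sqrt coord_prod_test_function[of \<eta>, OF \<eta>]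
    by (auto simp: has_weak_gradient_def axis_in_Basis_iff)
  moreover have "sqrt (coord_prod fi x) * frechet_derivative (coord_prod \<eta>) (at x) (axis i 1)
      = coord_prod (\<lambda>j t. v j t * (\<eta>(i := \<eta>')) j t) x" for x
  proof -
    have "frechet_derivative (coord_prod \<eta>) (at x) (axis i 1) = coord_prod (\<eta>(i := \<eta>')) x"
      using coord_prod_frechet_derivative[of \<eta> \<delta>, OF \<delta>] by (simp add: \<delta>_def)
    then show ?thesis by (simp only: sqrt_product coord_prod_mult)
  qed
  ultimately have "(LINT x|lborel. coord_prod (\<lambda>j t. v j t * (\<eta>(i := \<eta>')) j t) x)
      = - (LINT x|lborel. G_coord i x * coord_prod \<eta> x)" by (simp add: G_coord_def)
  moreover have "(LINT x|lborel. coord_prod (\<lambda>j t. v j t * (\<eta>(i := \<eta>')) j t) x)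
      = (\<Prod>j\<in>UNIV. LINT t|lborel. v j t * (\<eta>(i := \<eta>')) j t)"
    by (rule coord_prod_integral[OF int])
  moreover have "(\<Prod>j\<in>UNIV. LINT t|lborel. v j t * (\<eta>(i := \<eta>')) j t)
      = (LINT t|lborel. v i t * \<eta>' t) * (\<Prod>j\<in>UNIV - {i}. LINT t|lborel. v j t * (\<eta>(i := \<eta>')) j t)"
    using prod.remove[of UNIV i "\<lambda>j. LINT t|lborel. v j t * (\<eta>(i := \<eta>')) j t"] by simp
  moreover have "(\<Prod>j\<in>UNIV - {i}. LINT t|lborel. v j t * (\<eta>(i := \<eta>')) j t)
      = (\<Prod>j\<in>UNIV - {i}. LINT t|lborel. v j t * \<eta> j t)"
    by (intro prod.cong) auto
  ultimately show ?thesis by simp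
qed

text \<open>In the product formula the test functions \<open>\<psi> j\<close> for \<open>j \<noteq> i\<close> are kept fixed, with
  \<open>\<integral> v\<^sub>j \<psi>\<^sub>j \<noteq> 0\<close>; dividing by these integrals exhibits a marginal of the \<open>i\<close>-th component of \<open>G\<close>
  as a weak derivative of \<open>\<surd>f\<^sub>i\<close>.\<close>

lemma ex_weak_derivative:
  "\<exists>g V. locally_integrable g \<and> (\<forall>a b. primitive_on a b V g) \<and> (AE t in lborel. v i t = V t)"
proof -
  define H where "H = (\<lambda>x. G_coord i x * (\<Prod>j\<in>UNIV - {i}. \<psi> j (x $ j)))"
  have [measurable]: "\<psi> j \<in> borel_measurable borel" for j
    by (intro borel_measurable_continuous_onI test_function_continuous \<psi>_test)
  have Hm [measurable]: "H \<in> borel_measurable borel" unfolding H_def by measurable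
  have "\<forall>j. \<exists>R. \<forall>t. \<psi> j t \<noteq> 0 \<longrightarrow> \<bar>t\<bar> \<le> R" using test_function_support[OF \<psi>_test] by (metis real_norm_def)
  then obtain R where R: "\<And>j t. \<psi> j t \<noteq> 0 \<Longrightarrow> \<bar>t\<bar> \<le> R j" by metis
  have "\<forall>j. \<exists>B. \<forall>t. \<bar>\<psi> j t\<bar> \<le> B" using test_function_bounded[OF \<psi>_test] by metis
  then obtain B where B: "\<And>j t. \<bar>\<psi> j t\<bar> \<le> B j" by metis
  have Hi: "integrable lborel (\<lambda>x. indicator {-S..S} (x $ i) * H x)" for S
  proof -
    \<comment> \<open>the slab meets the support of the \<open>\<psi> j\<close> in a bounded set\<close>
    let ?r = "\<bar>S\<bar> + (\<Sum>j\<in>UNIV. \<bar>R j\<bar>)" and ?B = "\<Prod>j\<in>UNIV - {i}. B j"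
    have "integrable lborel (\<lambda>x. indicator (cball 0 ?r) x *\<^sub>R G_coord i x)"
      using locally_integrable_set_integrable[OF G_coord_locally_integrable, of "cball 0 ?r"]
      by (simp add: set_integrable_def)
    then have "integrable lborel (\<lambda>x. ?B * (indicator (cball 0 ?r) x *\<^sub>R G_coord i x))" by simp
    then show ?thesis
    proof (rule Bochner_Integration.integrable_bound)
      show "AE x in lborel. norm (indicator {-S..S} (x $ i) * H x) \<le> norm (?B * (indicator (cball 0 ?r) x *\<^sub>R G_coord i x))"
      proof (rule AE_I2)
        fix x :: "real ^ 'n"
        have b: "\<bar>\<Prod>j\<in>UNIV - {i}. \<psi> j (x $ j)\<bar> \<le> ?B"
          unfolding abs_prod by (intro prod_mono) (auto simp: B)
        show "norm (indicator {-S..S} (x $ i) * H x) \<le> norm (?B * (indicator (cball 0 ?r) x *\<^sub>R G_coord i x))"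
        proof (cases "x $ i \<in> {-S..S} \<and> (\<Prod>j\<in>UNIV - {i}. \<psi> j (x $ j)) \<noteq> 0")
          case True
          then have "\<bar>x $ j\<bar> \<le> (if j = i then \<bar>S\<bar> else \<bar>R j\<bar>)" for j
            using R[of j "x $ j"] by (cases "j = i") (auto intro: order_trans[OF _ abs_ge_self])
          then have "(\<Sum>j\<in>UNIV. \<bar>x $ j\<bar>) \<le> (\<Sum>j\<in>UNIV. if j = i then \<bar>S\<bar> else \<bar>R j\<bar>)" by (intro sum_mono)
          also have "\<dots> \<le> (\<Sum>j\<in>UNIV. (if j = i then \<bar>S\<bar> else 0) + \<bar>R j\<bar>)" by (intro sum_mono) auto
          also have "\<dots> = ?r" by (simp add: sum.distrib)
          finally have "x \<in> cball 0 ?r" using norm_le_l1_cart[of x] by simp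
          moreover have "\<bar>G_coord i x\<bar> * \<bar>\<Prod>j\<in>UNIV - {i}. \<psi> j (x $ j)\<bar> \<le> \<bar>G_coord i x\<bar> * \<bar>?B\<bar>"
            using b by (intro mult_left_mono) auto
          ultimately show ?thesis using True by (simp add: H_def abs_mult mult.commute)
        next
          case False
          then have eq: "indicator {-S..S} (x $ i) * H x = 0" by (auto simp: H_def)
          show ?thesis unfolding eq norm_zero by (rule norm_ge_zero)
        qed
      qed
    qed measurable
  qed
  define g0 where "g0 = (\<lambda>t. LINT y|other_coords i. H (insert_coord i (t, y)))"
  have m: "locally_integrable g0"
    "\<And>\<eta>. test_function \<eta> \<Longrightarrow> (LINT t|lborel. g0 t * \<eta> t) = (LINT x|lborel. H x * \<eta> (x $ i))"
    unfolding g0_def by (rule marginal(1)[OF Hm Hi], rule marginal(2)[OF Hm Hi])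
  let ?C = "\<Prod>j\<in>UNIV - {i}. LINT t|lborel. v j t * \<psi> j t"
  have C: "?C \<noteq> 0" using \<psi>_nonzero by simp
  define g where "g = (\<lambda>t. 1 / ?C * g0 t)"
  have gl: "locally_integrable g"
    using m(1) unfolding locally_integrable_def g_def by auto
  have weak: "(LINT t|lborel. v i t * \<eta>' t) = - (LINT t|lborel. g t * \<eta> t)"
    if \<eta>: "test_function \<eta>" "test_function \<eta>'" "\<And>t. (\<eta> has_real_derivative \<eta>' t) (at t)" for \<eta> \<eta>'
  proof -
    let ?\<psi> = "\<psi>(i := \<eta>)"
    have "(LINT t|lborel. v i t * \<eta>' t) * (\<Prod>j\<in>UNIV - {i}. LINT t|lborel. v j t * ?\<psi> j t)
        = - (LINT x|lborel. G_coord i x * coord_prod ?\<psi> x)"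
      by (rule weak_formula) (use \<psi>_test \<eta> in auto)
    moreover have "(\<Prod>j\<in>UNIV - {i}. LINT t|lborel. v j t * ?\<psi> j t) = ?C" by (intro prod.cong) auto
    moreover have "(LINT x|lborel. G_coord i x * coord_prod ?\<psi> x) = (LINT x|lborel. H x * \<eta> (x $ i))"
      by (simp add: coord_prod_update H_def mult_ac)
    ultimately have "(LINT t|lborel. v i t * \<eta>' t) * ?C = - (LINT t|lborel. g0 t * \<eta> t)"
      using m(2)[OF \<eta>(1)] by simp
    moreover have "(LINT t|lborel. g t * \<eta> t) = 1 / ?C * (LINT t|lborel. g0 t * \<eta> t)"
      unfolding g_def by (simp only: mult.assoc integral_mult_right_zero)
    moreover have "a = - b" if "a * c = - x" "b = 1 / c * x" "c \<noteq> 0" for a b c x :: real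
    proof -
      have "a * c = - b * c" using that by simp
      then show ?thesis using that(3) by (simp only: mult_cancel_right) blast
    qed
    ultimately show ?thesis using C by blast
  qed
  from du_Bois_Reymond[OF v_locally_integrable gl weak]
  show ?thesis using gl by metis
qed

text \<open>A weak derivative of \<open>\<surd>f\<^sub>i\<close> together with the continuous representative of \<open>\<surd>f\<^sub>i\<close>.\<close>

definition weak_data :: "'n \<Rightarrow> (real \<Rightarrow> real) \<times> (real \<Rightarrow> real)" where
  "weak_data i = (SOME (g, V). locally_integrable g \<and> (\<forall>a b. primitive_on a b V g) \<and> (AE t in lborel. v i t = V t))"

definition g :: "'n \<Rightarrow> real \<Rightarrow> real" where "g i = fst (weak_data i)"
definition V :: "'n \<Rightarrow> real \<Rightarrow> real" where "V i = snd (weak_data i)"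

lemma g_locally_integrable: "locally_integrable (g i)"
  and V_primitive: "primitive_on a b (V i) (g i)"
  and v_eq_V: "AE t in lborel. v i t = V i t"
proof -
  have "case weak_data i of (d, U) \<Rightarrow> locally_integrable d \<and> (\<forall>a b. primitive_on a b U d) \<and> (AE t in lborel. v i t = U t)"
    unfolding weak_data_def by (rule someI_ex) (use ex_weak_derivative[of i] in auto)
  then show "locally_integrable (g i)" "primitive_on a b (V i) (g i)" "AE t in lborel. v i t = V i t"
    by (auto simp: g_def V_def case_prod_beta)
qed

lemma g_measurable [measurable]: "g i \<in> borel_measurable borel"
  using g_locally_integrable by (simp add: locally_integrable_def)

lemma V_continuous: "continuous_on S (V i)"
  by (rule continuous_on_subset[OF continuous_on_UNIV_if_primitive_on[OF V_primitive]]) simp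

lemma V_measurable [measurable]: "V i \<in> borel_measurable borel"
  by (rule borel_measurable_continuous_onI[OF V_continuous])

lemma v_weak_derivative:
  assumes \<eta>: "test_function \<eta>" "test_function \<eta>'" "\<And>t. (\<eta> has_real_derivative \<eta>' t) (at t)"
  shows "(LINT t|lborel. v i t * \<eta>' t) = - (LINT t|lborel. g i t * \<eta> t)"
proof -
  obtain R1 where R1: "\<And>x. \<eta> x \<noteq> 0 \<Longrightarrow> norm x \<le> R1" using test_function_support[OF \<eta>(1)] by blast
  obtain R2 where R2: "\<And>x. \<eta>' x \<noteq> 0 \<Longrightarrow> norm x \<le> R2" using test_function_support[OF \<eta>(2)] by blast
  have [measurable]: "\<eta>' \<in> borel_measurable borel"
    by (intro borel_measurable_continuous_onI test_function_continuous \<eta>)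
  have "(LINT t|lborel. v i t * \<eta>' t) = (LINT t|lborel. V i t * \<eta>' t)"
    by (intro integral_cong_AE, measurable, use v_eq_V[of i] in eventually_elim) simp
  also have "\<dots> = - (LINT t|lborel. g i t * \<eta> t)"
  proof (rule primitive_weak_derivative[OF V_primitive \<eta>(3) test_function_continuous[OF \<eta>(2)], where R = "max R1 R2"])
    show "\<eta> x = 0" if "max R1 R2 < \<bar>x\<bar>" for x using R1[of x] that by (cases "\<eta> x = 0") auto
    show "\<eta>' x = 0" if "max R1 R2 < \<bar>x\<bar>" for x using R2[of x] that by (cases "\<eta>' x = 0") auto
  qed
  finally show ?thesis .
qed

text \<open>Both sides have the same integrals against box-shaped bumps, by the product formula and the
  one-dimensional weak derivative.\<close>

lemma G_coord_AE: "AE x in lborel. G_coord i x = coord_prod (v(i := g i)) x"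
proof -
  let ?P = "coord_prod (v(i := g i))"
  have P: "locally_integrable ?P"
    by (rule coord_prod_locally_integrable) (use v_locally_integrable g_locally_integrable in simp)
  have "AE x in lborel. G_coord i x - ?P x = 0"
  proof (rule AE_zero_if_orthogonal_to_bumps[OF locally_integrable_diff[OF G_coord_locally_integrable P]])
    fix n and l r :: "real ^ 'n"
    define \<beta> where "\<beta> = (\<lambda>j. bump n (l $ j) (r $ j))"
    have \<beta>t: "test_function (\<beta> j)" for j unfolding \<beta>_def by (rule bump_test_function)
    obtain \<beta>' where \<beta>': "\<And>x. (\<beta> i has_real_derivative \<beta>' x) (at x)" "test_function \<beta>'"
      using test_function_real_deriv[OF \<beta>t] by blast
    have int: "integrable lborel (\<lambda>t. (v(i := g i)) j t * \<beta> j t)" for j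
      using v_test_integrable[OF \<beta>t] locally_integrable_mult_test_function[OF g_locally_integrable \<beta>t] by simp
    have "(LINT x|lborel. ?P x * coord_prod \<beta> x) = (\<Prod>j\<in>UNIV. LINT t|lborel. (v(i := g i)) j t * \<beta> j t)"
      unfolding coord_prod_mult by (rule coord_prod_integral[OF int])
    also have "\<dots> = (LINT t|lborel. g i t * \<beta> i t) * (\<Prod>j\<in>UNIV - {i}. LINT t|lborel. (v(i := g i)) j t * \<beta> j t)"
      using prod.remove[of UNIV i "\<lambda>j. LINT t|lborel. (v(i := g i)) j t * \<beta> j t"] by simp
    also have "(\<Prod>j\<in>UNIV - {i}. LINT t|lborel. (v(i := g i)) j t * \<beta> j t) = (\<Prod>j\<in>UNIV - {i}. LINT t|lborel. v j t * \<beta> j t)"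
      by (intro prod.cong) auto
    finally have E: "(LINT x|lborel. ?P x * coord_prod \<beta> x)
        = (LINT t|lborel. g i t * \<beta> i t) * (\<Prod>j\<in>UNIV - {i}. LINT t|lborel. v j t * \<beta> j t)" .
    have "(LINT x|lborel. ?P x * coord_prod \<beta> x) = (LINT x|lborel. G_coord i x * coord_prod \<beta> x)"
      using weak_formula[of \<beta> \<beta>' i, OF \<beta>t \<beta>'(2,1)]
      unfolding v_weak_derivative[OF \<beta>t \<beta>'(2,1)] E by simp
    moreover have "(LINT x|lborel. (G_coord i x - ?P x) * coord_prod \<beta> x)
        = (LINT x|lborel. G_coord i x * coord_prod \<beta> x) - (LINT x|lborel. ?P x * coord_prod \<beta> x)"
      unfolding left_diff_distrib
      by (intro Bochner_Integration.integral_diff locally_integrable_mult_test_function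
          G_coord_locally_integrable P coord_prod_test_function \<beta>t)
    ultimately show "(LINT x|lborel. (G_coord i x - ?P x) * box_bump n l r x) = 0"
      by (simp add: box_bump_vec \<beta>_def)
  qed
  then show ?thesis by (rule eventually_mono) simp
qed

text \<open>By Tonelli the integral of the square of the \<open>i\<close>-th component of \<open>G\<close> is a product, whose factors
  for \<open>j \<noteq> i\<close> are the masses \<open>\<integral> f\<^sub>j \<phi> = 1\<close>.\<close>

lemma g_square_integrable: "integrable lborel (\<lambda>t. (g i t)\<^sup>2 * \<phi> t)"
proof -
  define w where "w = (\<lambda>j t. ((v(i := g i)) j t)\<^sup>2 * \<phi> t)"
  have [measurable]: "w j \<in> borel_measurable borel" for j unfolding w_def by (cases "j = i") simp_all
  have Gm: "G \<in> borel_measurable borel"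
    using weak_gradient_sqrt by (simp add: has_weak_gradient_def locally_integrable_def)
  then have [measurable]: "(\<lambda>x. (norm (G x))\<^sup>2) \<in> borel_measurable borel" by measurable
  have "integrable lborel (\<lambda>x. (norm (G x))\<^sup>2 * \<gamma> x)"
    using gradient_square_integrable integral_gaussian_vec(2)[of "\<lambda>x. (norm (G x))\<^sup>2"] by simp
  then have i1: "integrable lborel (\<lambda>x. (G_coord i x)\<^sup>2 * \<gamma> x)"
  proof (rule Bochner_Integration.integrable_bound)
    show "AE x in lborel. norm ((G_coord i x)\<^sup>2 * \<gamma> x) \<le> norm ((norm (G x))\<^sup>2 * \<gamma> x)"
    proof (rule AE_I2)
      fix x
      have "\<bar>G_coord i x\<bar> \<le> norm (G x)"
        unfolding G_coord_def using Cauchy_Schwarz_ineq2[of "G x" "axis i 1"] by simp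
      then have "(G_coord i x)\<^sup>2 \<le> (norm (G x))\<^sup>2" by (simp add: abs_le_square_iff[symmetric])
      then show "norm ((G_coord i x)\<^sup>2 * \<gamma> x) \<le> norm ((norm (G x))\<^sup>2 * \<gamma> x)"
        using \<gamma>_pos[of x] by (simp add: mult_right_mono)
    qed
  qed measurable
  have ae: "AE x in lborel. (G_coord i x)\<^sup>2 * \<gamma> x = coord_prod w x"
    using G_coord_AE[of i]
  proof eventually_elim
    case (elim x)
    then show ?case by (simp add: coord_prod_def w_def prod.distrib prod_power_distrib)
  qed
  have "coord_prod w \<in> borel_measurable lborel" by measurable
  from integrable_cong_AE_imp[OF i1 this] ae have "integrable lborel (coord_prod w)" by (simp add: eq_commute)
  then have "(\<integral>\<^sup>+x. ennreal (coord_prod w x) \<partial>lborel) < \<infinity>"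
  proof -
    assume "integrable lborel (coord_prod w)"
    then have "(\<integral>\<^sup>+x. ennreal (norm (coord_prod w x)) \<partial>lborel) < \<infinity>" by (simp add: integrable_iff_bounded)
    moreover have "0 \<le> coord_prod w x" for x unfolding coord_prod_def w_def by (intro prod_nonneg) simp
    ultimately show ?thesis by simp
  qed
  also have "(\<integral>\<^sup>+x. ennreal (coord_prod w x) \<partial>lborel) = (\<Prod>j\<in>UNIV. \<integral>\<^sup>+t. ennreal (w j t) \<partial>lborel)"
    by (rule coord_prod_nn_integral) (simp_all add: w_def)
  also have "\<dots> = (\<integral>\<^sup>+t. ennreal (w i t) \<partial>lborel) * (\<Prod>j\<in>UNIV - {i}. \<integral>\<^sup>+t. ennreal (w j t) \<partial>lborel)"
    using prod.remove[of UNIV i "\<lambda>j. \<integral>\<^sup>+t. ennreal (w j t) \<partial>lborel"] by simp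
  also have "(\<Prod>j\<in>UNIV - {i}. \<integral>\<^sup>+t. ennreal (w j t) \<partial>lborel) = 1"
  proof (rule prod.neutral, rule ballI)
    fix j assume "j \<in> UNIV - {i}"
    then have "(\<integral>\<^sup>+t. ennreal (w j t) \<partial>lborel) = (\<integral>\<^sup>+t. ennreal (fi j t * \<phi> t) \<partial>lborel)"
      by (intro nn_integral_cong_AE, use fi_nonneg_AE[of j] in eventually_elim) (simp add: w_def v_sq)
    also have "\<dots> = ennreal (LINT t|lborel. fi j t * \<phi> t)"
      by (rule nn_integral_eq_integral[OF fi_mass(1)], use fi_nonneg_AE[of j] in eventually_elim) simp
    finally show "(\<integral>\<^sup>+t. ennreal (w j t) \<partial>lborel) = 1" by (simp add: fi_mass)
  qed
  finally have "(\<integral>\<^sup>+t. ennreal (w i t) \<partial>lborel) < \<infinity>" by simp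
  then have "integrable lborel (w i)"
    by (intro integrableI_nonneg) (auto simp: w_def)
  then show ?thesis by (simp add: w_def)
qed

definition F :: "'n \<Rightarrow> real \<Rightarrow> real" where "F i t = V i t * V i t"
text \<open>The derivative of \<open>V\<^sup>2\<close> by the product rule. It vanishes where \<open>V\<close> does, whatever \<open>g\<close> is there.\<close>

definition h :: "'n \<Rightarrow> real \<Rightarrow> real" where "h i t = g i t * V i t + g i t * V i t"

lemma F_eq_fi: "AE t in lborel. F i t = fi i t"
  using v_eq_V[of i] fi_nonneg_AE[of i]
proof eventually_elim
  case (elim t)
  then have "F i t = (v i t)\<^sup>2" by (simp add: F_def power2_eq_square)
  from this v_sq[of i t] have "F i t = \<bar>fi i t\<bar>" by (rule trans)
  with elim(2) show ?case by simp
qed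

lemma F_measurable [measurable]: "F i \<in> borel_measurable borel"
  unfolding F_def by measurable

lemma h_measurable [measurable]: "h i \<in> borel_measurable borel"
  unfolding h_def by measurable

lemma F_integral:
  "w \<in> borel_measurable borel \<Longrightarrow> (LINT t|lborel. w t * (F i t * \<phi> t)) = (LINT t|lborel. w t * (fi i t * \<phi> t))"
  "w \<in> borel_measurable borel \<Longrightarrow> integrable lborel (\<lambda>t. w t * (F i t * \<phi> t)) \<longleftrightarrow> integrable lborel (\<lambda>t. w t * (fi i t * \<phi> t))"
proof -
  assume [measurable]: "w \<in> borel_measurable borel"
  have ae: "AE t in lborel. w t * (F i t * \<phi> t) = w t * (fi i t * \<phi> t)"
    using F_eq_fi[of i] by eventually_elim simp
  show "(LINT t|lborel. w t * (F i t * \<phi> t)) = (LINT t|lborel. w t * (fi i t * \<phi> t))"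
    by (rule integral_cong_AE[OF _ _ ae]) measurable
  show "integrable lborel (\<lambda>t. w t * (F i t * \<phi> t)) \<longleftrightarrow> integrable lborel (\<lambda>t. w t * (fi i t * \<phi> t))"
    by (rule integrable_cong_AE[OF _ _ ae]) measurable
qed

lemma fi_moment: "integrable lborel (\<lambda>t. t\<^sup>2 * (fi i t * \<phi> t))" "(LINT t|lborel. t\<^sup>2 * (fi i t * \<phi> t)) \<le> M"
proof -
  have m: "(\<lambda>t. \<bar>t\<bar>\<^sup>2 * fi i t) \<in> borel_measurable borel" by measurable
  show "integrable lborel (\<lambda>t. t\<^sup>2 * (fi i t * \<phi> t))" "(LINT t|lborel. t\<^sup>2 * (fi i t * \<phi> t)) \<le> M"
    using moment_fi_integrable[of i] moment_fi_le[of i]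
    unfolding integral_gaussian_real(1)[OF m] integral_gaussian_real(2)[OF m] by (simp_all add: mult.assoc)
qed

lemma fi_first_moment: "integrable lborel (\<lambda>t. t * (fi i t * \<phi> t))"
proof (rule Bochner_Integration.integrable_bound)
  show "integrable lborel (\<lambda>t. fi i t * \<phi> t + t\<^sup>2 * (fi i t * \<phi> t))"
    using fi_mass(1) fi_moment(1) by (rule Bochner_Integration.integrable_add)
  show "AE t in lborel. norm (t * (fi i t * \<phi> t)) \<le> norm (fi i t * \<phi> t + t\<^sup>2 * (fi i t * \<phi> t))"
    using fi_nonneg_AE[of i]
  proof eventually_elim
    case (elim t)
    then have "\<bar>t\<bar> * (fi i t * \<phi> t) \<le> (1 + t\<^sup>2) * (fi i t * \<phi> t)"
      by (intro mult_right_mono abs_le_1_plus_square) simp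
    then show ?case using elim by (simp add: abs_mult algebra_simps)
  qed
qed measurable

lemma product_nonneg_AE: "AE x in lborel. 0 \<le> coord_prod fi x"
proof -
  have "AE x in lborel. \<forall>i\<in>UNIV. 0 \<le> fi i (x $ i)"
    by (rule AE_finite_allI) (auto intro: AE_coord fi_nonneg_AE)
  then show ?thesis by (rule eventually_mono) (auto simp: coord_prod_def intro: prod_nonneg)
qed

text \<open>The mean of the product in the direction \<open>i\<close> is the mean of the \<open>i\<close>-th factor times the masses of
  the others.\<close>

lemma fi_mean: "(LINT t|lborel. t * (fi i t * \<phi> t)) = 0"
proof -
  let ?\<mu> = "density gaussian (\<lambda>x. ennreal (coord_prod fi x))"
  have [measurable]: "coord_prod fi \<in> borel_measurable borel" by measurable
  have "integrable ?\<mu> (\<lambda>x. x)" "(LINT x|?\<mu>. x) = 0" using centered_product by (auto simp: centered_def)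
  then have "(LINT x|?\<mu>. x \<bullet> axis i 1) = 0"
    using integral_inner_left[of "axis i 1" ?\<mu> "\<lambda>x. x"] by simp
  then have "(LINT x|?\<mu>. x $ i) = 0" by (simp add: inner_axis)
  moreover have "(LINT x|?\<mu>. x $ i) = (LINT x|gaussian. coord_prod fi x * x $ i)"
  proof (subst integral_density)
    show "AE x in gaussian. 0 \<le> coord_prod fi x" unfolding AE_gaussian_vec by (rule product_nonneg_AE)
  qed (simp_all add: gaussian_vec_eq)
  moreover have "\<dots> = (LINT x|lborel. coord_prod fi x * x $ i * \<gamma> x)"
    by (rule integral_gaussian_vec(1)) measurable
  moreover have "coord_prod fi x * x $ i * \<gamma> x = coord_prod ((\<lambda>j t. fi j t * \<phi> t)(i := (\<lambda>t. t * (fi i t * \<phi> t)))) x" for x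
  proof -
    have "coord_prod fi x * \<gamma> x = (fi i (x $ i) * \<phi> (x $ i)) * (\<Prod>j\<in>UNIV - {i}. fi j (x $ j) * \<phi> (x $ j))"
      unfolding coord_prod_mult unfolding coord_prod_def by (rule prod.remove) simp_all
    then show ?thesis unfolding coord_prod_update by (simp add: mult_ac)
  qed
  ultimately have "(LINT x|lborel. coord_prod ((\<lambda>j t. fi j t * \<phi> t)(i := (\<lambda>t. t * (fi i t * \<phi> t)))) x) = 0" by simp
  moreover have "integrable lborel (((\<lambda>j t. fi j t * \<phi> t)(i := (\<lambda>t. t * (fi i t * \<phi> t)))) j)" for j
    using fi_mass(1) fi_first_moment by simp
  ultimately have "(\<Prod>j\<in>UNIV. LINT t|lborel. ((\<lambda>j t. fi j t * \<phi> t)(i := (\<lambda>t. t * (fi i t * \<phi> t)))) j t) = 0"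
    by (simp only: coord_prod_integral)
  then obtain j where "(LINT t|lborel. ((\<lambda>j t. fi j t * \<phi> t)(i := (\<lambda>t. t * (fi i t * \<phi> t)))) j t) = 0" by auto
  then show ?thesis using fi_mass(2)[of j] by (cases "j = i") auto
qed

lemma h_sq_div_F: "(h i t)\<^sup>2 / F i t \<le> 4 * (g i t)\<^sup>2" "0 \<le> (h i t)\<^sup>2 / F i t"
proof -
  have "(h i t)\<^sup>2 / F i t = (if V i t = 0 then 0 else 4 * (g i t)\<^sup>2)"
    by (simp add: h_def F_def power2_eq_square field_simps)
  then show "(h i t)\<^sup>2 / F i t \<le> 4 * (g i t)\<^sup>2" "0 \<le> (h i t)\<^sup>2 / F i t" by auto
qed

lemma factor_sobolev_density: "sobolev_density (F i) (h i) M"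
proof
  show "0 \<le> F i t" for t by (simp add: F_def)
  show "primitive_on a b (F i) (h i)" for a b
    unfolding F_def[abs_def] h_def[abs_def] by (rule primitive_on_mult[OF V_primitive V_primitive])
  show "h i t = 0" if "F i t = 0" for t using that by (simp add: F_def h_def)
  show "h i \<in> borel_measurable borel" by measurable
  have "integrable lborel (\<lambda>t. 4 * ((g i t)\<^sup>2 * \<phi> t))" using g_square_integrable by simp
  then show "integrable lborel (\<lambda>t. (h i t)\<^sup>2 / F i t * \<phi> t)"
  proof (rule Bochner_Integration.integrable_bound)
    show "AE t in lborel. norm ((h i t)\<^sup>2 / F i t * \<phi> t) \<le> norm (4 * ((g i t)\<^sup>2 * \<phi> t))"
    proof (rule AE_I2)
      fix t
      have "(h i t)\<^sup>2 / F i t * \<phi> t \<le> 4 * (g i t)\<^sup>2 * \<phi> t" by (rule mult_right_mono[OF h_sq_div_F(1)]) simp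
      moreover have "0 \<le> (h i t)\<^sup>2 / F i t * \<phi> t" by (intro mult_nonneg_nonneg h_sq_div_F(2)) simp
      ultimately show "norm ((h i t)\<^sup>2 / F i t * \<phi> t) \<le> norm (4 * ((g i t)\<^sup>2 * \<phi> t))"
        unfolding real_norm_def by linarith
    qed
  qed measurable
  show "integrable lborel (\<lambda>t. F i t * \<phi> t)" "(LINT t|lborel. F i t * \<phi> t) = 1"
    using F_integral[of "\<lambda>_. 1" i] fi_mass by simp_all
  show "integrable lborel (\<lambda>t. t\<^sup>2 * (F i t * \<phi> t))" "(LINT t|lborel. t\<^sup>2 * (F i t * \<phi> t)) \<le> M"
    using F_integral[of "\<lambda>t. t\<^sup>2" i] fi_moment by simp_all
  show "(LINT t|lborel. t * (F i t * \<phi> t)) = 0"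
    using F_integral(1)[of "\<lambda>t. t" i] fi_mean by simp
qed

end

section \<open>The weak gradient of the product\<close>

lemma insert_coord_deriv:
  fixes \<zeta> :: "real ^ 'n::finite \<Rightarrow> real"
  assumes "test_function \<zeta>"
  shows "((\<lambda>t. \<zeta> (insert_coord i (t, y))) has_real_derivative
      frechet_derivative \<zeta> (at (insert_coord i (t, y))) (axis i 1)) (at t)"
proof -
  have "C_k (Suc 0) \<zeta>" using assms unfolding test_function_def by blast
  then have "\<zeta> differentiable (at x)" for x by simp
  then have d: "(\<zeta> has_derivative frechet_derivative \<zeta> (at x)) (at x)" for x
    by (simp add: frechet_derivative_works[symmetric])
  have eq: "insert_coord i (s, y) = insert_coord i (0, y) + s *\<^sub>R axis i 1" for s
    by (auto simp: vec_eq_iff axis_def)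
  have "((\<lambda>s. insert_coord i (0, y) + s *\<^sub>R axis i 1) has_derivative (\<lambda>s. s *\<^sub>R axis i 1)) (at t)"
    by (auto intro!: derivative_eq_intros)
  then have "((\<lambda>s. insert_coord i (s, y)) has_derivative (\<lambda>s. s *\<^sub>R axis i 1)) (at t)"
    unfolding eq[symmetric] .
  from has_derivative_compose[OF this d]
  have c: "((\<lambda>s. \<zeta> (insert_coord i (s, y))) has_derivative
      (\<lambda>s. frechet_derivative \<zeta> (at (insert_coord i (t, y))) (s *\<^sub>R axis i 1))) (at t)" .
  have "frechet_derivative \<zeta> (at (insert_coord i (t, y))) (s *\<^sub>R axis i 1)
      = frechet_derivative \<zeta> (at (insert_coord i (t, y))) (axis i 1) * s" for s
    using linear_scale[OF has_derivative_linear[OF d], of "insert_coord i (t, y)" s "axis i 1"] by simp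
  then show ?thesis using c unfolding has_field_derivative_def by simp
qed

lemma frechet_derivative_test_function:
  fixes \<zeta> :: "'a::euclidean_space \<Rightarrow> real"
  assumes \<zeta>: "test_function \<zeta>" and b: "b \<in> Basis"
  shows "test_function (\<lambda>x. frechet_derivative \<zeta> (at x) b)"
proof (rule test_function_boundedI)
  show "C_k k (\<lambda>x. frechet_derivative \<zeta> (at x) b)" for k
  proof -
    have "C_k (Suc k) \<zeta>" using \<zeta> unfolding test_function_def by blast
    then show ?thesis using b by simp
  qed
  obtain R where R: "\<And>x. \<zeta> x \<noteq> 0 \<Longrightarrow> norm x \<le> R" using test_function_support[OF \<zeta>] by blast
  have "frechet_derivative \<zeta> (at x) b = 0" if x: "R < norm x" for x
  proof -
    have o: "open {y. R < norm (y :: 'a)}" by (intro open_Collect_less continuous_intros)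
    have "((\<lambda>y. 0) has_derivative (\<lambda>y. 0)) (at x)" by simp
    then have "(\<zeta> has_derivative (\<lambda>y. 0)) (at x)"
      by (rule has_derivative_transform_within_open[OF _ o]) (use x R in force)+
    then have "(\<lambda>y. 0) = frechet_derivative \<zeta> (at x)" by (rule frechet_derivative_at)
    from fun_cong[OF this, of b] show ?thesis by simp
  qed
  then have "{x. frechet_derivative \<zeta> (at x) b \<noteq> 0} \<subseteq> cball 0 R" by force
  then show "bounded {x. frechet_derivative \<zeta> (at x) b \<noteq> 0}" by (rule bounded_subset[OF bounded_cball])
qed

lemma has_weak_gradient_unique:
  fixes W W' :: "real ^ 'n::finite \<Rightarrow> real ^ 'n"
  assumes "has_weak_gradient u W" "has_weak_gradient u W'"
  shows "AE x in lborel. W x = W' x"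
proof -
  have W: "locally_integrable W" "locally_integrable W'" using assms by (auto simp: has_weak_gradient_def)
  have "AE x in lborel. W x \<bullet> b - W' x \<bullet> b = 0" if b: "b \<in> Basis" for b
  proof (rule AE_zero_if_orthogonal_to_bumps[OF locally_integrable_diff[OF locally_integrable_inner[OF W(1)] locally_integrable_inner[OF W(2)]]])
    fix n and l r :: "real ^ 'n"
    have "(LINT x|lborel. (W x \<bullet> b - W' x \<bullet> b) * box_bump n l r x)
        = (LINT x|lborel. (W x \<bullet> b) * box_bump n l r x) - (LINT x|lborel. (W' x \<bullet> b) * box_bump n l r x)"
      unfolding left_diff_distrib
      by (intro Bochner_Integration.integral_diff locally_integrable_mult_test_function locally_integrable_inner W box_bump_test_function)
    moreover have "(LINT x|lborel. u x * frechet_derivative (box_bump n l r) (at x) b)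
        = - (LINT x|lborel. (U x \<bullet> b) * box_bump n l r x)" if "has_weak_gradient u U" for U
      using that b box_bump_test_function[of n l r] unfolding has_weak_gradient_def by blast
    from this[OF assms(1)] this[OF assms(2)]
    have "(LINT x|lborel. (W x \<bullet> b) * box_bump n l r x) = (LINT x|lborel. (W' x \<bullet> b) * box_bump n l r x)"
      by linarith
    ultimately show "(LINT x|lborel. (W x \<bullet> b - W' x \<bullet> b) * box_bump n l r x) = 0" by simp
  qed
  then have "AE x in lborel. \<forall>b\<in>Basis. W x \<bullet> b - W' x \<bullet> b = 0"
    by (intro AE_finite_allI) auto
  then show ?thesis by (rule eventually_mono) (auto intro: euclidean_eqI)
qed

text \<open>Telescoping: the factors are replaced by \<open>1\<close> one after the other.\<close>

lemma abs_prod_minus_1_le: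
  fixes a :: "'i \<Rightarrow> real"
  assumes "finite A" "\<And>i. i \<in> A \<Longrightarrow> 0 \<le> a i" "distinct xs" "set xs = A"
  shows "\<bar>(\<Prod>i\<in>A. a i) - 1\<bar> \<le> (\<Sum>k<length xs. \<bar>a (xs ! k) - 1\<bar> * (\<Prod>i\<in>set (drop (Suc k) xs). a i))"
  using assms
proof (induction xs arbitrary: A)
  case (Cons j js)
  have A: "A = insert j (set js)" "j \<notin> set js" using Cons.prems by auto
  have js: "0 \<le> (\<Prod>i\<in>set js. a i)" using Cons.prems by (intro prod_nonneg) auto
  have "(\<Prod>i\<in>A. a i) - 1 = (a j - 1) * (\<Prod>i\<in>set js. a i) + ((\<Prod>i\<in>set js. a i) - 1)"
    using A by (simp add: algebra_simps)
  then have "\<bar>(\<Prod>i\<in>A. a i) - 1\<bar> \<le> \<bar>a j - 1\<bar> * (\<Prod>i\<in>set js. a i) + \<bar>(\<Prod>i\<in>set js. a i) - 1\<bar>"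
    using abs_triangle_ineq[of "(a j - 1) * (\<Prod>i\<in>set js. a i)" "(\<Prod>i\<in>set js. a i) - 1"] js
    by (simp add: abs_mult)
  also have "\<bar>(\<Prod>i\<in>set js. a i) - 1\<bar> \<le> (\<Sum>k<length js. \<bar>a (js ! k) - 1\<bar> * (\<Prod>i\<in>set (drop (Suc k) js). a i))"
    using Cons.prems by (intro Cons.IH) auto
  finally show ?case by (simp add: sum.lessThan_Suc_shift del: sum.lessThan_Suc)
qed simp

context product_sobolev
begin

interpretation D: sobolev_density "F i" "h i" M for i
  by (rule factor_sobolev_density)

lemma F_mass: "integrable lborel (\<lambda>t. F i t * \<phi> t)" "(LINT t|lborel. F i t * \<phi> t) = 1"
  by (rule D.mass_integrable, rule D.mass_1)

lemma product_eq_F: "AE x in lborel. coord_prod fi x = coord_prod F x"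
proof -
  have "AE x in lborel. \<forall>i\<in>UNIV. F i (x $ i) = fi i (x $ i)"
    by (rule AE_finite_allI) (auto intro: AE_coord F_eq_fi)
  then show ?thesis by (rule eventually_mono) (auto simp: coord_prod_def)
qed

lemma F_locally_integrable: "locally_integrable (F i)"
  by (rule continuous_locally_integrable) (rule D.f_continuous)

lemma h_locally_integrable: "locally_integrable (h i)"
proof -
  have "set_integrable lborel K (h i)" if K: "compact K" for K
  proof -
    obtain R where R: "\<And>t. t \<in> K \<Longrightarrow> \<bar>t\<bar> \<le> R" using compact_imp_bounded[OF K] by (auto simp: bounded_iff)
    have "K \<subseteq> {-\<bar>R\<bar>..\<bar>R\<bar>}" using R by force
    moreover have "set_integrable lborel {-\<bar>R\<bar>..\<bar>R\<bar>} (h i)"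
      by (rule primitive_on_integrable[OF D.f_primitive]) simp
    ultimately show ?thesis
      by (intro set_integrable_subset[of lborel "{-\<bar>R\<bar>..\<bar>R\<bar>}" "h i" K]) (use K in \<open>auto simp: compact_imp_closed\<close>)
  qed
  then show ?thesis by (simp add: locally_integrable_def)
qed

definition DF :: "real ^ 'n \<Rightarrow> real ^ 'n" where
  "DF x = (\<chi> i. coord_prod (F(i := h i)) x)"

lemma DF_inner_axis: "DF x \<bullet> axis i 1 = coord_prod (F(i := h i)) x"
  by (simp add: DF_def inner_axis)

lemma partial_locally_integrable: "locally_integrable (coord_prod (F(i := h i)))"
  by (rule coord_prod_locally_integrable) (use F_locally_integrable h_locally_integrable in simp)

lemma DF_locally_integrable: "locally_integrable DF"
  unfolding locally_integrable_def
proof (intro conjI allI impI)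
  show DFm: "DF \<in> borel_measurable borel"
    unfolding DF_def[abs_def]
    by (rule vec_lambda_measurable) (use partial_locally_integrable in \<open>simp add: locally_integrable_def\<close>)
  fix K :: "(real ^ 'n) set" assume K: "compact K"
  have eq: "indicator K x *\<^sub>R DF x = (\<Sum>i\<in>UNIV. (indicator K x *\<^sub>R coord_prod (F(i := h i)) x) *\<^sub>R axis i 1)" for x
    by (simp add: vec_eq_iff DF_def axis_def sum_component if_distrib cong: if_cong)
  have "integrable lborel (\<lambda>x. \<Sum>i\<in>UNIV. (indicator K x *\<^sub>R coord_prod (F(i := h i)) x) *\<^sub>R axis i (1::real))"
    using partial_locally_integrable K
    by (intro Bochner_Integration.integrable_sum integrable_scaleR_left)
      (auto simp: locally_integrable_def set_integrable_def)
  then show "set_integrable lborel K DF" unfolding set_integrable_def eq .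
qed

lemma product_locally_integrable: "locally_integrable (coord_prod fi)"
  by (rule coord_prod_locally_integrable) (rule fi_locally_integrable)

text \<open>Fubini with the coordinate \<open>i\<close> inside reduces this to integration by parts on lines, where the
  other factors are constants.\<close>

lemma product_weak_derivative:
  assumes \<zeta>: "test_function \<zeta>"
  shows "(LINT x|lborel. coord_prod fi x * frechet_derivative \<zeta> (at x) (axis i 1))
    = - (LINT x|lborel. coord_prod (F(i := h i)) x * \<zeta> x)"
proof -
  interpret O: sigma_finite_measure "other_coords i" by (rule product_lborel.sigma_finite) simp
  interpret pair_sigma_finite lborel "other_coords i" ..
  let ?d = "\<lambda>x. frechet_derivative \<zeta> (at x) (axis i 1)"
  have dt: "test_function ?d"
    by (rule frechet_derivative_test_function[OF \<zeta>]) (simp add: axis_in_Basis_iff)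
  have [measurable]: "?d \<in> borel_measurable borel" "\<zeta> \<in> borel_measurable borel"
    by (intro borel_measurable_continuous_onI test_function_continuous dt \<zeta>)+
  have FL: "locally_integrable (coord_prod F)" by (rule coord_prod_locally_integrable) (rule F_locally_integrable)
  have hm: "coord_prod (F(i := h i)) \<in> borel_measurable borel"
    using partial_locally_integrable by (simp add: locally_integrable_def)
  have Fm: "coord_prod F \<in> borel_measurable borel" using FL by (simp add: locally_integrable_def)
  have i1: "integrable lborel (\<lambda>x. coord_prod F x * ?d x)"
    by (rule locally_integrable_mult_test_function[OF FL dt])
  have i2: "integrable lborel (\<lambda>x. coord_prod (F(i := h i)) x * \<zeta> x)"
    by (rule locally_integrable_mult_test_function[OF partial_locally_integrable \<zeta>])
  have m1: "(\<lambda>x. coord_prod F x * ?d x) \<in> borel_measurable borel" using Fm by measurable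
  have m2: "(\<lambda>x. coord_prod (F(i := h i)) x * \<zeta> x) \<in> borel_measurable borel" using hm by measurable
  have n1: "integrable (lborel \<Otimes>\<^sub>M other_coords i) (\<lambda>z. coord_prod F (insert_coord i z) * ?d (insert_coord i z))"
    using i1 unfolding lborel_vec_eq_pair[of i] by (subst (asm) integrable_distr_eq) (simp_all add: m1)
  have n2: "integrable (lborel \<Otimes>\<^sub>M other_coords i) (\<lambda>z. coord_prod (F(i := h i)) (insert_coord i z) * \<zeta> (insert_coord i z))"
    using i2 unfolding lborel_vec_eq_pair[of i] by (subst (asm) integrable_distr_eq) (simp_all add: m2)
  have split: "coord_prod F (insert_coord i (t, y)) = F i t * (\<Prod>j\<in>UNIV - {i}. F j (y j))" for t y
    unfolding coord_prod_def using prod.remove[of UNIV i "\<lambda>j. F j (insert_coord i (t, y) $ j)"] by simp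
  have split': "coord_prod (F(i := h i)) (insert_coord i (t, y)) = h i t * (\<Prod>j\<in>UNIV - {i}. F j (y j))" for t y
    unfolding coord_prod_update by simp
  obtain R where R: "\<And>x. \<zeta> x \<noteq> 0 \<Longrightarrow> norm x \<le> R" using test_function_support[OF \<zeta>] by blast
  obtain R' where R': "\<And>x. ?d x \<noteq> 0 \<Longrightarrow> norm x \<le> R'" using test_function_support[OF dt] by blast
  have "(LINT x|lborel. coord_prod fi x * ?d x) = (LINT x|lborel. coord_prod F x * ?d x)"
  proof (rule integral_cong_AE)
    show "AE x in lborel. coord_prod fi x * ?d x = coord_prod F x * ?d x"
      using product_eq_F by eventually_elim simp
    show "(\<lambda>x. coord_prod fi x * ?d x) \<in> borel_measurable lborel" by measurable
  qed (use m1 in simp)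
  also have "\<dots> = (LINT z|(lborel \<Otimes>\<^sub>M other_coords i). coord_prod F (insert_coord i z) * ?d (insert_coord i z))"
    by (subst lborel_vec_eq_pair[of i], subst integral_distr) (simp_all add: m1)
  also have "\<dots> = (LINT y|other_coords i. LINT t|lborel. coord_prod F (insert_coord i (t, y)) * ?d (insert_coord i (t, y)))"
    using integral_snd[of "\<lambda>t y. coord_prod F (insert_coord i (t, y)) * ?d (insert_coord i (t, y))"] n1
    by (simp add: case_prod_beta')
  also have "\<dots> = (LINT y|other_coords i. - (LINT t|lborel. coord_prod (F(i := h i)) (insert_coord i (t, y)) * \<zeta> (insert_coord i (t, y))))"
  proof (rule Bochner_Integration.integral_cong[OF refl])
    fix y
    let ?c = "\<Prod>j\<in>UNIV - {i}. F j (y j)"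
    have ic: "isCont (\<lambda>t. insert_coord i (t, y)) t" for t
      unfolding isCont_def
    proof (rule vec_tendstoI)
      fix j show "((\<lambda>s. insert_coord i (s, y) $ j) \<longlongrightarrow> insert_coord i (t, y) $ j) (at t)"
        by (cases "j = i") simp_all
    qed
    have cont: "continuous_on UNIV (\<lambda>t. ?d (insert_coord i (t, y)))"
      by (rule continuous_on_compose2[OF test_function_continuous[OF dt, of UNIV] continuous_at_imp_continuous_on])
        (use ic in auto)
    have nrm: "\<bar>t\<bar> \<le> norm (insert_coord i (t, y))" for t
      using component_le_norm_cart[of "insert_coord i (t, y)" i] by simp
    have "(LINT t|lborel. F i t * ?d (insert_coord i (t, y))) = - (LINT t|lborel. h i t * \<zeta> (insert_coord i (t, y)))"
    proof (rule primitive_weak_derivative[OF D.f_primitive insert_coord_deriv[OF \<zeta>] cont, where R = "max R R'"])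
      show "\<zeta> (insert_coord i (t, y)) = 0" if "max R R' < \<bar>t\<bar>" for t
        using R[of "insert_coord i (t, y)"] nrm[of t] that by (cases "\<zeta> (insert_coord i (t, y)) = 0") auto
      show "?d (insert_coord i (t, y)) = 0" if "max R R' < \<bar>t\<bar>" for t
        using R'[of "insert_coord i (t, y)"] nrm[of t] that by (cases "?d (insert_coord i (t, y)) = 0") auto
    qed
    then have "?c * (LINT t|lborel. F i t * ?d (insert_coord i (t, y))) = - (?c * (LINT t|lborel. h i t * \<zeta> (insert_coord i (t, y))))"
      by simp
    then show "(LINT t|lborel. coord_prod F (insert_coord i (t, y)) * ?d (insert_coord i (t, y)))
        = - (LINT t|lborel. coord_prod (F(i := h i)) (insert_coord i (t, y)) * \<zeta> (insert_coord i (t, y)))"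
      unfolding split split' integral_mult_right_zero[symmetric] by (simp add: mult_ac)
  qed
  also have "\<dots> = - (LINT z|(lborel \<Otimes>\<^sub>M other_coords i). coord_prod (F(i := h i)) (insert_coord i z) * \<zeta> (insert_coord i z))"
    using integral_snd[of "\<lambda>t y. coord_prod (F(i := h i)) (insert_coord i (t, y)) * \<zeta> (insert_coord i (t, y))"] n2
    by (simp add: case_prod_beta')
  also have "(LINT z|(lborel \<Otimes>\<^sub>M other_coords i). coord_prod (F(i := h i)) (insert_coord i z) * \<zeta> (insert_coord i z))
      = (LINT x|lborel. coord_prod (F(i := h i)) x * \<zeta> x)"
    by (subst lborel_vec_eq_pair[of i], subst integral_distr) (simp_all add: m2)
  finally show ?thesis .
qed

lemma has_weak_gradient_product: "has_weak_gradient (coord_prod fi) DF"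
  unfolding has_weak_gradient_def
proof (intro conjI allI impI ballI product_locally_integrable DF_locally_integrable)
  fix \<zeta> :: "real ^ 'n \<Rightarrow> real" and b :: "real ^ 'n" assume \<zeta>: "test_function \<zeta>" and "b \<in> Basis"
  then obtain i where b: "b = axis i 1" by (auto simp: Basis_vec_def)
  show "(LINT x|lborel. coord_prod fi x * frechet_derivative \<zeta> (at x) b) = - (LINT x|lborel. (DF x \<bullet> b) * \<zeta> x)"
    unfolding b DF_inner_axis by (rule product_weak_derivative[OF \<zeta>])
qed

lemma weak_gradient_works: "has_weak_gradient (coord_prod fi) (weak_gradient (coord_prod fi))"
  unfolding weak_gradient_def
  by (rule someI[of "has_weak_gradient (coord_prod fi)", OF has_weak_gradient_product])

lemma weak_gradient_product: "AE x in lborel. weak_gradient (coord_prod fi) x = DF x"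
  by (rule has_weak_gradient_unique[OF weak_gradient_works has_weak_gradient_product])

section \<open>Deficit and distance of a product\<close>

lemma coord_prod_single:
  assumes "\<And>j. integrable lborel (\<lambda>t. F j t * \<phi> t)" "integrable lborel (\<lambda>t. w t * \<phi> t)"
  shows "integrable lborel (\<lambda>x. coord_prod (F(i := w)) x * \<gamma> x)"
    and "(LINT x|lborel. coord_prod (F(i := w)) x * \<gamma> x) = (LINT t|lborel. w t * \<phi> t)"
proof -
  have int: "integrable lborel (\<lambda>t. (F(i := w)) j t * \<phi> t)" for j using assms by simp
  show "integrable lborel (\<lambda>x. coord_prod (F(i := w)) x * \<gamma> x)"
    unfolding coord_prod_mult by (rule coord_prod_integrable[OF int])
  have "(LINT x|lborel. coord_prod (F(i := w)) x * \<gamma> x) = (\<Prod>j\<in>UNIV. LINT t|lborel. (F(i := w)) j t * \<phi> t)"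
    unfolding coord_prod_mult by (rule coord_prod_integral[OF int])
  also have "\<dots> = (LINT t|lborel. w t * \<phi> t) * (\<Prod>j\<in>UNIV - {i}. LINT t|lborel. (F(i := w)) j t * \<phi> t)"
    using prod.remove[of UNIV i "\<lambda>j. LINT t|lborel. (F(i := w)) j t * \<phi> t"] by simp
  also have "(\<Prod>j\<in>UNIV - {i}. LINT t|lborel. (F(i := w)) j t * \<phi> t) = 1"
    by (rule prod.neutral) (simp add: F_mass)
  finally show "(LINT x|lborel. coord_prod (F(i := w)) x * \<gamma> x) = (LINT t|lborel. w t * \<phi> t)"
    by (simp only: mult_1_right)
qed

text \<open>Pointwise, the square of the \<open>i\<close>-th partial derivative \<open>h\<^sub>i \<Prod>\<^bsub>j \<noteq> i\<^esub> F\<^sub>j\<close> divided by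
  \<open>\<Prod>\<^sub>j F\<^sub>j\<close> is \<open>(h\<^sub>i\<^sup>2 / F\<^sub>i) \<Prod>\<^bsub>j \<noteq> i\<^esub> F\<^sub>j\<close>. Where some factor vanishes, both sides are
  \<open>0\<close> by the convention \<open>x / 0 = 0\<close>.\<close>

lemma fisher_information_product:
  "fisher_information (coord_prod fi) = (\<Sum>i\<in>UNIV. LINT t|lborel. (h i t)\<^sup>2 / F i t * \<phi> t)"
proof -
  let ?W = "weak_gradient (coord_prod fi)"
  let ?w = "\<lambda>i t. (h i t)\<^sup>2 / F i t"
  have W: "?W \<in> borel_measurable borel"
    using weak_gradient_works by (simp add: has_weak_gradient_def locally_integrable_def)
  have fm: "coord_prod fi \<in> borel_measurable borel" by measurable
  have m: "(\<lambda>x. (norm (?W x))\<^sup>2 / coord_prod fi x) \<in> borel_measurable borel" using W fm by measurable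
  have wm: "coord_prod (F(i := ?w i)) \<in> borel_measurable borel" for i
  proof (rule coord_prod_measurable)
    show "(F(i := ?w i)) j \<in> borel_measurable borel" for j by (cases "j = i") simp_all
  qed
  have gm: "(\<gamma> :: real ^ 'n \<Rightarrow> real) \<in> borel_measurable borel" by (rule coord_prod_measurable) (rule \<phi>_measurable)
  have pw: "(norm (DF x))\<^sup>2 / coord_prod F x = (\<Sum>i\<in>UNIV. coord_prod (F(i := ?w i)) x)" for x
  proof -
    have "(norm (DF x))\<^sup>2 = (\<Sum>i\<in>UNIV. (coord_prod (F(i := h i)) x)\<^sup>2)"
      by (simp add: norm_vec_def L2_set_def sum_nonneg DF_def)
    moreover have "(coord_prod (F(i := h i)) x)\<^sup>2 / coord_prod F x = coord_prod (F(i := ?w i)) x" for i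
    proof -
      have a: "coord_prod F x = F i (x $ i) * (\<Prod>j\<in>UNIV - {i}. F j (x $ j))"
        unfolding coord_prod_def by (rule prod.remove) simp_all
      show ?thesis unfolding coord_prod_update a
        by (simp add: power2_eq_square)
    qed
    ultimately show ?thesis by (simp add: sum_divide_distrib)
  qed
  have "fisher_information (coord_prod fi) = (LINT x|lborel. (norm (?W x))\<^sup>2 / coord_prod fi x * \<gamma> x)"
    unfolding fisher_information_def by (rule integral_gaussian_vec(1)[OF m])
  also have "\<dots> = (LINT x|lborel. (\<Sum>i\<in>UNIV. coord_prod (F(i := ?w i)) x * \<gamma> x))"
  proof (rule integral_cong_AE)
    show "(\<lambda>x. (norm (?W x))\<^sup>2 / coord_prod fi x * \<gamma> x) \<in> borel_measurable lborel"
      using borel_measurable_times[OF m gm] by (simp only: measurable_lborel2)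
    show "(\<lambda>x. \<Sum>i\<in>UNIV. coord_prod (F(i := ?w i)) x * \<gamma> x) \<in> borel_measurable lborel" using wm gm by simp
    show "AE x in lborel. (norm (?W x))\<^sup>2 / coord_prod fi x * \<gamma> x = (\<Sum>i\<in>UNIV. coord_prod (F(i := ?w i)) x * \<gamma> x)"
      using weak_gradient_product product_eq_F
    proof eventually_elim
      case (elim x)
      then show ?case using pw[of x] by (simp only: sum_distrib_right[symmetric])
    qed
  qed
  also have "\<dots> = (\<Sum>i\<in>UNIV. LINT x|lborel. coord_prod (F(i := ?w i)) x * \<gamma> x)"
    by (rule Bochner_Integration.integral_sum) (rule coord_prod_single(1)[OF F_mass(1) D.fisher_integrable])
  also have "\<dots> = (\<Sum>i\<in>UNIV. LINT t|lborel. ?w i t * \<phi> t)"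
    by (intro sum.cong refl coord_prod_single(2) F_mass D.fisher_integrable)
  finally show ?thesis .
qed

lemma relative_entropy_product:
  "relative_entropy (coord_prod fi) = (\<Sum>i\<in>UNIV. LINT t|lborel. F i t * ln (F i t) * \<phi> t)"
proof -
  let ?w = "\<lambda>i t. F i t * ln (F i t)"
  have fm: "coord_prod fi \<in> borel_measurable borel" by measurable
  have m: "(\<lambda>x. coord_prod fi x * ln (coord_prod fi x)) \<in> borel_measurable borel" using fm by measurable
  have wm: "coord_prod (F(i := ?w i)) \<in> borel_measurable borel" for i
  proof (rule coord_prod_measurable)
    show "(F(i := ?w i)) j \<in> borel_measurable borel" for j by (cases "j = i") simp_all
  qed
  have gm: "(\<gamma> :: real ^ 'n \<Rightarrow> real) \<in> borel_measurable borel" by (rule coord_prod_measurable) (rule \<phi>_measurable)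
  have pw: "coord_prod F x * ln (coord_prod F x) = (\<Sum>i\<in>UNIV. coord_prod (F(i := ?w i)) x)" for x
  proof -
    have a: "coord_prod F x = F i (x $ i) * (\<Prod>j\<in>UNIV - {i}. F j (x $ j))" for i
      unfolding coord_prod_def by (rule prod.remove) simp_all
    have t: "coord_prod (F(i := ?w i)) x = coord_prod F x * ln (F i (x $ i))" for i
      unfolding coord_prod_update a[of i] by simp
    show ?thesis
    proof (cases "coord_prod F x = 0")
      case False
      then have pos: "0 < F i (x $ i)" for i
        using D.f_nonneg[of i "x $ i"] by (auto simp: coord_prod_def order_le_less)
      then have "ln (coord_prod F x) = (\<Sum>i\<in>UNIV. ln (F i (x $ i)))"
        unfolding coord_prod_def using pos by (intro ln_prod) (simp_all add: order_less_imp_not_eq2)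
      then show ?thesis unfolding t by (simp add: sum_distrib_left)
    qed (simp add: t)
  qed
  have "relative_entropy (coord_prod fi) = (LINT x|lborel. coord_prod fi x * ln (coord_prod fi x) * \<gamma> x)"
    unfolding relative_entropy_def by (rule integral_gaussian_vec(1)[OF m])
  also have "\<dots> = (LINT x|lborel. (\<Sum>i\<in>UNIV. coord_prod (F(i := ?w i)) x * \<gamma> x))"
  proof (rule integral_cong_AE)
    show "(\<lambda>x. coord_prod fi x * ln (coord_prod fi x) * \<gamma> x) \<in> borel_measurable lborel" using m gm by simp
    show "(\<lambda>x. \<Sum>i\<in>UNIV. coord_prod (F(i := ?w i)) x * \<gamma> x) \<in> borel_measurable lborel" using wm gm by simp
    show "AE x in lborel. coord_prod fi x * ln (coord_prod fi x) * \<gamma> x = (\<Sum>i\<in>UNIV. coord_prod (F(i := ?w i)) x * \<gamma> x)"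
      using product_eq_F
    proof eventually_elim
      case (elim x)
      then show ?case using pw[of x] by (simp only: sum_distrib_right[symmetric])
    qed
  qed
  also have "\<dots> = (\<Sum>i\<in>UNIV. LINT x|lborel. coord_prod (F(i := ?w i)) x * \<gamma> x)"
    by (rule Bochner_Integration.integral_sum) (rule coord_prod_single(1)[OF F_mass(1) D.entropy_integrable])
  also have "\<dots> = (\<Sum>i\<in>UNIV. LINT t|lborel. ?w i t * \<phi> t)"
    by (intro sum.cong refl coord_prod_single(2) F_mass D.entropy_integrable)
  finally show ?thesis .
qed

lemma LSI_deficit_product:
  "LSI_deficit (coord_prod fi) = (\<Sum>i\<in>UNIV. sobolev_density.deficit (F i) (h i))"
  unfolding LSI_deficit_def fisher_information_product relative_entropy_product D.deficit_def
  by (simp add: sum_subtractf sum_divide_distrib)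

lemma L1_distance_product:
  "(LINT x|gaussian. \<bar>coord_prod fi x - 1\<bar>) \<le> (\<Sum>i\<in>UNIV. LINT t|lborel. \<bar>F i t - 1\<bar> * \<phi> t)"
proof -
  obtain ks :: "'n list" where ks: "distinct ks" "set ks = UNIV"
    using finite_distinct_list[of "UNIV :: 'n set"] by auto
  \<comment> \<open>the \<open>k\<close>-th telescoping term times \<open>\<gamma>\<close>, as a product over coordinates\<close>
  define w where "w = (\<lambda>k j t. if j = ks ! k then \<bar>F j t - 1\<bar> * \<phi> t else if j \<in> set (drop (Suc k) ks) then F j t * \<phi> t else \<phi> t)"
  have fm: "coord_prod fi \<in> borel_measurable borel" by measurable
  have Fm: "coord_prod F \<in> borel_measurable borel" by measurable
  have gm: "(\<gamma> :: real ^ 'n \<Rightarrow> real) \<in> borel_measurable borel" by (rule coord_prod_measurable) (rule \<phi>_measurable)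
  have m: "(\<lambda>x. \<bar>coord_prod fi x - 1\<bar>) \<in> borel_measurable borel" using fm by measurable
  have F1: "integrable lborel (\<lambda>t. \<bar>F j t - 1\<bar> * \<phi> t)" for j
  proof -
    have "integrable lborel (\<lambda>t. \<bar>F j t * \<phi> t - \<phi> t\<bar>)"
      by (intro integrable_abs Bochner_Integration.integrable_diff F_mass normal.integrable)
    moreover have "\<bar>F j t * \<phi> t - \<phi> t\<bar> = \<bar>F j t - 1\<bar> * \<phi> t" for t
    proof -
      have "F j t * \<phi> t - \<phi> t = (F j t - 1) * \<phi> t" by (simp add: algebra_simps)
      then show ?thesis by (simp add: abs_mult)
    qed
    ultimately show ?thesis by simp
  qed
  have wi: "integrable lborel (w k j)" for k j
    unfolding w_def using F1 F_mass(1) normal.integrable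
    by (cases "j = ks ! k"; cases "j \<in> set (drop (Suc k) ks)") simp_all
  have notin: "ks ! k \<notin> set (drop (Suc k) ks)" if "k < length ks" for k
    using ks(1) that by (auto simp: in_set_conv_nth nth_eq_iff_index_eq)
  have pw: "\<bar>coord_prod F x - 1\<bar> * \<gamma> x \<le> (\<Sum>k<length ks. coord_prod (w k) x)" for x
  proof -
    have "\<bar>coord_prod F x - 1\<bar> \<le> (\<Sum>k<length ks. \<bar>F (ks ! k) (x $ (ks ! k)) - 1\<bar> * (\<Prod>j\<in>set (drop (Suc k) ks). F j (x $ j)))"
      unfolding coord_prod_def
      by (rule abs_prod_minus_1_le[of UNIV "\<lambda>i. F i (x $ i)" ks]) (use ks D.f_nonneg in auto)
    then have "\<bar>coord_prod F x - 1\<bar> * \<gamma> x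
        \<le> (\<Sum>k<length ks. \<bar>F (ks ! k) (x $ (ks ! k)) - 1\<bar> * (\<Prod>j\<in>set (drop (Suc k) ks). F j (x $ j))) * \<gamma> x"
      using \<gamma>_pos[of x] by (intro mult_right_mono) auto
    also have "\<dots> = (\<Sum>k<length ks. coord_prod (w k) x)"
      unfolding sum_distrib_right
    proof (rule sum.cong[OF refl])
      fix k assume "k \<in> {..<length ks}"
      then have k: "k < length ks" by simp
      let ?a = "\<lambda>j. if j = ks ! k then \<bar>F j (x $ j) - 1\<bar> else 1"
      let ?b = "\<lambda>j. if j \<in> set (drop (Suc k) ks) then F j (x $ j) else 1"
      have "coord_prod (w k) x = (\<Prod>j\<in>UNIV. ?a j * ?b j * \<phi> (x $ j))"
        unfolding coord_prod_def w_def using notin[OF k] by (intro prod.cong) auto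
      also have "\<dots> = (\<Prod>j\<in>UNIV. ?a j) * (\<Prod>j\<in>UNIV. ?b j) * \<gamma> x"
        by (simp only: prod.distrib coord_prod_def)
      also have "(\<Prod>j\<in>UNIV. ?a j) = \<bar>F (ks ! k) (x $ (ks ! k)) - 1\<bar>" by simp
      also have "(\<Prod>j\<in>UNIV. ?b j) = (\<Prod>j\<in>set (drop (Suc k) ks). F j (x $ j))"
        by (simp add: prod.If_cases)
      finally show "\<bar>F (ks ! k) (x $ (ks ! k)) - 1\<bar> * (\<Prod>j\<in>set (drop (Suc k) ks). F j (x $ j)) * \<gamma> x = coord_prod (w k) x"
        by (rule sym)
    qed
    finally show ?thesis .
  qed
  have s: "integrable lborel (\<lambda>x. \<Sum>k<length ks. coord_prod (w k) x)"
    by (intro Bochner_Integration.integrable_sum coord_prod_integrable wi)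
  have "(LINT x|gaussian. \<bar>coord_prod fi x - 1\<bar>) = (LINT x|lborel. \<bar>coord_prod fi x - 1\<bar> * \<gamma> x)"
    by (rule integral_gaussian_vec(1)[OF m])
  also have "\<dots> = (LINT x|lborel. \<bar>coord_prod F x - 1\<bar> * \<gamma> x)"
  proof (rule integral_cong_AE)
    show "AE x in lborel. \<bar>coord_prod fi x - 1\<bar> * \<gamma> x = \<bar>coord_prod F x - 1\<bar> * \<gamma> x"
      using product_eq_F by eventually_elim simp
  qed (use fm Fm gm in simp_all)
  also have "\<dots> \<le> (LINT x|lborel. (\<Sum>k<length ks. coord_prod (w k) x))"
  proof (rule integral_mono[OF _ s])
    show "integrable lborel (\<lambda>x. \<bar>coord_prod F x - 1\<bar> * \<gamma> x)"
    proof (rule Bochner_Integration.integrable_bound[OF s])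
      show "AE x in lborel. norm (\<bar>coord_prod F x - 1\<bar> * \<gamma> x) \<le> norm (\<Sum>k<length ks. coord_prod (w k) x)"
      proof (rule AE_I2)
        fix x
        have "norm (\<bar>coord_prod F x - 1\<bar> * \<gamma> x) = \<bar>coord_prod F x - 1\<bar> * \<gamma> x" using \<gamma>_pos[of x] by simp
        then show "norm (\<bar>coord_prod F x - 1\<bar> * \<gamma> x) \<le> norm (\<Sum>k<length ks. coord_prod (w k) x)"
          using pw[of x] by simp
      qed
    qed (use Fm gm in simp)
  qed (rule pw)
  also have "\<dots> = (\<Sum>k<length ks. LINT x|lborel. coord_prod (w k) x)"
    by (rule Bochner_Integration.integral_sum) (intro coord_prod_integrable wi)
  also have "\<dots> = (\<Sum>k<length ks. LINT t|lborel. \<bar>F (ks ! k) t - 1\<bar> * \<phi> t)"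
  proof (rule sum.cong[OF refl])
    fix k
    have "(LINT x|lborel. coord_prod (w k) x) = (\<Prod>j\<in>UNIV. LINT t|lborel. w k j t)"
      by (rule coord_prod_integral[OF wi])
    also have "\<dots> = (\<Prod>j\<in>UNIV. if j = ks ! k then LINT t|lborel. \<bar>F j t - 1\<bar> * \<phi> t else 1)"
    proof (rule prod.cong[OF refl])
      fix j
      show "(LINT t|lborel. w k j t) = (if j = ks ! k then LINT t|lborel. \<bar>F j t - 1\<bar> * \<phi> t else 1)"
        unfolding w_def
        by (cases "j = ks ! k"; cases "j \<in> set (drop (Suc k) ks)") (simp_all add: F_mass normal.mass)
    qed
    finally show "(LINT x|lborel. coord_prod (w k) x) = (LINT t|lborel. \<bar>F (ks ! k) t - 1\<bar> * \<phi> t)" by simp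
  qed
  also have "\<dots> = (\<Sum>i\<in>UNIV. LINT t|lborel. \<bar>F i t - 1\<bar> * \<phi> t)"
    using sum.reindex_bij_betw[OF bij_betw_nth[OF ks(1) refl ks(2)[symmetric]], of "\<lambda>i. LINT t|lborel. \<bar>F i t - 1\<bar> * \<phi> t"]
    by simp
  finally show ?thesis .
qed

text \<open>If the deficit is \<open>0\<close>, the one-dimensional estimate holds for every \<open>s > 0\<close> and the distance is
  \<open>0\<close>; otherwise \<open>s\<close> is its fourth root.\<close>

lemma product_stability:
  "(LINT x|gaussian. \<bar>coord_prod fi x - 1\<bar>)
     \<le> real CARD('n) * (2 * (10 + (M + 182) * (4 + 2 * M + 5 * (M + 182)))) * LSI_deficit (coord_prod fi) powr (1 / 4)"
proof -
  let ?C = "2 * (10 + (M + 182) * (4 + 2 * M + 5 * (M + 182)))"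
  let ?\<delta> = "LSI_deficit (coord_prod fi)"
  have \<delta>: "sobolev_density.deficit (F i) (h i) \<le> ?\<delta>" for i
    unfolding LSI_deficit_product by (rule member_le_sum) (auto intro: D.deficit_nonneg)
  have \<delta>0: "0 \<le> ?\<delta>" unfolding LSI_deficit_product by (intro sum_nonneg D.deficit_nonneg)
  have *: "(LINT t|lborel. \<bar>F i t - 1\<bar> * \<phi> t) \<le> ?C * s" if "0 < s" "?\<delta> \<le> s ^ 4" for i s
    using D.L1_distance[of s i] that \<delta>[of i] unfolding D.K_def by linarith
  have "(LINT t|lborel. \<bar>F i t - 1\<bar> * \<phi> t) \<le> ?C * ?\<delta> powr (1 / 4)" for i
  proof (cases "?\<delta> = 0")
    case False
    have "(?\<delta> powr (1 / 4)) ^ 4 = ?\<delta>"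
      using False \<delta>0 by (simp add: powr_realpow[symmetric] powr_powr)
    then show ?thesis using False \<delta>0 by (intro *) auto
  next
    case True
    have C: "0 \<le> ?C" using D.M_nonneg by simp
    have "(LINT t|lborel. \<bar>F i t - 1\<bar> * \<phi> t) \<le> 0"
    proof (rule field_le_epsilon)
      fix e :: real assume e: "0 < e"
      have "(LINT t|lborel. \<bar>F i t - 1\<bar> * \<phi> t) \<le> ?C * (e / (?C + 1))"
        using e C True by (intro *) auto
      also have "\<dots> = e * (?C / (?C + 1))" by simp
      also have "\<dots> \<le> e * 1" using e C by (intro mult_left_mono) auto
      finally show "(LINT t|lborel. \<bar>F i t - 1\<bar> * \<phi> t) \<le> 0 + e" by simp
    qed
    then show ?thesis using True by simp
  qed
  then have "(\<Sum>i\<in>UNIV. LINT t|lborel. \<bar>F i t - 1\<bar> * \<phi> t) \<le> (\<Sum>i\<in>(UNIV :: 'n set). ?C * ?\<delta> powr (1 / 4))"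
    by (intro sum_mono) blast
  then show ?thesis using L1_distance_product by simp
qed

end

theorem corollary1p4:
  fixes M :: real
  assumes "M \<ge> 1"
  shows "\<exists>C::real. C > 0 \<and>
    (\<forall>(f :: real ^ 'n \<Rightarrow> real) (fi :: 'n::finite \<Rightarrow> real \<Rightarrow> real).
       (\<forall>x. f x = (\<Prod>i\<in>UNIV. fi i (x $ i))) \<longrightarrow>
       (\<forall>i. gaussian_prob_density (fi i) \<and>
            integrable gaussian (\<lambda>x. \<bar>x\<bar>\<^sup>2 * fi i x) \<and>
            (LINT x|gaussian. \<bar>x\<bar>\<^sup>2 * fi i x) \<le> M) \<longrightarrow>
       gaussian_prob_density f \<longrightarrow>
       centered (density gaussian (\<lambda>x. ennreal (f x))) \<longrightarrow>
       (\<lambda>x. sqrt (f x)) \<in> gaussian_W12 \<longrightarrow>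
       (LINT x|gaussian. \<bar>f x - 1\<bar>) \<le> C * LSI_deficit f powr (1 / 4))"
proof (intro exI conjI allI impI)
  let ?C = "real CARD('n) * (2 * (10 + (M + 182) * (4 + 2 * M + 5 * (M + 182))))"
  show "0 < ?C" using assms by (intro mult_pos_pos add_pos_nonneg mult_nonneg_nonneg) auto
  fix f :: "real ^ 'n \<Rightarrow> real" and fi :: "'n \<Rightarrow> real \<Rightarrow> real"
  assume f: "\<forall>x. f x = (\<Prod>i\<in>UNIV. fi i (x $ i))"
    and fi: "\<forall>i. gaussian_prob_density (fi i) \<and> integrable gaussian (\<lambda>x. \<bar>x\<bar>\<^sup>2 * fi i x) \<and>
      (LINT x|gaussian. \<bar>x\<bar>\<^sup>2 * fi i x) \<le> M"
    and c: "centered (density gaussian (\<lambda>x. ennreal (f x)))"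
    and w: "(\<lambda>x. sqrt (f x)) \<in> gaussian_W12"
  have feq: "f = coord_prod fi" using f by (auto simp: coord_prod_def)
  obtain G where "has_weak_gradient (\<lambda>x. sqrt (f x)) G" "integrable gaussian (\<lambda>x. (norm (G x))\<^sup>2)"
    using w by (auto simp: gaussian_W12_def)
  then interpret product_sobolev fi G M
    by unfold_locales (use fi c feq in auto)
  show "(LINT x|gaussian. \<bar>f x - 1\<bar>) \<le> ?C * LSI_deficit f powr (1 / 4)"
    unfolding feq by (rule product_stability)
qed

end
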